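(* Let $m\ge 3$ and let $W(C_m)$ denote the whiskered cycle. Then $$\operatorname{depth}\bigl(R/I(W(C_m))^{[2]}\bigr)=\begin{cases}3&\text{if } m=3,\\ m+1&\text{if } m>3.\end{cases}$$
   Context: All graphs are finite and simple. Fix a field $\mathbb{K}$. For a graph $G$ with vertex set $V(G)$ (vertices are identified with indeterminates), $R=\mathbb{K}[x\mid x\in V(G)]$ and $I(G)=\langle xy\mid \{x,y\}\in E(G)\rangle\subseteq R$ is the edge ideal. The second square-free power $I(G)^{[2]}$ is the ideal of $R$ generated by the square-free monomials of $I(G)^2$; equivalently it is generated by the products $abcd$ over all pairs of disjoint edges $\{a,b\},\{c,d\}$ of $G$. The whiskered cycle $W(C_m)$ has vertices $x_1,\dots,x_m,y_1,\dots,y_m$ and edges $\{x_i,x_{i+1}\}$ ($1\le i\le m-1$), $\{x_1,x_m\}$, and $\{x_i,y_i\}$ ($1\le i\le m$); here $R$ is the polynomial ring over $\mathbb{K}$ in these $2m$ variables. *)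

theory Defs
  imports
    "HOL-Algebra.QuotRing"
    "HOL-Algebra.Ideal_Product"
    "HOL-Algebra.Module"
    "HOL-Library.Poly_Mapping"
    "HOL-Library.Extended_Nat"
begin

section \<open>Polynomial rings on a set of indeterminates\<close>

text \<open>
  A polynomial is a finitely supported map from exponent vectors to coefficients; sums and
  products are those of \<^theory>\<open>HOL-Library.Poly_Mapping\<close>.  The indeterminates of the ring form
  a subset of the type of indeterminates.
\<close>

type_synonym ('v, 'k) mpoly = "('v \<Rightarrow>\<^sub>0 nat) \<Rightarrow>\<^sub>0 'k"

definition poly_ring :: "'v set \<Rightarrow> ('v, 'k::field) mpoly ring" where
  "poly_ring V =
    \<lparr>carrier = {p. \<forall>t \<in> Poly_Mapping.keys p. Poly_Mapping.keys t \<subseteq> V},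
     mult = (*), one = 1, zero = 0, add = (+)\<rparr>"

definition monomial :: "('v \<Rightarrow>\<^sub>0 nat) \<Rightarrow> ('v, 'k::field) mpoly" where
  "monomial t = Poly_Mapping.single t 1"

definition indet :: "'v \<Rightarrow> ('v, 'k::field) mpoly" where
  "indet x = monomial (Poly_Mapping.single x 1)"

definition squarefree_exponent :: "('v \<Rightarrow>\<^sub>0 nat) \<Rightarrow> bool" where
  "squarefree_exponent t \<longleftrightarrow> (\<forall>x. Poly_Mapping.lookup t x \<le> 1)"

definition graded_maximal_ideal :: "'v set \<Rightarrow> ('v, 'k::field) mpoly set" where
  "graded_maximal_ideal V = genideal (poly_ring V) (indet ` V)"

lemma poly_ring_cring: "cring (poly_ring V :: ('v, 'k::field) mpoly ring)"
proof (rule cringI)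
  show "abelian_group (poly_ring V :: ('v, 'k) mpoly ring)"
  proof (rule abelian_groupI)
    fix p assume p: "p \<in> carrier (poly_ring V :: ('v, 'k) mpoly ring)"
    show "\<exists>q \<in> carrier (poly_ring V). q \<oplus>\<^bsub>poly_ring V\<^esub> p = \<zero>\<^bsub>poly_ring V\<^esub>"
      by (rule bexI[of _ "- p"]) (use p in \<open>auto simp: poly_ring_def in_keys_iff\<close>)
  qed (use Poly_Mapping.keys_add in \<open>fastforce simp: poly_ring_def add_ac\<close>)+
  show "comm_monoid (poly_ring V :: ('v, 'k) mpoly ring)"
  proof (rule comm_monoidI)
    fix p q assume pq: "p \<in> carrier (poly_ring V :: ('v, 'k) mpoly ring)" "q \<in> carrier (poly_ring V :: ('v, 'k) mpoly ring)"
    show "p \<otimes>\<^bsub>poly_ring V\<^esub> q \<in> carrier (poly_ring V :: ('v, 'k) mpoly ring)"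
      unfolding poly_ring_def
    proof (clarsimp simp del: subset_iff)
      fix t x assume "t \<in> Poly_Mapping.keys (p * q)" and x: "x \<in> Poly_Mapping.keys t"
      then obtain a b where "t = a + b" "a \<in> Poly_Mapping.keys p" "b \<in> Poly_Mapping.keys q"
        using keys_mult[of p q] by blast
      then show "x \<in> V"
        using pq x Poly_Mapping.keys_add[of a b] by (fastforce simp: poly_ring_def)
    qed
  qed (auto simp: poly_ring_def mult_ac)
qed (auto simp: poly_ring_def distrib_right)


section \<open>Depth of a module\<close>

definition quotient_module :: "('a, 'b) ring_scheme \<Rightarrow> 'a set \<Rightarrow> ('a, 'a set) module" where
  "quotient_module R I =
    \<lparr>carrier = carrier (R Quot I), mult = mult (R Quot I), one = one (R Quot I),
     zero = zero (R Quot I), add = add (R Quot I),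
     smult = (\<lambda>r X. (I +>\<^bsub>R\<^esub> r) \<otimes>\<^bsub>R Quot I\<^esub> X)\<rparr>"

lemma quotient_module_module:
  assumes "cring R" "ideal I R"
  shows "Module.module R (quotient_module R I)"
proof -
  interpret cring R by fact
  interpret ideal I R by fact
  interpret Q: cring "R Quot I" by (rule quotient_is_cring) fact
  interpret h: ring_hom_ring R "R Quot I" "(+>\<^bsub>R\<^esub>) I" by (rule rcos_ring_hom_ring)
  show ?thesis
  proof (rule Module.moduleI)
    show "abelian_group (quotient_module R I)"
    proof (rule abelian_groupI)
      fix X assume "X \<in> carrier (quotient_module R I)"
      then show "\<exists>Y\<in>carrier (quotient_module R I). Y \<oplus>\<^bsub>quotient_module R I\<^esub> X = \<zero>\<^bsub>quotient_module R I\<^esub>"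
        using Q.l_neg Q.a_inv_closed by (auto simp: quotient_module_def)
    qed (auto simp: quotient_module_def Q.a_ac)
  qed (auto simp: quotient_module_def Q.l_distr Q.r_distr Q.m_assoc assms)
qed

text \<open>The submodule \<open>(S)M\<close> of \<open>M\<close> generated by all \<open>f u\<close> with \<open>f \<in> S\<close> and \<open>u \<in> M\<close>.\<close>

definition ideal_times_module :: "('a, 'c) ring_scheme \<Rightarrow> 'a set \<Rightarrow> ('a, 'b) module \<Rightarrow> 'b set" where
  "ideal_times_module R S M =
    \<Inter>{N. submodule N R M \<and> (\<forall>f \<in> S. \<forall>u \<in> carrier M. f \<odot>\<^bsub>M\<^esub> u \<in> N)}"

text \<open>
  In the first clause, multiplication by the entry \<open>f\<^sub>i\<close> is injective on the quotient of \<open>M\<close> by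
  \<open>(f\<^sub>1, \<dots>, f\<^sub>i\<^sub>-\<^sub>1)M\<close>.
\<close>

definition regular_sequence ::
    "('a, 'c) ring_scheme \<Rightarrow> ('a, 'b) module \<Rightarrow> 'a list \<Rightarrow> bool" where
  "regular_sequence R M fs \<longleftrightarrow>
     set fs \<subseteq> carrier R \<and>
     (\<forall>i < length fs. \<forall>u \<in> carrier M.
        (fs ! i) \<odot>\<^bsub>M\<^esub> u \<in> ideal_times_module R (set (take i fs)) M \<longrightarrow>
        u \<in> ideal_times_module R (set (take i fs)) M) \<and>
     ideal_times_module R (set fs) M \<noteq> carrier M"

text \<open>
  The depth (grade) of \<open>M\<close> with respect to an ideal \<open>J\<close>: the supremum of the lengths of
  \<open>M\<close>-regular sequences in \<open>J\<close>.  The elements of the sequences need not be homogeneous.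
\<close>

definition depth :: "('a, 'c) ring_scheme \<Rightarrow> 'a set \<Rightarrow> ('a, 'b) module \<Rightarrow> enat" where
  "depth R J M = Sup {enat (length fs) | fs. set fs \<subseteq> J \<and> regular_sequence R M fs}"


section \<open>Graphs and square-free powers of edge ideals\<close>

record 'v sgraph =
  vertices :: "'v set"
  edges :: "'v set set"

definition finite_simple_graph :: "'v sgraph \<Rightarrow> bool" where
  "finite_simple_graph G \<longleftrightarrow>
     finite (vertices G) \<and> (\<forall>e \<in> edges G. e \<subseteq> vertices G \<and> card e = 2)"

definition edge_ideal :: "'v sgraph \<Rightarrow> ('v, 'k::field) mpoly set" where
  "edge_ideal G =
    genideal (poly_ring (vertices G)) {indet x * indet y | x y. {x, y} \<in> edges G}"

definition squarefree_square :: "'v sgraph \<Rightarrow> ('v, 'k::field) mpoly set" where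
  "squarefree_square G =
    genideal (poly_ring (vertices G))
      {p \<in> ideal_prod (poly_ring (vertices G)) (edge_ideal G) (edge_ideal G).
        \<exists>t. squarefree_exponent t \<and> p = monomial t}"

datatype whisker_vertex = X nat | Y nat

definition whiskered_cycle :: "nat \<Rightarrow> whisker_vertex sgraph" where
  "whiskered_cycle m =
    \<lparr>vertices = X ` {1..m} \<union> Y ` {1..m},
     edges = {{X i, X (i + 1)} | i. 1 \<le> i \<and> i \<le> m - 1} \<union> {{X 1, X m}}
             \<union> {{X i, Y i} | i. 1 \<le> i \<and> i \<le> m}\<rparr>"

lemma whiskered_cycle_finite_simple: "m \<ge> 3 \<Longrightarrow> finite_simple_graph (whiskered_cycle m)"
  by (auto simp: finite_simple_graph_def whiskered_cycle_def card_insert_if)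

end

theory Submission
  imports Defs
begin

text \<open>
  Upper bound.  For a facet \<open>S\<close> of the complex of a squarefree monomial ideal \<open>I\<close>, the class \<open>u\<close> of
  the squarefree monomial of \<open>S\<close> has annihilator generated by the variables outside \<open>S\<close>.  More than
  \<open>|S|\<close> elements \<open>f\<^sub>i\<close> are algebraically dependent modulo these variables, so \<open>g(f)u = 0\<close> for a
  polynomial \<open>g \<noteq> 0\<close> over the field.  A regular sequence is quasi-regular; comparing initial forms
  of \<open>g(f)\<close> and \<open>u\<close> in the graded module associated with the powers of \<open>(f)\<close> excludes this,
  since \<open>u\<close> lies outside a high power.  The facet is \<open>{X 1} \<union> {Y 1, \<dots>, Y m}\<close> in general, and the triangle
  for \<open>m = 3\<close>.

  Lower bound.  The ideal is the polarization of its image under \<open>Y j \<mapsto> X j\<close>, whence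
  \<open>X 1 - Y 1, \<dots>, X m - Y m\<close> is regular.  If \<open>m > 3\<close> the cycle has no triangle, so pairwise
  intersecting edges have a common vertex \<open>i\<close>, and a monomial outside the image ideal remains
  outside after multiplication with \<open>(X i)\<^sup>2\<close>; this makes \<open>(X 1)\<^sup>2 + \<dots> + (X m)\<^sup>2\<close> regular modulo
  the image ideal.
\<close>

section \<open>Quasi-regularity of regular sequences\<close>

text \<open>The sequences need not be homogeneous and the ring is not local, so the upper bound must
  handle arbitrary polynomials without constant term. Their dependence comes from counting: the
  products of \<open>n\<close> entries with all exponents below \<open>N\<close> number
  \<open>N ^ n\<close>, while their terms supported in \<open>S\<close> lie in a box of
  \<open>(W + 1) ^ card S\<close> points with \<open>W\<close> linear in \<open>N\<close>; for
  \<open>card S < n\<close> and large \<open>N\<close> the products win. The high power that misses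
  \<open>u\<close> is the power \<open>card S + 1\<close>: all its terms outside the ideal have
  degree above \<open>card S\<close>, the degree of \<open>u\<close>.

  For \<open>m = 3\<close> the monomial \<open>X 1 X 2 X 3\<close> lies outside the image ideal, but
  its product with each of the three variables lies inside: an edge of the triangle together with
  the square of the opposite vertex is a generator. This socle element is why the differences cannot
  be prolonged there, and why the argument for \<open>m > 3\<close> needs a cycle without
  triangles.\<close>

lemma linear_dependence:
  fixes a :: "'i \<Rightarrow> 'j \<Rightarrow> 'k::field"
  assumes "finite T" "finite A" "card T < card A"
  shows "\<exists>c. (\<exists>i\<in>A. c i \<noteq> 0) \<and> (\<forall>t\<in>T. (\<Sum>i\<in>A. c i * a i t) = 0)"
  using assms
proof (induction T arbitrary: A a rule: finite_induct)
  case empty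
  then obtain i where "i \<in> A"
    by fastforce
  then show ?case
    by (intro exI[of _ "\<lambda>_. 1"]) auto
next
  case (insert t T)
  show ?case
  proof (cases "\<forall>i\<in>A. a i t = 0")
    case True
    have "card T < card A"
      using insert by simp
    from insert.IH[OF insert.prems(1) this, of a] obtain c where
      "\<exists>i\<in>A. c i \<noteq> 0" "\<forall>s\<in>T. (\<Sum>i\<in>A. c i * a i s) = 0"
      by blast
    with True show ?thesis
      by (intro exI[of _ c]) auto
  next
    case False
    then obtain z where z: "z \<in> A" "a z t \<noteq> 0"
      by blast
    \<comment> \<open>Elimination with pivot \<open>a z t\<close>: the unknown \<open>z\<close> is
      solved from equation \<open>t\<close> and substituted into the others; \<open>d\<close> below
      restores its value.\<close>
    define b where "b i s = a i s - a i t / a z t * a z s" for i s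
    have "card T < card (A - {z})"
      using insert z by (simp add: card_Diff_singleton)
    from insert.IH[OF _ this, of b] obtain c where
      c: "\<exists>i\<in>A - {z}. c i \<noteq> 0" "\<forall>s\<in>T. (\<Sum>i\<in>A - {z}. c i * b i s) = 0"
      using insert.prems by auto
    define d where "d = c(z := - (\<Sum>i\<in>A - {z}. c i * a i t) / a z t)"
    have split: "(\<Sum>i\<in>A. d i * a i s) = d z * a z s + (\<Sum>i\<in>A - {z}. c i * a i s)" for s
    proof -
      have "(\<Sum>i\<in>A - {z}. d i * a i s) = (\<Sum>i\<in>A - {z}. c i * a i s)"
        by (rule sum.cong) (auto simp: d_def)
      then show ?thesis
        using sum.remove[OF insert.prems(1) z(1), of "\<lambda>i. d i * a i s"] by simp
    qed
    have "(\<Sum>i\<in>A. d i * a i s) = 0" if "s \<in> insert t T" for s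
    proof (cases "s = t")
      case True
      then show ?thesis
        using z unfolding split by (simp add: d_def)
    next
      case False
      have "(\<Sum>i\<in>A - {z}. c i * b i s)
          = (\<Sum>i\<in>A - {z}. c i * a i s) - (\<Sum>i\<in>A - {z}. c i * a i t) / a z t * a z s"
        by (simp add: b_def algebra_simps sum_subtractf sum_distrib_left sum_distrib_right sum_divide_distrib)
      then show ?thesis
        using c(2) that False unfolding split by (simp add: d_def)
    qed
    moreover have "\<exists>i\<in>A. d i \<noteq> 0"
      using c(1) by (auto simp: d_def)
    ultimately show ?thesis
      by blast
  qed
qed

section \<open>Forms of fixed degree in the entries of a list\<close>

definition exps :: "nat \<Rightarrow> nat \<Rightarrow> nat list set" where
  "exps n s = {\<alpha>. length \<alpha> = n \<and> sum_list \<alpha> = s}"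

definition mon :: "'a::comm_ring_1 list \<Rightarrow> nat list \<Rightarrow> 'a" where
  "mon fs \<alpha> = prod_list (map2 (^) fs \<alpha>)"

text \<open>A form with coefficients \<open>v\<close>, evaluated at \<open>fs\<close>. Only the
  values of \<open>v\<close> on \<open>exps\<close> count, so coefficients can be changed within a
  subset of the ring without a polynomial ring over it.\<close>

definition eval_form :: "'a::comm_ring_1 list \<Rightarrow> nat \<Rightarrow> (nat list \<Rightarrow> 'a) \<Rightarrow> 'a" where
  "eval_form fs s v = (\<Sum>\<alpha>\<in>exps (length fs) s. mon fs \<alpha> * v \<alpha>)"

lemma mon_simps [simp]: "mon [] \<alpha> = 1" "mon (f # fs) (a # \<alpha>) = f ^ a * mon fs \<alpha>"
  by (auto simp: mon_def)

lemma mon_add: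
  "length \<alpha> = length fs \<Longrightarrow> length \<beta> = length fs \<Longrightarrow> mon fs (map2 (+) \<alpha> \<beta>) = mon fs \<alpha> * mon fs \<beta>"
proof (induction fs arbitrary: \<alpha> \<beta>)
  case (Cons f fs)
  then show ?case
    by (cases \<alpha>; cases \<beta>) (auto simp: power_add algebra_simps)
qed auto

lemma exps_add:
  "\<alpha> \<in> exps n s \<Longrightarrow> \<beta> \<in> exps n k \<Longrightarrow> map2 (+) \<alpha> \<beta> \<in> exps n (s + k)"
proof (induction n arbitrary: \<alpha> \<beta> s k)
  case (Suc n)
  obtain a \<alpha>' b \<beta>' where eq: "\<alpha> = a # \<alpha>'" "\<beta> = b # \<beta>'"
    using Suc.prems by (auto simp: exps_def length_Suc_conv)
  have "map2 (+) \<alpha>' \<beta>' \<in> exps n ((s - a) + (k - b))"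
    using Suc.prems eq by (intro Suc.IH) (auto simp: exps_def)
  then show ?case
    using Suc.prems eq by (auto simp: exps_def)
qed (auto simp: exps_def)

lemma finite_exps [simp]: "finite (exps n s)"
proof (rule finite_subset)
  show "exps n s \<subseteq> {\<alpha>. set \<alpha> \<subseteq> {..s} \<and> length \<alpha> = n}"
    by (auto simp: exps_def member_le_sum_list)
qed (simp add: finite_lists_length_eq)

lemma exps_0: "exps n 0 = {replicate n 0}"
  by (auto simp: exps_def sum_list_eq_0_iff intro: replicate_eqI)

lemma mon_replicate_0 [simp]: "mon fs (replicate (length fs) 0) = 1"
  by (induction fs) auto

lemma eval_form_0: "eval_form fs 0 v = v (replicate (length fs) 0)"
  by (simp add: eval_form_def exps_0)

lemma exps_Suc_Suc:
  "exps (Suc n) (Suc s) = (#) 0 ` exps n (Suc s) \<union> (\<lambda>\<alpha>. Suc (hd \<alpha>) # tl \<alpha>) ` exps (Suc n) s"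
proof (intro equalityI subsetI)
  fix \<alpha> assume \<alpha>: "\<alpha> \<in> exps (Suc n) (Suc s)"
  then obtain a \<beta> where eq: "\<alpha> = a # \<beta>"
    by (auto simp: exps_def length_Suc_conv)
  show "\<alpha> \<in> (#) 0 ` exps n (Suc s) \<union> (\<lambda>\<alpha>. Suc (hd \<alpha>) # tl \<alpha>) ` exps (Suc n) s"
  proof (cases a)
    case 0
    then show ?thesis using \<alpha> eq by (auto simp: exps_def)
  next
    case (Suc b)
    then have "\<alpha> = (\<lambda>\<alpha>. Suc (hd \<alpha>) # tl \<alpha>) (b # \<beta>)" "b # \<beta> \<in> exps (Suc n) s"
      using \<alpha> eq by (auto simp: exps_def)
    then show ?thesis by blast
  qed
next
  fix \<alpha> assume "\<alpha> \<in> (#) 0 ` exps n (Suc s) \<union> (\<lambda>\<alpha>. Suc (hd \<alpha>) # tl \<alpha>) ` exps (Suc n) s"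
  then show "\<alpha> \<in> exps (Suc n) (Suc s)"
    by (auto simp: exps_def length_Suc_conv)
qed

text \<open>Splits a form by whether the first indeterminate occurs. The first summand involves only
  the shorter list, the second has one degree less; the induction on the degree for quasi-regularity
  rests on this.\<close>

lemma eval_form_Suc:
  "eval_form (f # fs) (Suc s) v =
     eval_form fs (Suc s) (\<lambda>\<alpha>. v (0 # \<alpha>)) + f * eval_form (f # fs) s (\<lambda>\<alpha>. v (Suc (hd \<alpha>) # tl \<alpha>))"
proof -
  let ?g = "\<lambda>\<alpha>::nat list. Suc (hd \<alpha>) # tl \<alpha>" and ?n = "length fs"
  have inj: "inj_on ?g (exps (Suc ?n) s)"
    by (rule inj_onI, rule list.expand) (auto simp: exps_def)
  have "eval_form (f # fs) (Suc s) v
      = (\<Sum>\<alpha>\<in>(#) 0 ` exps ?n (Suc s). mon (f # fs) \<alpha> * v \<alpha>)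
        + (\<Sum>\<alpha>\<in>?g ` exps (Suc ?n) s. mon (f # fs) \<alpha> * v \<alpha>)"
    unfolding eval_form_def list.size add_Suc_right add_0_right exps_Suc_Suc
    by (rule sum.union_disjoint) auto
  also have "(\<Sum>\<alpha>\<in>(#) 0 ` exps ?n (Suc s). mon (f # fs) \<alpha> * v \<alpha>) = eval_form fs (Suc s) (\<lambda>\<alpha>. v (0 # \<alpha>))"
    by (simp add: sum.reindex eval_form_def)
  also have "(\<Sum>\<alpha>\<in>?g ` exps (Suc ?n) s. mon (f # fs) \<alpha> * v \<alpha>)
      = f * eval_form (f # fs) s (\<lambda>\<alpha>. v (?g \<alpha>))"
    unfolding eval_form_def sum.reindex[OF inj] sum_distrib_left
    by (rule sum.cong) (auto simp: exps_def length_Suc_conv algebra_simps)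
  finally show ?thesis .
qed

lemma eval_form_add: "eval_form fs s (\<lambda>\<alpha>. v \<alpha> + w \<alpha>) = eval_form fs s v + eval_form fs s w"
  by (simp add: eval_form_def algebra_simps sum.distrib)

lemma eval_form_diff: "eval_form fs s (\<lambda>\<alpha>. v \<alpha> - w \<alpha>) = eval_form fs s v - eval_form fs s w"
  by (simp add: eval_form_def algebra_simps sum_subtractf)

lemma eval_form_mult: "eval_form fs s (\<lambda>\<alpha>. r * v \<alpha>) = r * eval_form fs s v"
  by (simp add: eval_form_def algebra_simps sum_distrib_left)

lemma eval_form_single:
  "\<alpha> \<in> exps (length fs) s \<Longrightarrow> eval_form fs s (\<lambda>\<beta>. if \<beta> = \<alpha> then x else 0) = mon fs \<alpha> * x"
proof -
  assume a: "\<alpha> \<in> exps (length fs) s"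
  have "eval_form fs s (\<lambda>\<beta>. if \<beta> = \<alpha> then x else 0)
      = (\<Sum>\<beta>\<in>exps (length fs) s. if \<beta> = \<alpha> then mon fs \<alpha> * x else 0)"
    unfolding eval_form_def by (rule sum.cong) auto
  then show ?thesis
    using a by simp
qed

text \<open>The polynomial ring on a set of indeterminates is a subset of a type. With
  \<open>C\<close> as a subring of a commutative ring type, sums and products are those of the type
  class and only membership in \<open>C\<close> has to be tracked. \<open>I\<close> is an ideal of
  \<open>C\<close>, not of the whole type.\<close>

locale subring_ideal =
  fixes C I :: "'a::comm_ring_1 set"
  assumes one_C: "1 \<in> C"
    and minus_C: "x \<in> C \<Longrightarrow> - x \<in> C"
    and add_C: "x \<in> C \<Longrightarrow> y \<in> C \<Longrightarrow> x + y \<in> C"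
    and mult_C: "x \<in> C \<Longrightarrow> y \<in> C \<Longrightarrow> x * y \<in> C"
    and I_C: "I \<subseteq> C"
    and zero_I: "0 \<in> I"
    and add_I: "x \<in> I \<Longrightarrow> y \<in> I \<Longrightarrow> x + y \<in> I"
    and mult_I: "x \<in> C \<Longrightarrow> y \<in> I \<Longrightarrow> x * y \<in> I"
begin

fun gen :: "'a list \<Rightarrow> 'a set" where
  "gen [] = I"
| "gen (f # fs) = {x + r * f | x r. x \<in> gen fs \<and> r \<in> C}"

text \<open>The list is read from its end: \<open>f\<close> comes after the elements of \<open>fs\<close> in the sequence.\<close>

fun reg :: "'a list \<Rightarrow> bool" where
  "reg [] \<longleftrightarrow> True"
| "reg (f # fs) \<longleftrightarrow> reg fs \<and> (\<forall>x\<in>C. f * x \<in> gen fs \<longrightarrow> x \<in> gen fs)"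

lemma gen_ConsI: "x \<in> gen fs \<Longrightarrow> r \<in> C \<Longrightarrow> x + r * f \<in> gen (f # fs)"
  by auto

text \<open>For an ideal \<open>N\<close> of \<open>C\<close> this is (fs)^s N + I; with
  \<open>N = C\<close> it is the s-th power of (fs), plus \<open>I\<close>. Elements are kept as
  explicit forms because quasi-regularity speaks about their coefficients.\<close>

definition forms :: "'a list \<Rightarrow> nat \<Rightarrow> 'a set \<Rightarrow> 'a set" where
  "forms fs s N = {eval_form fs s v + a | v a. (\<forall>\<alpha>\<in>exps (length fs) s. v \<alpha> \<in> N) \<and> a \<in> I}"

lemma zero_C: "0 \<in> C"
  using zero_I I_C by blast

lemma diff_C: "x \<in> C \<Longrightarrow> y \<in> C \<Longrightarrow> x - y \<in> C"
  using add_C[of x "- y"] minus_C by simp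

lemma power_C: "x \<in> C \<Longrightarrow> x ^ n \<in> C"
  by (induction n) (auto simp: one_C mult_C)

lemma sum_C: "(\<And>i. i \<in> A \<Longrightarrow> g i \<in> C) \<Longrightarrow> sum g A \<in> C"
  by (induction A rule: infinite_finite_induct) (auto simp: zero_C add_C)

lemma gen_props:
  assumes "set fs \<subseteq> C"
  shows gen_C: "gen fs \<subseteq> C" and I_gen: "I \<subseteq> gen fs"
    and add_gen: "x \<in> gen fs \<Longrightarrow> y \<in> gen fs \<Longrightarrow> x + y \<in> gen fs"
    and mult_gen: "r \<in> C \<Longrightarrow> x \<in> gen fs \<Longrightarrow> r * x \<in> gen fs"
proof -
  have "gen fs \<subseteq> C \<and> I \<subseteq> gen fs \<and> (\<forall>x\<in>gen fs. \<forall>y\<in>gen fs. x + y \<in> gen fs)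
      \<and> (\<forall>r\<in>C. \<forall>x\<in>gen fs. r * x \<in> gen fs)"
    using assms
  proof (induction fs)
    case Nil
    then show ?case
      using I_C add_I mult_I by auto
  next
    case (Cons f fs)
    then have f: "f \<in> C" and IH: "gen fs \<subseteq> C" "I \<subseteq> gen fs"
      "\<And>x y. x \<in> gen fs \<Longrightarrow> y \<in> gen fs \<Longrightarrow> x + y \<in> gen fs"
      "\<And>r x. r \<in> C \<Longrightarrow> x \<in> gen fs \<Longrightarrow> r * x \<in> gen fs"
      by auto
    have "x \<in> gen (f # fs)" if "x \<in> I" for x
      using gen_ConsI[of x fs 0 f] that IH(2) zero_C by auto
    moreover have "gen (f # fs) \<subseteq> C"
      using IH(1) f by (auto intro!: add_C mult_C)
    moreover have "x + y \<in> gen (f # fs)" if xy: "x \<in> gen (f # fs)" "y \<in> gen (f # fs)" for x y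
    proof -
      obtain x' r y' s where "x = x' + r * f" "y = y' + s * f" "x' \<in> gen fs" "y' \<in> gen fs" "r \<in> C" "s \<in> C"
        using xy by auto
      then show ?thesis
        using gen_ConsI[of "x' + y'" fs "r + s" f] IH(3) add_C by (simp add: algebra_simps del: gen.simps)
    qed
    moreover have "s * x \<in> gen (f # fs)" if x: "x \<in> gen (f # fs)" "s \<in> C" for s x
    proof -
      obtain x' r where "x = x' + r * f" "x' \<in> gen fs" "r \<in> C"
        using x by auto
      then show ?thesis
        using gen_ConsI[of "s * x'" fs "s * r" f] IH(4) mult_C x(2) by (simp add: algebra_simps del: gen.simps)
    qed
    ultimately show ?case by blast
  qed
  then show "gen fs \<subseteq> C" "I \<subseteq> gen fs" "x \<in> gen fs \<Longrightarrow> y \<in> gen fs \<Longrightarrow> x + y \<in> gen fs"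
    "r \<in> C \<Longrightarrow> x \<in> gen fs \<Longrightarrow> r * x \<in> gen fs"
    by auto
qed

lemma zero_gen: "set fs \<subseteq> C \<Longrightarrow> 0 \<in> gen fs"
  using I_gen zero_I by blast

lemma minus_gen: "set fs \<subseteq> C \<Longrightarrow> x \<in> gen fs \<Longrightarrow> - x \<in> gen fs"
  using mult_gen[of fs "-1" x] minus_C[OF one_C] by simp

lemma diff_gen: "set fs \<subseteq> C \<Longrightarrow> x \<in> gen fs \<Longrightarrow> y \<in> gen fs \<Longrightarrow> x - y \<in> gen fs"
  using add_gen[of fs x "- y"] minus_gen by simp

lemma sum_gen: "set fs \<subseteq> C \<Longrightarrow> (\<And>i. i \<in> A \<Longrightarrow> g i \<in> gen fs) \<Longrightarrow> sum g A \<in> gen fs"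
  by (induction A rule: infinite_finite_induct) (auto simp: zero_gen add_gen)

lemma gen_Cons_mono: "x \<in> gen fs \<Longrightarrow> x \<in> gen (f # fs)"
  using gen_ConsI[of x fs 0 f] zero_C by simp

lemma mult_gen_Cons: "set fs \<subseteq> C \<Longrightarrow> r \<in> C \<Longrightarrow> r * f \<in> gen (f # fs)"
  using gen_ConsI[of 0 fs r f] zero_gen[of fs] by simp

lemma mult_gen_mem: "set fs \<subseteq> C \<Longrightarrow> r \<in> C \<Longrightarrow> f \<in> set fs \<Longrightarrow> r * f \<in> gen fs"
proof (induction fs)
  case (Cons g fs)
  then show ?case
    using mult_gen_Cons gen_Cons_mono by (cases "f = g") (auto simp del: gen.simps)
qed simp

lemma mon_C: "set fs \<subseteq> C \<Longrightarrow> mon fs \<alpha> \<in> C"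
proof (induction fs arbitrary: \<alpha>)
  case (Cons f fs)
  then show ?case
    by (cases \<alpha>) (auto simp: mon_def[of _ "[]"] one_C mult_C power_C)
qed (simp add: one_C)

lemma diff_I: "x \<in> I \<Longrightarrow> y \<in> I \<Longrightarrow> x - y \<in> I"
  using diff_gen[of "[]"] by simp

lemma forms_add:
  assumes N: "\<And>x y. x \<in> N \<Longrightarrow> y \<in> N \<Longrightarrow> x + y \<in> N"
    and xy: "x \<in> forms fs s N" "y \<in> forms fs s N"
  shows "x + y \<in> forms fs s N"
proof -
  obtain v a w b where *: "x = eval_form fs s v + a" "\<forall>\<alpha>\<in>exps (length fs) s. v \<alpha> \<in> N" "a \<in> I"
    "y = eval_form fs s w + b" "\<forall>\<alpha>\<in>exps (length fs) s. w \<alpha> \<in> N" "b \<in> I"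
    using xy unfolding forms_def by blast
  then show ?thesis
    unfolding forms_def
    using N add_I by (auto intro!: exI[of _ "\<lambda>\<alpha>. v \<alpha> + w \<alpha>"] exI[of _ "a + b"] simp: eval_form_add)
qed

lemma forms_mult:
  assumes N: "\<And>x. x \<in> N \<Longrightarrow> r * x \<in> N" and r: "r \<in> C" and x: "x \<in> forms fs s N"
  shows "r * x \<in> forms fs s N"
proof -
  obtain v a where *: "x = eval_form fs s v + a" "\<forall>\<alpha>\<in>exps (length fs) s. v \<alpha> \<in> N" "a \<in> I"
    using x unfolding forms_def by blast
  then show ?thesis
    unfolding forms_def
    using N r mult_I by (auto intro!: exI[of _ "\<lambda>\<alpha>. r * v \<alpha>"] exI[of _ "r * a"] simp: eval_form_mult distrib_left)
qed

lemma I_forms: "0 \<in> N \<Longrightarrow> a \<in> I \<Longrightarrow> a \<in> forms fs s N"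
  unfolding forms_def by (auto intro!: exI[of _ "\<lambda>_. 0"] exI[of _ a] simp: eval_form_def)

lemma mon_forms: "0 \<in> N \<Longrightarrow> x \<in> N \<Longrightarrow> \<alpha> \<in> exps (length fs) s \<Longrightarrow> mon fs \<alpha> * x \<in> forms fs s N"
  unfolding forms_def using zero_I
  by (auto intro!: exI[of _ "\<lambda>\<beta>. if \<beta> = \<alpha> then x else 0"] exI[of _ 0] simp: eval_form_single)

lemma forms_sum:
  assumes "\<And>x y. x \<in> N \<Longrightarrow> y \<in> N \<Longrightarrow> x + y \<in> N" "0 \<in> N" "\<And>i. i \<in> A \<Longrightarrow> g i \<in> forms fs s N"
  shows "sum g A \<in> forms fs s N"
  using assms(3)
  by (induction A rule: infinite_finite_induct) (auto intro: I_forms forms_add assms(1,2) zero_I)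

text \<open>An induction principle for \<open>forms\<close>: closure under addition reduces an
  inclusion to single products of a monomial with a coefficient.\<close>

lemma forms_subset:
  assumes P: "\<And>x y. x \<in> P \<Longrightarrow> y \<in> P \<Longrightarrow> x + y \<in> P" "I \<subseteq> P"
    and m: "\<And>\<alpha> x. \<alpha> \<in> exps (length fs) s \<Longrightarrow> x \<in> N \<Longrightarrow> mon fs \<alpha> * x \<in> P"
  shows "forms fs s N \<subseteq> P"
proof
  fix y assume "y \<in> forms fs s N"
  then obtain v a where *: "y = eval_form fs s v + a" "\<forall>\<alpha>\<in>exps (length fs) s. v \<alpha> \<in> N" "a \<in> I"
    unfolding forms_def by blast
  have "sum g A \<in> P" if "\<And>i. i \<in> A \<Longrightarrow> g i \<in> P" for g and A :: "nat list set"
    using that P zero_I by (induction A rule: infinite_finite_induct) auto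
  then show "y \<in> P"
    using * P m unfolding eval_form_def by (auto simp: subset_iff)
qed

lemma mon_exps_Suc:
  "set fs \<subseteq> C \<Longrightarrow> \<gamma> \<in> exps (length fs) (Suc s) \<Longrightarrow>
    \<exists>\<alpha>\<in>exps (length fs) s. \<exists>f\<in>set fs. mon fs \<gamma> = mon fs \<alpha> * f"
proof (induction fs arbitrary: \<gamma> s)
  case (Cons f fs)
  obtain c \<delta> where \<gamma>: "\<gamma> = c # \<delta>" "length \<delta> = length fs" "c + sum_list \<delta> = Suc s"
    using Cons.prems by (auto simp: exps_def length_Suc_conv)
  show ?case
  proof (cases c)
    case 0
    then obtain \<alpha> g where "\<alpha> \<in> exps (length fs) s" "g \<in> set fs" "mon fs \<delta> = mon fs \<alpha> * g"
      using Cons.IH[of \<delta> s] Cons.prems \<gamma> by (auto simp: exps_def)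
    then show ?thesis
      using \<gamma> 0 by (intro bexI[of _ "0 # \<alpha>"] bexI[of _ g]) (auto simp: exps_def)
  next
    case (Suc b)
    then show ?thesis
      using \<gamma> by (intro bexI[of _ "b # \<delta>"] bexI[of _ f]) (auto simp: exps_def algebra_simps)
  qed
qed (simp add: exps_def)

text \<open>A coefficient in \<open>gen fs\<close> is a combination of the entries modulo
  \<open>I\<close>, so it raises the degree by one. In the induction the multiple of
  \<open>f\<close> increases the first exponent, and the rest is left to the shorter list.\<close>

lemma mon_gen_forms:
  "set fs \<subseteq> C \<Longrightarrow> x \<in> gen fs \<Longrightarrow> \<alpha> \<in> exps (length fs) s \<Longrightarrow> mon fs \<alpha> * x \<in> forms fs (Suc s) C"
proof (induction fs arbitrary: \<alpha> s x)
  case Nil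
  then show ?case
    by (auto intro: I_forms zero_C)
next
  case (Cons f fs)
  obtain a \<beta> where \<alpha>: "\<alpha> = a # \<beta>" "\<beta> \<in> exps (length fs) (s - a)" "a \<le> s"
    using Cons.prems(3) by (auto simp: exps_def length_Suc_conv)
  obtain y r where x: "x = y + r * f" "y \<in> gen fs" "r \<in> C"
    using Cons.prems(2) by auto
  have fs: "set fs \<subseteq> C" "f \<in> C"
    using Cons.prems by auto
  have "mon fs \<beta> * y \<in> forms fs (Suc (s - a)) C"
    using Cons.IH[OF fs(1) x(2) \<alpha>(2)] .
  also have "forms fs (Suc (s - a)) C \<subseteq> {z. f ^ a * z \<in> forms (f # fs) (Suc s) C}"
  proof (rule forms_subset; clarify?)
    fix z w assume "f ^ a * z \<in> forms (f # fs) (Suc s) C" "f ^ a * w \<in> forms (f # fs) (Suc s) C"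
    then show "f ^ a * (z + w) \<in> forms (f # fs) (Suc s) C"
      using forms_add[of C] add_C by (simp add: distrib_left)
  next
    fix z assume "z \<in> I"
    then show "f ^ a * z \<in> forms (f # fs) (Suc s) C"
      by (intro I_forms zero_C mult_I power_C fs)
  next
    fix \<gamma> z assume *: "\<gamma> \<in> exps (length fs) (Suc (s - a))" "z \<in> C"
    then have "a # \<gamma> \<in> exps (length (f # fs)) (Suc s)"
      using \<alpha> by (auto simp: exps_def)
    from mon_forms[OF zero_C *(2) this] show "f ^ a * (mon fs \<gamma> * z) \<in> forms (f # fs) (Suc s) C"
      by (simp add: algebra_simps)
  qed
  finally have 1: "mon (f # fs) \<alpha> * y \<in> forms (f # fs) (Suc s) C"
    by (simp add: \<alpha> algebra_simps)
  have "Suc a # \<beta> \<in> exps (length (f # fs)) (Suc s)"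
    using \<alpha> by (auto simp: exps_def)
  from mon_forms[OF zero_C x(3) this] have 2: "mon (f # fs) \<alpha> * (r * f) \<in> forms (f # fs) (Suc s) C"
    by (simp add: \<alpha> algebra_simps)
  show ?case
    unfolding x(1) distrib_left by (rule forms_add[OF add_C 1 2])
qed

text \<open>(fs)^(s+1) + I = (fs)^s ((fs) + I) + I. Hence an element of the next power is a form of
  degree s whose coefficients vanish modulo \<open>gen fs\<close>, which is how degrees are shifted
  in the inductions below.\<close>

lemma forms_Suc: 
  assumes fs: "set fs \<subseteq> C"
  shows "forms fs (Suc s) C = forms fs s (gen fs)"
proof
  show "forms fs (Suc s) C \<subseteq> forms fs s (gen fs)"
  proof (rule forms_subset)
    fix \<gamma> x assume *: "\<gamma> \<in> exps (length fs) (Suc s)" "x \<in> C"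
    obtain \<alpha> f where \<alpha>: "\<alpha> \<in> exps (length fs) s" "f \<in> set fs" "mon fs \<gamma> = mon fs \<alpha> * f"
      using mon_exps_Suc[OF fs *(1)] by blast
    have "mon fs \<alpha> * (x * f) \<in> forms fs s (gen fs)"
      by (rule mon_forms[OF zero_gen mult_gen_mem]) (use fs * \<alpha> in auto)
    then show "mon fs \<gamma> * x \<in> forms fs s (gen fs)"
      by (simp add: \<alpha> algebra_simps)
  qed (use forms_add[of "gen fs"] I_forms[of "gen fs"] zero_gen[OF fs] add_gen[OF fs] in auto)
  show "forms fs s (gen fs) \<subseteq> forms fs (Suc s) C"
    by (rule forms_subset) (auto intro: forms_add I_forms zero_C add_C mon_gen_forms[OF fs])
qed

lemma forms_mono: "N \<subseteq> N' \<Longrightarrow> forms fs s N \<subseteq> forms fs s N'"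
  unfolding forms_def by fastforce

lemma forms_antimono: "set fs \<subseteq> C \<Longrightarrow> k \<le> s \<Longrightarrow> forms fs s C \<subseteq> forms fs k C"
proof (induction s)
  case (Suc s)
  have "forms fs (Suc s) C \<subseteq> forms fs s C"
    unfolding forms_Suc[OF Suc.prems(1)] by (rule forms_mono) (rule gen_C[OF Suc.prems(1)])
  with Suc show ?case
    by (cases "k = Suc s") auto
qed simp

lemma forms_0: "forms fs 0 C = C"
  unfolding forms_def eval_form_0 exps_0
  using I_C add_C zero_I by (auto intro!: exI[of _ "\<lambda>_. x" for x] exI[of _ 0])

text \<open>Injectivity of the natural map from the polynomial ring over \<open>C / gen fs\<close>
  to the graded module associated with the powers of (fs) on \<open>C / I\<close>. Vanishing is
  demanded only modulo \<open>I\<close>; \<open>quasi_regD\<close> recovers the version modulo the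
  next power.\<close>

definition quasi_reg :: "'a list \<Rightarrow> bool" where
  "quasi_reg fs \<longleftrightarrow> (\<forall>s v. (\<forall>\<alpha>\<in>exps (length fs) s. v \<alpha> \<in> C) \<longrightarrow> eval_form fs s v \<in> I \<longrightarrow>
     (\<forall>\<alpha>\<in>exps (length fs) s. v \<alpha> \<in> gen fs))"

text \<open>An element of the next power is itself a form of degree s with coefficients in
  \<open>gen fs\<close>; the difference of the two forms falls into \<open>I\<close>.\<close>

lemma quasi_regD:
  assumes q: "quasi_reg fs" and fs: "set fs \<subseteq> C"
    and v: "\<forall>\<alpha>\<in>exps (length fs) s. v \<alpha> \<in> C" "eval_form fs s v \<in> forms fs (Suc s) C"
    and \<alpha>: "\<alpha> \<in> exps (length fs) s"
  shows "v \<alpha> \<in> gen fs"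
proof -
  obtain w a where w: "eval_form fs s v = eval_form fs s w + a"
    "\<forall>\<alpha>\<in>exps (length fs) s. w \<alpha> \<in> gen fs" "a \<in> I"
    using v(2) unfolding forms_Suc[OF fs] unfolding forms_def by blast
  then have "eval_form fs s (\<lambda>\<alpha>. v \<alpha> - w \<alpha>) \<in> I"
    by (simp add: eval_form_diff)
  moreover have "\<forall>\<alpha>\<in>exps (length fs) s. v \<alpha> - w \<alpha> \<in> C"
    using v(1) w(2) gen_C[OF fs] diff_C by blast
  ultimately have "v \<alpha> - w \<alpha> \<in> gen fs"
    using q \<alpha> unfolding quasi_reg_def by meson
  from add_gen[OF fs this] w(2) \<alpha> show ?thesis
    by fastforce
qed

text \<open>By quasi-regularity the successive quotients of the powers of (fs) are free over
  \<open>C / gen fs\<close>, where multiplication by \<open>f\<close> is injective; so it stays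
  injective modulo every power. Each induction step pushes \<open>x\<close> one power deeper, by
  cancelling \<open>f\<close> in its coefficients.\<close>

lemma quasi_reg_mult_forms:
  assumes q: "quasi_reg fs" and fs: "set fs \<subseteq> C" and f: "f \<in> C"
    and r: "\<forall>x\<in>C. f * x \<in> gen fs \<longrightarrow> x \<in> gen fs"
    and x: "x \<in> C" "f * x \<in> forms fs s C"
  shows "x \<in> forms fs s C"
  using x(2)
proof (induction s)
  case 0
  then show ?case using x by (simp add: forms_0)
next
  case (Suc s)
  then have "x \<in> forms fs s C"
    using forms_antimono[OF fs, of s "Suc s"] by auto
  then obtain v a where v: "x = eval_form fs s v + a" "\<forall>\<alpha>\<in>exps (length fs) s. v \<alpha> \<in> C" "a \<in> I"
    unfolding forms_def by blast
  have "f * x + (- f) * a \<in> forms fs (Suc s) C"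
    by (intro forms_add add_C Suc.prems I_forms zero_C mult_I minus_C f v)
  then have "eval_form fs s (\<lambda>\<alpha>. f * v \<alpha>) \<in> forms fs (Suc s) C"
    unfolding eval_form_mult by (simp add: v algebra_simps)
  then have "\<forall>\<alpha>\<in>exps (length fs) s. f * v \<alpha> \<in> gen fs"
    using quasi_regD[OF q fs, of s "\<lambda>\<alpha>. f * v \<alpha>"] v f mult_C by auto
  then have "\<forall>\<alpha>\<in>exps (length fs) s. v \<alpha> \<in> gen fs"
    using r v by auto
  then show ?case
    unfolding forms_Suc[OF fs] unfolding forms_def using v by auto
qed

lemma forms_Cons: "x \<in> forms fs s C \<Longrightarrow> set fs \<subseteq> C \<Longrightarrow> x \<in> forms (f # fs) s C"
proof -
  assume x: "x \<in> forms fs s C" "set fs \<subseteq> C"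
  have "forms fs s C \<subseteq> forms (f # fs) s C"
  proof (rule forms_subset)
    fix \<alpha> x assume "\<alpha> \<in> exps (length fs) s" "x \<in> C"
    then have "mon (f # fs) (0 # \<alpha>) * x \<in> forms (f # fs) s C"
      by (intro mon_forms zero_C) (auto simp: exps_def)
    then show "mon fs \<alpha> * x \<in> forms (f # fs) s C" by simp
  qed (auto intro: forms_add I_forms zero_C add_C)
  then show ?thesis using x by blast
qed

lemma quasi_reg_Cons:
  assumes q: "quasi_reg fs" and fs: "set fs \<subseteq> C" and f: "f \<in> C"
    and r: "\<forall>x\<in>C. f * x \<in> gen fs \<longrightarrow> x \<in> gen fs"
  shows "quasi_reg (f # fs)"
  unfolding quasi_reg_def
proof (intro allI impI)
  fix s v
  have ffs: "set (f # fs) \<subseteq> C"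
    using fs f by simp
  assume "\<forall>\<alpha>\<in>exps (length (f # fs)) s. v \<alpha> \<in> C" "eval_form (f # fs) s v \<in> I"
  then show "\<forall>\<alpha>\<in>exps (length (f # fs)) s. v \<alpha> \<in> gen (f # fs)"
  proof (induction s arbitrary: v)
    case 0
    then show ?case
      using I_gen[OF ffs] unfolding eval_form_0 exps_0 by auto
  next
    case (Suc s)
    let ?G = "\<lambda>\<alpha>. v (0 # \<alpha>)" and ?H = "\<lambda>\<alpha>. v (Suc (hd \<alpha>) # tl \<alpha>)"
    let ?h = "eval_form (f # fs) s ?H"
    have vC: "\<forall>\<alpha>\<in>exps (length fs) (Suc s). ?G \<alpha> \<in> C" "\<forall>\<alpha>\<in>exps (length (f # fs)) s. ?H \<alpha> \<in> C"
      using Suc.prems(1) by (auto simp: exps_Suc_Suc)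
    have hC: "?h \<in> C"
      unfolding eval_form_def by (intro sum_C mult_C mon_C[OF ffs]) (use vC in auto)
    \<comment> \<open>Modulo \<open>I\<close> the product \<open>f * ?h\<close> is minus a form of
      degree s + 1 in \<open>fs\<close> alone. As \<open>f\<close> is regular modulo that power, the
      factor \<open>f\<close> can be cancelled.\<close>
    have "f * ?h \<in> forms fs (Suc s) C"
    proof -
      have "f * ?h = eval_form fs (Suc s) (\<lambda>\<alpha>. (-1) * ?G \<alpha>) + eval_form (f # fs) (Suc s) v"
        by (simp only: eval_form_mult eval_form_Suc) simp
      then show ?thesis
        unfolding forms_def using vC Suc.prems(2) by (auto intro: minus_C)
    qed
    then have h: "?h \<in> forms fs (Suc s) C"
      by (rule quasi_reg_mult_forms[OF q fs f r hC])
    \<comment> \<open>Lying one power higher than its degree, \<open>?h\<close> has a second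
      representation of degree s with coefficients in \<open>gen (f # fs)\<close>; the difference of
      the two is covered by the induction on the degree.\<close>
    have "?h \<in> forms (f # fs) s (gen (f # fs))"
      using forms_Cons[OF h fs] forms_Suc[OF ffs] by blast
    then obtain w b where w: "?h = eval_form (f # fs) s w + b"
      "\<forall>\<alpha>\<in>exps (length (f # fs)) s. w \<alpha> \<in> gen (f # fs)" "b \<in> I"
      unfolding forms_def by blast
    have "eval_form (f # fs) s (\<lambda>\<alpha>. ?H \<alpha> - w \<alpha>) \<in> I"
      unfolding eval_form_diff using w by simp
    then have "\<forall>\<alpha>\<in>exps (length (f # fs)) s. ?H \<alpha> - w \<alpha> \<in> gen (f # fs)"
      using Suc.IH[of "\<lambda>\<alpha>. ?H \<alpha> - w \<alpha>"] vC w(2) gen_C[OF ffs] diff_C by (simp add: subset_iff del: gen.simps)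
    then have H: "\<forall>\<alpha>\<in>exps (length (f # fs)) s. ?H \<alpha> \<in> gen (f # fs)"
      using add_gen[OF ffs] w(2) by (metis diff_add_cancel)
    \<comment> \<open>Writing \<open>?h\<close> as a form in \<open>fs\<close> turns the whole into
      one form of degree s + 1 in \<open>fs\<close>, to which quasi-regularity of the shorter list
      applies; its coefficients differ from those of the first part by multiples of
      \<open>f\<close>.\<close>
    obtain u a where u: "?h = eval_form fs (Suc s) u + a"
      "\<forall>\<alpha>\<in>exps (length fs) (Suc s). u \<alpha> \<in> C" "a \<in> I"
      using h unfolding forms_def by blast
    have "eval_form fs (Suc s) (\<lambda>\<alpha>. ?G \<alpha> + f * u \<alpha>) = eval_form (f # fs) (Suc s) v - f * a"
      by (simp only: eval_form_Suc eval_form_add eval_form_mult u(1)) (simp add: algebra_simps)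
    also have "\<dots> \<in> I"
      using Suc.prems(2) u(3) f by (auto intro!: diff_I mult_I)
    finally have "\<forall>\<alpha>\<in>exps (length fs) (Suc s). ?G \<alpha> + f * u \<alpha> \<in> gen fs"
      using q[unfolded quasi_reg_def, rule_format, of "Suc s" "\<lambda>\<alpha>. ?G \<alpha> + f * u \<alpha>"] vC u(2) f add_C mult_C
      by simp
    then have G: "\<forall>\<alpha>\<in>exps (length fs) (Suc s). ?G \<alpha> \<in> gen (f # fs)"
    proof (intro ballI)
      fix \<alpha> assume *: "\<forall>\<alpha>\<in>exps (length fs) (Suc s). ?G \<alpha> + f * u \<alpha> \<in> gen fs" "\<alpha> \<in> exps (length fs) (Suc s)"
      have "?G \<alpha> = (?G \<alpha> + f * u \<alpha>) + (- u \<alpha>) * f"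
        by (simp add: algebra_simps)
      with * u(2) show "?G \<alpha> \<in> gen (f # fs)"
        unfolding gen.simps mem_Collect_eq by (metis minus_C)
    qed
    show ?case
      using G H by (auto simp: exps_Suc_Suc simp del: gen.simps)
  qed
qed

theorem reg_imp_quasi_reg: "set fs \<subseteq> C \<Longrightarrow> reg fs \<Longrightarrow> quasi_reg fs"
proof (induction fs)
  case Nil
  have "v [] \<in> I" if "eval_form [] 0 v \<in> I" for v
    using that eval_form_0[of "[]" v] by simp
  then show ?case
    unfolding quasi_reg_def by (auto simp: exps_def)
next
  case (Cons f fs)
  then show ?case
    by (intro quasi_reg_Cons) auto
qed

section \<open>Products with forms whose coefficients are units or zero\<close>

lemma gen_unit: "set fs \<subseteq> C \<Longrightarrow> d \<in> C \<Longrightarrow> d * c = 1 \<Longrightarrow> c * x \<in> gen fs \<Longrightarrow> x \<in> gen fs"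
  using mult_gen[of fs d "c * x"] by (simp add: mult.assoc[symmetric])

text \<open>
  The associated graded module of a regular sequence is a polynomial ring over the quotient by the
  sequence, so a nonzero form with unit coefficients acts injectively on it.
\<close>

lemma quasi_reg_product:
  assumes q: "quasi_reg fs" and fs: "set fs \<subseteq> C"
    and c: "\<And>\<alpha>. \<alpha> \<in> exps (length fs) s \<Longrightarrow> c \<alpha> \<in> C \<and> (c \<alpha> = 0 \<or> (\<exists>d\<in>C. d * c \<alpha> = 1))"
    and c0: "\<exists>\<alpha>\<in>exps (length fs) s. c \<alpha> \<noteq> 0"
    and v: "\<And>\<beta>. \<beta> \<in> exps (length fs) k \<Longrightarrow> v \<beta> \<in> C"
    and prod: "eval_form fs s c * eval_form fs k v \<in> forms fs (Suc (s + k)) C"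
    and \<beta>: "\<beta> \<in> exps (length fs) k"
  shows "v \<beta> \<in> gen fs"
proof (rule ccontr)
  assume v0: "v \<beta> \<notin> gen fs"
  let ?n = "length fs" and ?A = "{\<alpha> \<in> exps (length fs) s. c \<alpha> \<noteq> 0}"
    and ?B = "{\<beta> \<in> exps (length fs) k. v \<beta> \<notin> gen fs}"
  \<comment> \<open>Exponent lists as digits in base s + k + 1, which serves as a monomial order:
    the code is additive, and it is injective on lists with sum at most s + k because every digit is
    then below the base.\<close>
  define code :: "nat list \<Rightarrow> nat" where
    "code = (\<lambda>\<alpha>. foldr (\<lambda>a r. a + Suc (s + k) * r) \<alpha> 0)"
  have code_simps: "code [] = 0" "code (a # \<alpha>) = a + Suc (s + k) * code \<alpha>" for a \<alpha>
    by (simp_all add: code_def)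
  have code_add: "length \<alpha> = length \<beta> \<Longrightarrow> code (map2 (+) \<alpha> \<beta>) = code \<alpha> + code \<beta>" for \<alpha> \<beta>
    by (induction \<alpha> \<beta> rule: list_induct2) (auto simp: code_simps algebra_simps)
  have code_inj: "length \<alpha> = length \<beta> \<Longrightarrow> sum_list \<alpha> \<le> s + k \<Longrightarrow> sum_list \<beta> \<le> s + k \<Longrightarrow>
      code \<alpha> = code \<beta> \<Longrightarrow> \<alpha> = \<beta>" for \<alpha> \<beta>
  proof (induction \<alpha> \<beta> rule: list_induct2)
    case (Cons a \<alpha> b \<beta>)
    have "a < Suc (s + k)" "b < Suc (s + k)"
      using Cons.prems by auto
    moreover have "a + Suc (s + k) * code \<alpha> = b + Suc (s + k) * code \<beta>"
      using Cons.prems by (simp add: code_simps)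
    ultimately have "a = b"
      by (metis mod_less mod_mult_self2)
    moreover from this have "Suc (s + k) * code \<alpha> = Suc (s + k) * code \<beta>"
      using \<open>a + _ = _\<close> by linarith
    then have "code \<alpha> = code \<beta>"
      by (simp only: mult_cancel1) simp
    ultimately show ?case
      using Cons by simp
  qed simp
  \<comment> \<open>The smallest monomials that survive in the two factors: a nonzero coefficient in
    the first, one outside \<open>gen fs\<close> in the second. The coefficient at their product is
    inspected.\<close>
  obtain \<alpha>0 where \<alpha>0: "\<alpha>0 \<in> ?A" "\<And>\<alpha>. \<alpha> \<in> ?A \<Longrightarrow> code \<alpha>0 \<le> code \<alpha>"
    using ex_has_least_nat[of "\<lambda>\<alpha>. \<alpha> \<in> ?A" _ code] c0 by blast
  obtain \<beta>0 where \<beta>0: "\<beta>0 \<in> ?B" "\<And>\<beta>. \<beta> \<in> ?B \<Longrightarrow> code \<beta>0 \<le> code \<beta>"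
    using ex_has_least_nat[of "\<lambda>\<beta>. \<beta> \<in> ?B" \<beta> code] v0 \<beta> by blast
  define w where "w \<gamma> = (\<Sum>(\<alpha>, \<beta>)\<in>{p \<in> exps ?n s \<times> exps ?n k. map2 (+) (fst p) (snd p) = \<gamma>}. c \<alpha> * v \<beta>)" for \<gamma>
  have "eval_form fs s c * eval_form fs k v
      = (\<Sum>p\<in>exps ?n s \<times> exps ?n k. (mon fs (fst p) * c (fst p)) * (mon fs (snd p) * v (snd p)))"
    by (simp add: eval_form_def sum_product sum.cartesian_product case_prod_beta)
  also have "\<dots> = (\<Sum>\<gamma>\<in>exps ?n (s + k). \<Sum>p\<in>{p \<in> exps ?n s \<times> exps ?n k. map2 (+) (fst p) (snd p) = \<gamma>}.
      (mon fs (fst p) * c (fst p)) * (mon fs (snd p) * v (snd p)))"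
    by (rule sum.group[symmetric]) (auto simp: exps_add)
  also have "\<dots> = eval_form fs (s + k) w"
    unfolding eval_form_def w_def sum_distrib_left
    by (intro sum.cong refl) (auto simp: exps_def mon_add algebra_simps)
  finally have "eval_form fs (s + k) w \<in> forms fs (Suc (s + k)) C"
    using prod by simp
  moreover have "\<forall>\<gamma>\<in>exps ?n (s + k). w \<gamma> \<in> C"
    unfolding w_def using c v by (auto intro!: sum_C mult_C)
  ultimately have w: "w (map2 (+) \<alpha>0 \<beta>0) \<in> gen fs"
    using \<alpha>0(1) \<beta>0(1) exps_add by (intro quasi_regD[OF q fs]) auto
  let ?P = "{p \<in> exps ?n s \<times> exps ?n k. map2 (+) (fst p) (snd p) = map2 (+) \<alpha>0 \<beta>0}"
  have P0: "(\<alpha>0, \<beta>0) \<in> ?P"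
    using \<alpha>0(1) \<beta>0(1) by auto
  have "w (map2 (+) \<alpha>0 \<beta>0) = c \<alpha>0 * v \<beta>0 + (\<Sum>(\<alpha>, \<beta>)\<in>?P - {(\<alpha>0, \<beta>0)}. c \<alpha> * v \<beta>)"
    unfolding w_def by (subst sum.remove[OF _ P0]) auto
  moreover have "(\<Sum>(\<alpha>, \<beta>)\<in>?P - {(\<alpha>0, \<beta>0)}. c \<alpha> * v \<beta>) \<in> gen fs"
  proof (rule sum_gen[OF fs])
    fix p assume p: "p \<in> ?P - {(\<alpha>0, \<beta>0)}"
    obtain \<alpha> \<beta> where p_eq: "p = (\<alpha>, \<beta>)"
      by (cases p)
    have *: "\<alpha> \<in> exps ?n s" "\<beta> \<in> exps ?n k" "\<not> (\<alpha> = \<alpha>0 \<and> \<beta> = \<beta>0)"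
      "map2 (+) \<alpha> \<beta> = map2 (+) \<alpha>0 \<beta>0"
      using p by (auto simp: p_eq)
    have len: "length \<alpha> = ?n" "length \<beta> = ?n" "length \<alpha>0 = ?n" "length \<beta>0 = ?n"
      and sums: "sum_list \<alpha> = s" "sum_list \<alpha>0 = s" "sum_list \<beta> = k" "sum_list \<beta>0 = k"
      using * \<alpha>0(1) \<beta>0(1) by (auto simp: exps_def)
    have codes: "code \<alpha> + code \<beta> = code \<alpha>0 + code \<beta>0"
      using code_add[of \<alpha> \<beta>] code_add[of \<alpha>0 \<beta>0] *(4) len by simp
    have "c \<alpha> * v \<beta> \<in> gen fs"
    \<comment> \<open>Surviving monomials have codes no smaller than the minimal ones, and the sums
      of codes agree; so both codes are minimal and the pair is the one removed from the
      sum.\<close>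
    proof (cases "c \<alpha> \<noteq> 0 \<and> v \<beta> \<notin> gen fs")
      case True
      then have "code \<alpha> = code \<alpha>0" "code \<beta> = code \<beta>0"
        using \<alpha>0(2)[of \<alpha>] \<beta>0(2)[of \<beta>] codes *(1,2) by auto
      then show ?thesis
        using code_inj[of \<alpha> \<alpha>0] code_inj[of \<beta> \<beta>0] len sums *(3) by auto
    next
      case False
      then show ?thesis
        using c[OF *(1)] mult_gen[OF fs, of "c \<alpha>" "v \<beta>"] zero_gen[OF fs] by (cases "c \<alpha> = 0") auto
    qed
    then show "(case p of (\<alpha>, \<beta>) \<Rightarrow> c \<alpha> * v \<beta>) \<in> gen fs"
      by (simp add: p_eq)
  qed
  ultimately have "c \<alpha>0 * v \<beta>0 \<in> gen fs"
    using diff_gen[OF fs w, of "\<Sum>(\<alpha>, \<beta>)\<in>?P - {(\<alpha>0, \<beta>0)}. c \<alpha> * v \<beta>"] by simp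
  moreover obtain d where "d \<in> C" "d * c \<alpha>0 = 1"
    using c[of \<alpha>0] \<alpha>0(1) by auto
  ultimately show False
    using gen_unit[OF fs] \<beta>0(1) by blast
qed

text \<open>Let s be the lowest degree occurring in the polynomial and k the order of
  \<open>u\<close>, finite since \<open>u\<close> misses some power. The two forms of degrees s and
  k multiply into the power s + k + 1, as all other contributions lie there and the total is in
  \<open>I\<close>. Then the form of \<open>u\<close> has its coefficients in \<open>gen fs\<close>,
  and the order of \<open>u\<close> exceeds k.\<close>

theorem regular_polynomial_injective:
  assumes "reg fs" and fs: "set fs \<subseteq> C" and u: "u \<in> C" "u \<notin> forms fs m C"
    and A: "finite A" "\<And>\<alpha>. \<alpha> \<in> A \<Longrightarrow> length \<alpha> = length fs"
    and c: "\<And>\<alpha>. c \<alpha> \<in> C \<and> (c \<alpha> = 0 \<or> (\<exists>d\<in>C. d * c \<alpha> = 1))"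
    and rel: "(\<Sum>\<alpha>\<in>A. c \<alpha> * mon fs \<alpha>) * u \<in> I"
  shows "\<forall>\<alpha>\<in>A. c \<alpha> = 0"
proof (rule ccontr)
  let ?n = "length fs"
  assume "\<not> (\<forall>\<alpha>\<in>A. c \<alpha> = 0)"
  then obtain \<alpha>0 where \<alpha>0: "\<alpha>0 \<in> A" "c \<alpha>0 \<noteq> 0"
    "\<And>\<alpha>. \<alpha> \<in> A \<Longrightarrow> c \<alpha> \<noteq> 0 \<Longrightarrow> sum_list \<alpha>0 \<le> sum_list \<alpha>"
    using ex_has_least_nat[of "\<lambda>\<alpha>. \<alpha> \<in> A \<and> c \<alpha> \<noteq> 0" _ sum_list] by blast
  define s where "s = sum_list \<alpha>0"
  define c' where "c' \<alpha> = (if \<alpha> \<in> A then c \<alpha> else 0)" for \<alpha>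
  \<comment> \<open>The order of \<open>u\<close>: it lies in the power \<open>k\<close> but not in
    \<open>k + 1\<close>, hence the \<open>Suc\<close>.\<close>
  define k where "k = (LEAST m. u \<notin> forms fs (Suc m) C)"
  have "m \<noteq> 0"
    using u by (metis forms_0)
  then have k: "u \<notin> forms fs (Suc k) C"
    using LeastI[of "\<lambda>m. u \<notin> forms fs (Suc m) C" "m - 1"] u(2) by (simp add: k_def)
  have "u \<in> forms fs k C"
  proof (cases k)
    case 0
    then show ?thesis using u by (simp add: forms_0)
  next
    case (Suc j)
    then show ?thesis
      using not_less_Least[of j "\<lambda>m. u \<notin> forms fs (Suc m) C"] by (auto simp: k_def)
  qed
  then obtain v a where v: "u = eval_form fs k v + a" "\<forall>\<alpha>\<in>exps ?n k. v \<alpha> \<in> C" "a \<in> I"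
    unfolding forms_def by blast
  have ev: "eval_form fs k v = u + (- a)"
    using v by simp
  have ma: "- a \<in> I"
    using mult_I[OF minus_C[OF one_C] v(3)] by simp
  have high: "eval_form fs k v \<in> forms fs k C"
    unfolding ev by (intro forms_add add_C \<open>u \<in> forms fs k C\<close> I_forms zero_C ma)
  have split: "(\<Sum>\<alpha>\<in>A. c \<alpha> * mon fs \<alpha>)
      = eval_form fs s c' + (\<Sum>\<alpha>\<in>{\<alpha>\<in>A. sum_list \<alpha> \<noteq> s}. c \<alpha> * mon fs \<alpha>)"
  proof -
    have "eval_form fs s c' = (\<Sum>\<alpha>\<in>{\<alpha>\<in>A. sum_list \<alpha> = s}. c \<alpha> * mon fs \<alpha>)"
      unfolding eval_form_def
      by (rule sum.mono_neutral_cong_right) (use A finite_exps[of ?n s] in \<open>auto simp: c'_def exps_def\<close>)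
    moreover have "(\<Sum>\<alpha>\<in>A. c \<alpha> * mon fs \<alpha>)
      = (\<Sum>\<alpha>\<in>{\<alpha>\<in>A. sum_list \<alpha> = s} \<union> {\<alpha>\<in>A. sum_list \<alpha> \<noteq> s}. c \<alpha> * mon fs \<alpha>)"
      by (rule sum.cong) auto
    ultimately show ?thesis
      using A(1) by (subst (asm) sum.union_disjoint) auto
  qed
  let ?r = "\<Sum>\<alpha>\<in>{\<alpha>\<in>A. sum_list \<alpha> \<noteq> s}. c \<alpha> * mon fs \<alpha>"
  have "?r * eval_form fs k v \<in> forms fs (Suc (s + k)) C"
    unfolding sum_distrib_right
  proof (intro forms_sum add_C zero_C; clarify)
    fix \<alpha> assume \<alpha>: "\<alpha> \<in> A" "sum_list \<alpha> \<noteq> s"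
    show "c \<alpha> * mon fs \<alpha> * eval_form fs k v \<in> forms fs (Suc (s + k)) C"
    proof (cases "c \<alpha> = 0")
      case True
      then show ?thesis by (simp add: I_forms zero_C zero_I)
    next
      case False
      then have le: "Suc s \<le> sum_list \<alpha>"
        using \<alpha>0(3)[OF \<alpha>(1)] \<alpha>(2) by (simp add: s_def)
      have \<alpha>e: "\<alpha> \<in> exps ?n (sum_list \<alpha>)"
        using A(2)[OF \<alpha>(1)] by (simp add: exps_def)
      have "mon fs \<alpha> * eval_form fs k v \<in> forms fs (sum_list \<alpha> + k) C"
        unfolding eval_form_def sum_distrib_left
      proof (intro forms_sum add_C zero_C)
        fix \<beta> assume \<beta>: "\<beta> \<in> exps ?n k"
        have "mon fs (map2 (+) \<alpha> \<beta>) * v \<beta> \<in> forms fs (sum_list \<alpha> + k) C"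
          using v(2) \<beta> by (intro mon_forms zero_C exps_add \<alpha>e) auto
        then show "mon fs \<alpha> * (mon fs \<beta> * v \<beta>) \<in> forms fs (sum_list \<alpha> + k) C"
          using \<alpha>e \<beta> by (simp add: exps_def mon_add mult.assoc)
      qed
      then have "c \<alpha> * (mon fs \<alpha> * eval_form fs k v) \<in> forms fs (sum_list \<alpha> + k) C"
        using forms_mult[OF mult_C] c by blast
      then show ?thesis
        using forms_antimono[OF fs, of "Suc (s + k)" "sum_list \<alpha> + k"] le by (auto simp: mult.assoc)
    qed
  qed
  moreover have "(\<Sum>\<alpha>\<in>A. c \<alpha> * mon fs \<alpha>) * eval_form fs k v \<in> forms fs (Suc (s + k)) C"
  proof -
    have "(\<Sum>\<alpha>\<in>A. c \<alpha> * mon fs \<alpha>) * (- a) \<in> I"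
      using c by (intro mult_I[OF _ ma] sum_C mult_C mon_C[OF fs]) auto
    then show ?thesis
      unfolding ev distrib_left using I_forms[OF zero_C add_I[OF rel]] by blast
  qed
  ultimately have "(\<Sum>\<alpha>\<in>A. c \<alpha> * mon fs \<alpha>) * eval_form fs k v + (- 1) * (?r * eval_form fs k v)
      \<in> forms fs (Suc (s + k)) C"
    using forms_mult[OF mult_C, of "- 1" "?r * eval_form fs k v"] minus_C one_C
    by (intro forms_add add_C) auto
  then have "eval_form fs s c' * eval_form fs k v \<in> forms fs (Suc (s + k)) C"
    unfolding split by (simp add: algebra_simps)
  moreover have "\<exists>\<alpha>\<in>exps ?n s. c' \<alpha> \<noteq> 0"
    using \<alpha>0 A(2) by (intro bexI[of _ \<alpha>0]) (auto simp: c'_def exps_def s_def)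
  moreover have "c' \<alpha> \<in> C \<and> (c' \<alpha> = 0 \<or> (\<exists>d\<in>C. d * c' \<alpha> = 1))" for \<alpha>
    using c zero_C by (auto simp: c'_def)
  ultimately have "\<forall>\<beta>\<in>exps ?n k. v \<beta> \<in> gen fs"
    using quasi_reg_product[OF reg_imp_quasi_reg[OF fs \<open>reg fs\<close>] fs, of s c' k v] v(2) by blast
  then have "u \<in> forms fs (Suc k) C"
    unfolding forms_Suc[OF fs] unfolding forms_def using v by auto
  with k show False by simp
qed

end

section \<open>Regular sequences on quotient rings\<close>

text \<open>Submodules of R/I correspond to ideals containing I. One direction tests the
  intersection against the image of the ideal, the other pulls each submodule of the family back to
  R.\<close>

lemma ideal_times_quotient_iff:
  fixes R (structure)
  assumes "cring R" "ideal I R" and S: "S \<subseteq> carrier R" and p: "p \<in> carrier R"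
  shows "(I +> p) \<in> ideal_times_module R S (quotient_module R I) \<longleftrightarrow> p \<in> Idl (I \<union> S)"
proof -
  interpret cring R by fact
  interpret I: ideal I R by fact
  interpret Q: cring "R Quot I" by (rule I.quotient_is_cring) fact
  interpret h: ring_hom_ring R "R Quot I" "(+>) I" by (rule I.rcos_ring_hom_ring)
  let ?M = "quotient_module R I"
  interpret M: Module.module R ?M
    by (rule quotient_module_module) fact+
  have M_simps: "carrier ?M = carrier (R Quot I)" "X \<oplus>\<^bsub>?M\<^esub> Y = X \<oplus>\<^bsub>R Quot I\<^esub> Y"
    "\<zero>\<^bsub>?M\<^esub> = \<zero>\<^bsub>R Quot I\<^esub>" "r \<odot>\<^bsub>?M\<^esub> X = (I +> r) \<otimes>\<^bsub>R Quot I\<^esub> X" for X Y r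
    by (simp_all add: quotient_module_def)
  have car: "X \<in> carrier (R Quot I) \<longleftrightarrow> (\<exists>x\<in>carrier R. X = I +> x)" for X
    unfolding FactRing_def A_RCOSETS_def' partial_object.simps by blast
  have zero_Quot: "\<zero>\<^bsub>R Quot I\<^esub> = I"
    by (simp only: FactRing_def ring.select_convs)
  have IS: "I \<union> S \<subseteq> carrier R"
    using S I.a_subset by auto
  interpret J: ideal "Idl (I \<union> S)" R
    by (rule genideal_ideal[OF IS])
  have IJ: "I \<union> S \<subseteq> Idl (I \<union> S)"
    by (rule genideal_self[OF IS])
  have neg: "\<ominus>\<^bsub>?M\<^esub> (I +> x) = I +> (\<ominus> x)" if "x \<in> carrier R" for x
  proof -
    have "(I +> (\<ominus> x)) \<oplus>\<^bsub>?M\<^esub> (I +> x) = \<zero>\<^bsub>?M\<^esub>"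
      using that by (simp add: M_simps Q.l_neg)
    then show ?thesis
      using that by (intro M.minus_equality) (auto simp: M_simps simp del: h.hom_a_inv)
  qed
  let ?N = "(+>) I ` (Idl (I \<union> S))"
  show ?thesis
  proof
    assume "(I +> p) \<in> ideal_times_module R S ?M"
    moreover have "submodule ?N R ?M"
    proof (rule M.submoduleI)
      show "?N \<subseteq> carrier ?M"
        using J.a_subset by (auto simp: M_simps)
      show "\<zero>\<^bsub>?M\<^esub> \<in> ?N"
        using J.zero_closed h.hom_zero by (metis M_simps(3) imageI)
    next
      fix X assume "X \<in> ?N"
      then obtain x where x: "x \<in> Idl (I \<union> S)" "X = I +> x" "x \<in> carrier R"
        using J.a_subset by blast
      have "I +> (\<ominus> x) \<in> ?N"
        using x(1) by (intro imageI J.a_inv_closed)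
      then show "\<ominus>\<^bsub>?M\<^esub> X \<in> ?N"
        by (simp only: x(2) neg[OF x(3)])
    next
      fix X Y assume "X \<in> ?N" "Y \<in> ?N"
      then obtain x y where xy: "x \<in> Idl (I \<union> S)" "X = I +> x" "x \<in> carrier R"
        "y \<in> Idl (I \<union> S)" "Y = I +> y" "y \<in> carrier R"
        using J.a_subset by blast
      have "I +> (x \<oplus> y) \<in> ?N"
        using xy by (intro imageI J.a_closed)
      then show "X \<oplus>\<^bsub>?M\<^esub> Y \<in> ?N"
        using xy by (simp add: M_simps)
    next
      fix r X assume r: "r \<in> carrier R" and "X \<in> ?N"
      then obtain x where x: "x \<in> Idl (I \<union> S)" "X = I +> x" "x \<in> carrier R"
        using J.a_subset by blast
      have "I +> (r \<otimes> x) \<in> ?N"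
        using x r by (intro imageI J.I_l_closed)
      then show "r \<odot>\<^bsub>?M\<^esub> X \<in> ?N"
        using x r by (simp add: M_simps)
    qed
    moreover have "f \<odot>\<^bsub>?M\<^esub> u \<in> ?N" if fS: "f \<in> S" and u: "u \<in> carrier ?M" for f u
    proof -
      obtain x where "x \<in> carrier R" "u = I +> x"
        using u unfolding M_simps(1) car by blast
      moreover have "f \<in> Idl (I \<union> S)" "f \<in> carrier R"
        using fS IJ S by auto
      ultimately have "f \<odot>\<^bsub>?M\<^esub> u = I +> (f \<otimes> x)" "f \<otimes> x \<in> Idl (I \<union> S)"
        using J.I_r_closed by (simp_all add: M_simps)
      then show ?thesis by simp
    qed
    ultimately have "(I +> p) \<in> ?N"
      unfolding ideal_times_module_def by blast
    then obtain q where q: "q \<in> Idl (I \<union> S)" "I +> p = I +> q"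
      by auto
    then have "q \<in> carrier R"
      using J.a_subset by auto
    then have "I +> (p \<ominus> q) = \<zero>\<^bsub>R Quot I\<^esub>"
      using q p by (simp add: a_minus_def Q.r_neg)
    then have "p \<ominus> q \<in> I"
      using \<open>q \<in> carrier R\<close> p I.rcos_const_imp_mem[of "p \<ominus> q"] by (simp only: zero_Quot minus_closed)
    then have "(p \<ominus> q) \<oplus> q \<in> Idl (I \<union> S)"
      using IJ q by (intro J.a_closed) auto
    then show "p \<in> Idl (I \<union> S)"
      using p \<open>q \<in> carrier R\<close> by (simp add: a_minus_def a_assoc l_neg)
  next
    assume pJ: "p \<in> Idl (I \<union> S)"
    show "(I +> p) \<in> ideal_times_module R S ?M"
      unfolding ideal_times_module_def
    proof clarify
      fix N assume N: "submodule N R ?M" "\<forall>f\<in>S. \<forall>u\<in>carrier ?M. f \<odot>\<^bsub>?M\<^esub> u \<in> N"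
      note NE = M.submoduleE[OF N(1)]
      let ?P = "{q \<in> carrier R. I +> q \<in> N}"
      have zN: "\<zero>\<^bsub>?M\<^esub> \<in> N"
        using subgroup.one_closed[OF submodule.axioms(1)[OF N(1)]] by simp
      have "ideal ?P R"
      proof (rule idealI)
        show "ring R" by (rule ring_axioms)
        show "subgroup ?P (add_monoid R)"
        proof (rule add.subgroupI)
          show "?P \<subseteq> carrier R" by blast
          show "?P \<noteq> {}"
            using zN h.hom_zero M_simps(3) zero_closed by (metis (mono_tags, lifting) empty_iff mem_Collect_eq)
        next
          fix a assume "a \<in> ?P"
          then show "\<ominus> a \<in> ?P"
            using NE(3)[of "I +> a"] by (simp add: neg)
        next
          fix a b assume "a \<in> ?P" "b \<in> ?P"
          then show "a \<oplus> b \<in> ?P"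
            using NE(5)[of "I +> a" "I +> b"] by (simp add: M_simps)
        qed
      next
        fix a x assume "a \<in> ?P" "x \<in> carrier R"
        then show "x \<otimes> a \<in> ?P"
          using NE(4)[of x "I +> a"] by (simp add: M_simps)
        then show "a \<otimes> x \<in> ?P"
          using \<open>a \<in> ?P\<close> \<open>x \<in> carrier R\<close> by (simp add: m_comm)
      qed
      moreover have "I \<union> S \<subseteq> ?P"
      proof
        fix x assume x: "x \<in> I \<union> S"
        then have xc: "x \<in> carrier R" using IS by auto
        show "x \<in> ?P"
        proof (cases "x \<in> I")
          case True
          then have "I +> x = \<zero>\<^bsub>?M\<^esub>"
            unfolding M_simps(3) zero_Quot by (rule I.a_rcos_const)
          then show ?thesis using zN xc by simp
        next
          case False
          then have "x \<odot>\<^bsub>?M\<^esub> (I +> \<one>) \<in> N"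
            using x N(2) by (simp add: M_simps(1))
          moreover have "x \<odot>\<^bsub>?M\<^esub> (I +> \<one>) = I +> x"
            using xc h.hom_mult[of x \<one>] by (simp add: M_simps(4) del: h.hom_one)
          ultimately show ?thesis
            using xc by simp
        qed
      qed
      ultimately have "Idl (I \<union> S) \<subseteq> ?P"
        by (rule genideal_minimal)
      then show "I +> p \<in> N"
        using pJ by auto
    qed
  qed
qed

text \<open>Reduces regularity to ideals of R. Properness of the last submodule becomes absence of
  the unit, since an ideal containing it is the whole ring.\<close>

lemma regular_sequence_quotient_iff:
  fixes R (structure)
  assumes "cring R" "ideal I R"
  shows "regular_sequence R (quotient_module R I) fs \<longleftrightarrow>
    set fs \<subseteq> carrier R \<and>
    (\<forall>i < length fs. \<forall>p \<in> carrier R.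
       fs ! i \<otimes> p \<in> Idl (I \<union> set (take i fs)) \<longrightarrow> p \<in> Idl (I \<union> set (take i fs))) \<and>
    \<one> \<notin> Idl (I \<union> set fs)"
proof (cases "set fs \<subseteq> carrier R")
  case True
  interpret cring R by fact
  interpret I: ideal I R by fact
  interpret h: ring_hom_ring R "R Quot I" "(+>) I" by (rule I.rcos_ring_hom_ring)
  let ?M = "quotient_module R I"
  interpret M: Module.module R ?M
    by (rule quotient_module_module) fact+
  have car: "carrier ?M = (+>) I ` carrier R"
    unfolding quotient_module_def FactRing_def A_RCOSETS_def' partial_object.simps by blast
  have sub: "set (take i fs) \<subseteq> carrier R" for i
    using True set_take_subset[of i fs] by auto
  note iff = ideal_times_quotient_iff[OF assms]
  have smult: "r \<odot>\<^bsub>?M\<^esub> (I +> x) = I +> (r \<otimes> x)" if "r \<in> carrier R" "x \<in> carrier R" for r x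
    using that by (simp add: quotient_module_def)
  have 1: "(\<forall>u\<in>carrier ?M. (fs ! i) \<odot>\<^bsub>?M\<^esub> u \<in> ideal_times_module R (set (take i fs)) ?M \<longrightarrow>
        u \<in> ideal_times_module R (set (take i fs)) ?M) \<longleftrightarrow>
      (\<forall>p \<in> carrier R. fs ! i \<otimes> p \<in> Idl (I \<union> set (take i fs)) \<longrightarrow> p \<in> Idl (I \<union> set (take i fs)))"
    if "i < length fs" for i
  proof -
    have f: "fs ! i \<in> carrier R"
      using that True by (auto simp: subset_iff)
    show ?thesis
      unfolding car ball_simps
      by (intro ball_cong refl) (simp only: smult f iff sub m_closed)
  qed
  have 2: "ideal_times_module R (set fs) ?M = carrier ?M \<longleftrightarrow> \<one> \<in> Idl (I \<union> set fs)"
  proof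
    assume "ideal_times_module R (set fs) ?M = carrier ?M"
    then show "\<one> \<in> Idl (I \<union> set fs)"
      using iff[OF True one_closed] car by blast
  next
    assume one: "\<one> \<in> Idl (I \<union> set fs)"
    interpret J: ideal "Idl (I \<union> set fs)" R
      by (rule genideal_ideal) (use True I.a_subset in auto)
    have "Idl (I \<union> set fs) = carrier R"
      by (rule J.one_imp_carrier[OF one])
    then have "carrier ?M \<subseteq> ideal_times_module R (set fs) ?M"
      using iff[OF True] by (auto simp: car)
    moreover have "submodule (carrier ?M) R ?M"
      by (rule M.carrier_is_submodule)
    then have "ideal_times_module R (set fs) ?M \<subseteq> carrier ?M"
      unfolding ideal_times_module_def using True M.smult_closed by blast
    ultimately show "ideal_times_module R (set fs) ?M = carrier ?M"
      by auto
  qed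
  show ?thesis
    unfolding regular_sequence_def using 1 2 by simp
qed (simp add: regular_sequence_def)

section \<open>Squarefree monomial ideals\<close>

lemma poly_ring_simps [simp]:
  "mult (poly_ring V) = (*)" "add (poly_ring V) = (+)" "one (poly_ring V) = 1" "zero (poly_ring V) = 0"
  by (simp_all add: poly_ring_def)

lemma mem_poly_ring: "p \<in> carrier (poly_ring V) \<longleftrightarrow> (\<forall>t\<in>Poly_Mapping.keys p. Poly_Mapping.keys t \<subseteq> V)"
  by (simp add: poly_ring_def)

lemma poly_ring_closed:
  shows zero_poly_ring: "0 \<in> carrier (poly_ring V)"
    and one_poly_ring: "1 \<in> carrier (poly_ring V)"
    and add_poly_ring: "p \<in> carrier (poly_ring V) \<Longrightarrow> q \<in> carrier (poly_ring V) \<Longrightarrow> p + q \<in> carrier (poly_ring V)"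
    and mult_poly_ring: "p \<in> carrier (poly_ring V) \<Longrightarrow> q \<in> carrier (poly_ring V) \<Longrightarrow> p * q \<in> carrier (poly_ring V)"
    and uminus_poly_ring: "p \<in> carrier (poly_ring V) \<Longrightarrow> - p \<in> carrier (poly_ring V)"
proof -
  interpret cring "poly_ring V"
    by (rule poly_ring_cring)
  show "0 \<in> carrier (poly_ring V)" "1 \<in> carrier (poly_ring V)"
    "p \<in> carrier (poly_ring V) \<Longrightarrow> q \<in> carrier (poly_ring V) \<Longrightarrow> p + q \<in> carrier (poly_ring V)"
    "p \<in> carrier (poly_ring V) \<Longrightarrow> q \<in> carrier (poly_ring V) \<Longrightarrow> p * q \<in> carrier (poly_ring V)"
    using zero_closed one_closed a_closed[of p q] m_closed[of p q] by simp_all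
  show "p \<in> carrier (poly_ring V) \<Longrightarrow> - p \<in> carrier (poly_ring V)"
    by (simp add: mem_poly_ring in_keys_iff)
qed

lemma single_poly_ring: "Poly_Mapping.keys t \<subseteq> V \<Longrightarrow> Poly_Mapping.single t c \<in> carrier (poly_ring V)"
  by (simp add: mem_poly_ring)

lemma indet_poly_ring: "x \<in> V \<Longrightarrow> indet x \<in> carrier (poly_ring V)"
  by (simp add: indet_def monomial_def single_poly_ring)

lemma poly_idealD:
  assumes "ideal I (poly_ring V)"
  shows ideal_poly_ring: "I \<subseteq> carrier (poly_ring V)"
    and ideal_zero: "0 \<in> I"
    and ideal_add: "p \<in> I \<Longrightarrow> q \<in> I \<Longrightarrow> p + q \<in> I"
    and ideal_mult: "r \<in> carrier (poly_ring V) \<Longrightarrow> p \<in> I \<Longrightarrow> r * p \<in> I"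
    and ideal_diff: "p \<in> I \<Longrightarrow> q \<in> I \<Longrightarrow> p - q \<in> I"
proof -
  interpret ideal I "poly_ring V" by fact
  show sub: "I \<subseteq> carrier (poly_ring V)" and "0 \<in> I"
    using a_subset additive_subgroup.zero_closed[OF is_additive_subgroup] by simp_all
  show add: "p \<in> I \<Longrightarrow> q \<in> I \<Longrightarrow> p + q \<in> I" for p q
    using additive_subgroup.a_closed[OF is_additive_subgroup, of p q] by simp
  show mult: "r \<in> carrier (poly_ring V) \<Longrightarrow> p \<in> I \<Longrightarrow> r * p \<in> I" for r p
    using I_l_closed[of p r] by simp
  have um: "p \<in> I \<Longrightarrow> - p \<in> I" for p
    using mult[of "- 1" p] by (simp add: uminus_poly_ring one_poly_ring)
  show "p \<in> I \<Longrightarrow> q \<in> I \<Longrightarrow> p - q \<in> I"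
    using add[of p "- q"] um by simp
qed

lemma ideal_sum: "ideal I (poly_ring V) \<Longrightarrow> (\<And>i. i \<in> A \<Longrightarrow> g i \<in> I) \<Longrightarrow> sum g A \<in> I"
  by (induction A rule: infinite_finite_induct) (auto simp: ideal_zero ideal_add)

lemma poly_idealI:
  assumes "I \<subseteq> carrier (poly_ring V)" "0 \<in> I" "\<And>p q. p \<in> I \<Longrightarrow> q \<in> I \<Longrightarrow> p + q \<in> I"
    "\<And>r p. r \<in> carrier (poly_ring V) \<Longrightarrow> p \<in> I \<Longrightarrow> r * p \<in> I"
  shows "ideal I (poly_ring V :: ('v, 'k::field) mpoly ring)"
proof -
  interpret cring "poly_ring V :: ('v, 'k) mpoly ring"
    by (rule poly_ring_cring)
  show ?thesis
  proof (rule idealI)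
    show "subgroup I (add_monoid (poly_ring V :: ('v, 'k) mpoly ring))"
    proof (rule add.subgroupI)
      fix p assume p: "p \<in> I"
      have "- p \<in> I"
        using assms(4)[of "- 1" p] p by (simp add: uminus_poly_ring one_poly_ring)
      moreover have "\<ominus>\<^bsub>poly_ring V\<^esub> p = - p"
        using p assms(1) by (intro minus_equality) (auto intro: uminus_poly_ring)
      ultimately show "\<ominus>\<^bsub>poly_ring V\<^esub> p \<in> I"
        by simp
    qed (use assms in auto)
    fix p r assume *: "p \<in> I" "r \<in> carrier (poly_ring V :: ('v, 'k) mpoly ring)"
    then show "r \<otimes>\<^bsub>poly_ring V\<^esub> p \<in> I" "p \<otimes>\<^bsub>poly_ring V\<^esub> r \<in> I"
      using assms(4)[of r p] by (simp_all add: mult.commute)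
  qed (rule ring_axioms)
qed

lemma poly_genideal:
  assumes "S \<subseteq> carrier (poly_ring V)"
  shows genideal_poly_ideal: "ideal (genideal (poly_ring V) S) (poly_ring V)"
    and genideal_poly_self: "S \<subseteq> genideal (poly_ring V) S"
    and genideal_poly_minimal: "ideal I (poly_ring V) \<Longrightarrow> S \<subseteq> I \<Longrightarrow> genideal (poly_ring V) S \<subseteq> I"
proof -
  interpret cring "poly_ring V"
    by (rule poly_ring_cring)
  show "ideal (genideal (poly_ring V) S) (poly_ring V)" "S \<subseteq> genideal (poly_ring V) S"
    "ideal I (poly_ring V) \<Longrightarrow> S \<subseteq> I \<Longrightarrow> genideal (poly_ring V) S \<subseteq> I"
    using genideal_ideal[OF assms] genideal_self[OF assms] genideal_minimal by simp_all
qed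

lemma poly_mapping_sum_singles: "p = (\<Sum>t\<in>Poly_Mapping.keys p. Poly_Mapping.single t (Poly_Mapping.lookup p t))"
  by (rule poly_mapping_eqI)
    (simp add: lookup_sum lookup_single when_def in_keys_iff)

lemma lookup_single_mult:
  fixes p :: "('v, 'k::field) mpoly"
  shows "Poly_Mapping.lookup (Poly_Mapping.single e c * p) (e + t) = c * Poly_Mapping.lookup p t"
proof -
  have "Poly_Mapping.single e c * p
      = (\<Sum>s\<in>Poly_Mapping.keys p. Poly_Mapping.single (e + s) (c * Poly_Mapping.lookup p s))"
    by (subst poly_mapping_sum_singles[of p]) (simp add: sum_distrib_left mult_single)
  then show ?thesis
    by (simp add: lookup_sum lookup_single when_def in_keys_iff)
qed

lemma keys_mult_subset:
  fixes p q :: "('v, 'k::field) mpoly"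
  shows "t \<in> Poly_Mapping.keys (p * q) \<Longrightarrow> \<exists>a\<in>Poly_Mapping.keys p. \<exists>b\<in>Poly_Mapping.keys q. t = a + b"
  using keys_mult[of p q] by blast

lemma keys_exponent_add: "Poly_Mapping.keys (a + b) = Poly_Mapping.keys a \<union> Poly_Mapping.keys (b :: 'v \<Rightarrow>\<^sub>0 nat)"
  by (auto simp: in_keys_iff lookup_add)

lemma lookup_minus_nat: "Poly_Mapping.lookup (a - b) x = Poly_Mapping.lookup a x - Poly_Mapping.lookup b x"
  for a b :: "'v \<Rightarrow>\<^sub>0 nat"
  by (simp add: minus_poly_mapping.rep_eq)

lemma exponent_add_diff:
  assumes "\<And>x. Poly_Mapping.lookup a x \<le> Poly_Mapping.lookup (b :: 'v \<Rightarrow>\<^sub>0 nat) x"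
  shows "a + (b - a) = b"
  by (rule poly_mapping_eqI) (simp add: lookup_add lookup_minus_nat assms)

section \<open>Monomial ideals described by supports\<close>

definition indicator_exponent :: "'v set \<Rightarrow> ('v \<Rightarrow>\<^sub>0 nat)" where
  "indicator_exponent A = (\<Sum>x\<in>A. Poly_Mapping.single x 1)"

lemma lookup_indicator_exponent:
  "finite A \<Longrightarrow> Poly_Mapping.lookup (indicator_exponent A) x = (if x \<in> A then 1 else 0)"
  by (simp add: indicator_exponent_def lookup_sum lookup_single when_def)

lemma keys_indicator_exponent: "finite A \<Longrightarrow> Poly_Mapping.keys (indicator_exponent A) = A"
  by (auto simp: in_keys_iff lookup_indicator_exponent split: if_splits)

lemma indicator_exponent_le:
  "finite A \<Longrightarrow> A \<subseteq> Poly_Mapping.keys t \<Longrightarrow>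
    Poly_Mapping.lookup (indicator_exponent A) x \<le> Poly_Mapping.lookup t x"
  by (auto simp: lookup_indicator_exponent subset_iff in_keys_iff Suc_le_eq)

text \<open>The ideal of the squarefree monomials with supports in \<open>F\<close>, given through
  its terms: such a monomial divides t exactly if its support is contained in that of t. Membership
  is decided term by term, without generators.\<close>

definition sqf_ideal :: "'v set \<Rightarrow> 'v set set \<Rightarrow> ('v, 'k::field) mpoly set" where
  "sqf_ideal V F = {p \<in> carrier (poly_ring V). \<forall>t\<in>Poly_Mapping.keys p. \<exists>A\<in>F. A \<subseteq> Poly_Mapping.keys t}"

lemma sqf_idealI:
  "p \<in> carrier (poly_ring V) \<Longrightarrow> (\<And>t. t \<in> Poly_Mapping.keys p \<Longrightarrow> \<exists>A\<in>F. A \<subseteq> Poly_Mapping.keys t) \<Longrightarrow>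
    p \<in> sqf_ideal V F"
  by (simp add: sqf_ideal_def)

lemma sqf_idealD:
  assumes "p \<in> sqf_ideal V F"
  shows "p \<in> carrier (poly_ring V)"
    and "t \<in> Poly_Mapping.keys p \<Longrightarrow> \<exists>A\<in>F. A \<subseteq> Poly_Mapping.keys t"
  using assms by (simp_all add: sqf_ideal_def)

lemma monomial_ideal:
  assumes "\<And>s t. P t \<Longrightarrow> P (s + t)"
  shows "ideal {p \<in> carrier (poly_ring V). \<forall>t\<in>Poly_Mapping.keys p. P t} (poly_ring V :: ('v, 'k::field) mpoly ring)"
proof (rule poly_idealI)
  fix p q :: "('v, 'k) mpoly"
  assume "p \<in> {p \<in> carrier (poly_ring V). \<forall>t\<in>Poly_Mapping.keys p. P t}"
    "q \<in> {p \<in> carrier (poly_ring V). \<forall>t\<in>Poly_Mapping.keys p. P t}"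
  then show "p + q \<in> {p \<in> carrier (poly_ring V). \<forall>t\<in>Poly_Mapping.keys p. P t}"
    using Poly_Mapping.keys_add[of p q] by (auto simp: add_poly_ring)
next
  fix r p :: "('v, 'k) mpoly"
  assume rp: "r \<in> carrier (poly_ring V)" "p \<in> {p \<in> carrier (poly_ring V). \<forall>t\<in>Poly_Mapping.keys p. P t}"
  have "P t" if "t \<in> Poly_Mapping.keys (r * p)" for t
    using keys_mult_subset[OF that] rp assms by auto
  then show "r * p \<in> {p \<in> carrier (poly_ring V). \<forall>t\<in>Poly_Mapping.keys p. P t}"
    using rp by (auto simp: mult_poly_ring)
qed (auto simp: zero_poly_ring)

lemma sqf_ideal_ideal: "ideal (sqf_ideal V F) (poly_ring V)"
  unfolding sqf_ideal_def by (rule monomial_ideal) (auto simp: keys_exponent_add)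

lemma zero_constant_coeff_ideal:
  "ideal {p \<in> carrier (poly_ring V). Poly_Mapping.lookup p 0 = 0} (poly_ring V :: ('v, 'k::field) mpoly ring)"
proof -
  have *: "(\<forall>t\<in>Poly_Mapping.keys p. t \<noteq> 0) \<longleftrightarrow> Poly_Mapping.lookup p 0 = 0" for p :: "('v, 'k) mpoly"
    by (auto simp: in_keys_iff)
  have "s + t \<noteq> 0" if "t \<noteq> 0" for s t :: "'v \<Rightarrow>\<^sub>0 nat"
    using that by (metis keys_exponent_add keys_zero keys_eq_empty Un_empty)
  then show ?thesis
    unfolding *[symmetric] by (rule monomial_ideal)
qed

lemma monomial_mult: "monomial (a + b) = monomial a * monomial b"
  by (simp add: monomial_def mult_single)

lemma edge_ideal_subset:
  assumes G: "finite_simple_graph G"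
  shows "edge_ideal G \<subseteq>
    {p \<in> carrier (poly_ring (vertices G)). \<forall>t\<in>Poly_Mapping.keys p. \<exists>e\<in>edges G. e \<subseteq> Poly_Mapping.keys t}"
  unfolding edge_ideal_def
proof (rule genideal_poly_minimal)
  have V: "x \<in> vertices G" "y \<in> vertices G" if "{x, y} \<in> edges G" for x y
    using G that unfolding finite_simple_graph_def by blast+
  show sub: "{indet x * indet y |x y. {x, y} \<in> edges G} \<subseteq> carrier (poly_ring (vertices G))"
    using V by (auto intro!: mult_poly_ring indet_poly_ring)
  show "{indet x * indet y |x y. {x, y} \<in> edges G}
    \<subseteq> {p \<in> carrier (poly_ring (vertices G)). \<forall>t\<in>Poly_Mapping.keys p. \<exists>e\<in>edges G. e \<subseteq> Poly_Mapping.keys t}"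
  proof clarify
    fix x y assume "{x, y} \<in> edges G"
    moreover from this have "indet x * indet y \<in> carrier (poly_ring (vertices G))"
      using sub by blast
    ultimately show "indet x * indet y \<in> carrier (poly_ring (vertices G)) \<and>
      (\<forall>t\<in>Poly_Mapping.keys (indet x * indet y). \<exists>e\<in>edges G. e \<subseteq> Poly_Mapping.keys t)"
      by (auto simp: indet_def monomial_def mult_single keys_exponent_add intro!: bexI[of _ "{x, y}"])
  qed
  show "ideal {p \<in> carrier (poly_ring (vertices G)). \<forall>t\<in>Poly_Mapping.keys p. \<exists>e\<in>edges G. e \<subseteq> Poly_Mapping.keys t}
     (poly_ring (vertices G))"
    by (rule monomial_ideal) (auto simp: keys_exponent_add)
qed

lemma indicator_mem_edge_ideal:
  assumes G: "finite_simple_graph G" and e: "e \<in> edges G"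
  shows "monomial (indicator_exponent e) \<in> edge_ideal G"
proof -
  obtain x y where xy: "e = {x, y}" "x \<noteq> y"
    using G e by (metis card_2_iff finite_simple_graph_def)
  have V: "x \<in> vertices G" "y \<in> vertices G" if "{x, y} \<in> edges G" for x y
    using G that unfolding finite_simple_graph_def by blast+
  have "{indet x * indet y |x y. {x, y} \<in> edges G} \<subseteq> edge_ideal G"
    unfolding edge_ideal_def
    by (rule genideal_poly_self) (use V in \<open>auto intro!: mult_poly_ring indet_poly_ring\<close>)
  then have "indet x * indet y \<in> edge_ideal G"
    using e xy by blast
  also have "indet x * indet y = (monomial (indicator_exponent e) :: ('a, 'b) mpoly)"
    using xy by (simp add: indet_def indicator_exponent_def monomial_mult)
  finally show ?thesis .
qed

text \<open>A term of a product of two elements of the edge ideal splits into two exponents, each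
  supporting an edge; if the sum is squarefree, the edges share no vertex. Conversely, two disjoint
  edges in a support give a squarefree element of the ideal product that divides the term.\<close>

theorem squarefree_square_eq:
  fixes G :: "'v sgraph"
  assumes G: "finite_simple_graph G"
  shows "(squarefree_square G :: ('v, 'k::field) mpoly set) =
    sqf_ideal (vertices G) {e \<union> e' | e e'. e \<in> edges G \<and> e' \<in> edges G \<and> e \<inter> e' = {}}"
    (is "_ = sqf_ideal ?V ?F")
proof
  let ?R = "poly_ring ?V :: ('v, 'k) mpoly ring"
    and ?P = "ideal_prod (poly_ring ?V :: ('v, 'k) mpoly ring) (edge_ideal G) (edge_ideal G)"
  let ?S = "{p \<in> ?P. \<exists>t. squarefree_exponent t \<and> p = monomial t}"
  \<comment> \<open>The decomposition \<open>t = a + b\<close> is remembered, not only the support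
    of \<open>t\<close>: a shared vertex shows up as an exponent of at least two in the sum.\<close>
  define split where "split t \<longleftrightarrow> (\<exists>e\<in>edges G. \<exists>e'\<in>edges G. \<exists>a b. t = a + b \<and>
      e \<subseteq> Poly_Mapping.keys a \<and> e' \<subseteq> Poly_Mapping.keys b)" for t :: "'v \<Rightarrow>\<^sub>0 nat"
  have P: "p \<in> carrier ?R \<and> (\<forall>t\<in>Poly_Mapping.keys p. split t)" if "p \<in> ?P" for p
    using that
  proof induction
    case (prod i j)
    then have ij: "i \<in> carrier ?R" "j \<in> carrier ?R"
      "\<forall>t\<in>Poly_Mapping.keys i. \<exists>e\<in>edges G. e \<subseteq> Poly_Mapping.keys t"
      "\<forall>t\<in>Poly_Mapping.keys j. \<exists>e\<in>edges G. e \<subseteq> Poly_Mapping.keys t"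
      using edge_ideal_subset[OF G] by blast+
    have "split t" if t: "t \<in> Poly_Mapping.keys (i * j)" for t
    proof -
      obtain a b where ab: "a \<in> Poly_Mapping.keys i" "b \<in> Poly_Mapping.keys j" "t = a + b"
        using keys_mult_subset[OF t] by blast
      obtain e e' where "e \<in> edges G" "e \<subseteq> Poly_Mapping.keys a"
        "e' \<in> edges G" "e' \<subseteq> Poly_Mapping.keys b"
        using ij(3,4) ab(1,2) by meson
      then show ?thesis
        unfolding split_def ab(3) by (intro bexI exI conjI) (rule refl, assumption+)
    qed
    then show ?case
      using mult_poly_ring[OF ij(1,2)] by simp
  next
    case (sum p q)
    have "split t" if "t \<in> Poly_Mapping.keys (p + q)" for t
      using Poly_Mapping.keys_add[of p q] that sum.IH by blast
    then show ?case
      using sum.IH add_poly_ring[of p ?V q] by simp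
  qed
  then have S: "?S \<subseteq> carrier ?R"
    by blast
  show "(squarefree_square G :: ('v, 'k) mpoly set) \<subseteq> sqf_ideal ?V ?F"
    unfolding squarefree_square_def
  proof (rule genideal_poly_minimal[OF S sqf_ideal_ideal], rule subsetI)
    fix p assume p: "p \<in> ?S"
    then obtain t where t: "squarefree_exponent t" "p = monomial t"
      by blast
    then obtain e e' a b where *: "e \<in> edges G" "e' \<in> edges G" "t = a + b"
      "e \<subseteq> Poly_Mapping.keys a" "e' \<subseteq> Poly_Mapping.keys b"
      using P[of p] p by (auto simp: monomial_def split_def)
    have "e \<inter> e' = {}"
    proof (rule ccontr)
      assume "e \<inter> e' \<noteq> {}"
      then obtain x where "x \<in> e" "x \<in> e'" by blast
      then have "Poly_Mapping.lookup a x \<ge> 1" "Poly_Mapping.lookup b x \<ge> 1"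
        using * by (auto simp: subset_iff in_keys_iff Suc_le_eq)
      moreover have "Poly_Mapping.lookup a x + Poly_Mapping.lookup b x \<le> 1"
        using t *(3) by (auto simp: squarefree_exponent_def lookup_add)
      ultimately show False by linarith
    qed
    then have F: "e \<union> e' \<in> ?F" "e \<union> e' \<subseteq> Poly_Mapping.keys t"
      using * by (auto simp: keys_exponent_add)
    have pC: "p \<in> carrier ?R" and keys: "Poly_Mapping.keys p = {t}"
      using P[of p] p t(2) by (auto simp: monomial_def)
    show "p \<in> sqf_ideal ?V ?F"
    proof (rule sqf_idealI[OF pC])
      fix t' assume "t' \<in> Poly_Mapping.keys p"
      then have "e \<union> e' \<subseteq> Poly_Mapping.keys t'"
        using F(2) keys by simp
      then show "\<exists>A\<in>?F. A \<subseteq> Poly_Mapping.keys t'"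
        by (rule bexI) (rule F(1))
    qed
  qed
  have id: "ideal (squarefree_square G :: ('v, 'k) mpoly set) ?R"
    unfolding squarefree_square_def by (rule genideal_poly_ideal[OF S])
  show "(sqf_ideal ?V ?F :: ('v, 'k) mpoly set) \<subseteq> squarefree_square G"
  proof
    fix p :: "('v, 'k) mpoly"
    assume p: "p \<in> sqf_ideal ?V ?F"
    have "Poly_Mapping.single t (Poly_Mapping.lookup p t) \<in> squarefree_square G" if t: "t \<in> Poly_Mapping.keys p" for t
    proof -
      obtain e e' where e: "e \<in> edges G" "e' \<in> edges G" "e \<inter> e' = {}" "e \<union> e' \<subseteq> Poly_Mapping.keys t"
        using sqf_idealD(2)[OF p t] by auto
      have fin: "finite e" "finite e'"
        using G e by (auto simp: finite_simple_graph_def intro: finite_subset)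
      let ?s = "indicator_exponent e + indicator_exponent e'"
      have look: "Poly_Mapping.lookup ?s x = (if x \<in> e \<union> e' then 1 else 0)" for x
        using e(3) fin by (auto simp: lookup_add lookup_indicator_exponent)
      have "monomial ?s \<in> ?P"
        unfolding monomial_mult
        using ideal_prod.prod[OF indicator_mem_edge_ideal[OF G e(1)] indicator_mem_edge_ideal[OF G e(2)], of ?R]
        by simp
      moreover have "squarefree_exponent ?s"
        by (simp add: squarefree_exponent_def look)
      ultimately have "monomial ?s \<in> ?S"
        by (intro CollectI conjI exI[of _ ?s] refl)
      then have s: "(monomial ?s :: ('v, 'k) mpoly) \<in> squarefree_square G"
        unfolding squarefree_square_def by (rule subsetD[OF genideal_poly_self[OF S]])
      have t_eq: "?s + (t - ?s) = t"
      proof (rule exponent_add_diff)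
        fix x show "Poly_Mapping.lookup ?s x \<le> Poly_Mapping.lookup t x"
          unfolding look using e(4) by (auto simp: subset_iff in_keys_iff Suc_le_eq)
      qed
      have "Poly_Mapping.keys (t - ?s) \<subseteq> Poly_Mapping.keys t"
        by (auto simp: in_keys_iff lookup_minus_nat)
      moreover have "Poly_Mapping.keys t \<subseteq> ?V"
        using sqf_idealD(1)[OF p] t by (simp add: mem_poly_ring)
      ultimately have "Poly_Mapping.single (t - ?s) (Poly_Mapping.lookup p t) * monomial ?s \<in> squarefree_square G"
        by (intro ideal_mult[OF id _ s] single_poly_ring) auto
      then show ?thesis
        using t_eq by (simp add: monomial_def mult_single add.commute)
    qed
    then show "p \<in> squarefree_square G"
      by (subst poly_mapping_sum_singles) (rule ideal_sum[OF id])
  qed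
qed

section \<open>Regular sequences and facets\<close>

lemma subring_ideal_poly_ring:
  "ideal I (poly_ring V) \<Longrightarrow> subring_ideal (carrier (poly_ring V)) I"
  by unfold_locales
    (auto simp: one_poly_ring uminus_poly_ring add_poly_ring mult_poly_ring ideal_zero ideal_add
      ideal_mult dest: ideal_poly_ring)

lemma gen_eq_genideal:
  assumes I: "ideal I (poly_ring V)" and fs: "set fs \<subseteq> carrier (poly_ring V)"
  shows "subring_ideal.gen (carrier (poly_ring V)) I fs = genideal (poly_ring V) (I \<union> set fs)"
proof -
  interpret subring_ideal "carrier (poly_ring V)" I
    by (rule subring_ideal_poly_ring[OF I])
  have sub: "I \<union> set fs \<subseteq> carrier (poly_ring V)"
    using fs I_C by blast
  show ?thesis
  proof
    have "ideal (gen fs) (poly_ring V)"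
      using gen_props[OF fs] zero_gen[OF fs] by (intro poly_idealI) auto
    moreover have "I \<union> set fs \<subseteq> gen fs"
      using I_gen[OF fs] mult_gen_mem[OF fs one_C] by auto
    ultimately show "genideal (poly_ring V) (I \<union> set fs) \<subseteq> gen fs"
      by (rule genideal_poly_minimal[OF sub])
    have J: "gen gs \<subseteq> J" if "ideal J (poly_ring V)" "I \<union> set gs \<subseteq> J" for J gs
      using that(2)
    proof (induction gs)
      case (Cons g gs)
      then have IH: "gen gs \<subseteq> J" and g: "g \<in> J"
        by auto
      show ?case
      proof
        fix x assume "x \<in> gen (g # gs)"
        then obtain y r where "x = y + r * g" "y \<in> gen gs" "r \<in> carrier (poly_ring V)"
          by auto
        then show "x \<in> J"
          using IH g ideal_add[OF that(1)] ideal_mult[OF that(1)] by auto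
      qed
    qed simp
    show "gen fs \<subseteq> genideal (poly_ring V) (I \<union> set fs)"
      by (rule J[OF genideal_poly_ideal[OF sub] genideal_poly_self[OF sub]])
  qed
qed

lemma regular_sequence_reg:
  assumes I: "ideal I (poly_ring V)"
    and reg: "regular_sequence (poly_ring V) (quotient_module (poly_ring V) I) fs"
  shows "subring_ideal.reg (carrier (poly_ring V)) I (rev fs)"
proof -
  interpret subring_ideal "carrier (poly_ring V)" I
    by (rule subring_ideal_poly_ring[OF I])
  have *: "set fs \<subseteq> carrier (poly_ring V)"
    "\<And>i p. i < length fs \<Longrightarrow> p \<in> carrier (poly_ring V) \<Longrightarrow>
       fs ! i * p \<in> genideal (poly_ring V) (I \<union> set (take i fs)) \<Longrightarrow>
       p \<in> genideal (poly_ring V) (I \<union> set (take i fs))"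
    using reg unfolding regular_sequence_quotient_iff[OF poly_ring_cring I] poly_ring_simps by blast+
  have "reg (rev (take k fs))" if "k \<le> length fs" for k
    using that
  proof (induction k)
    case (Suc k)
    have "set (take k fs) \<subseteq> carrier (poly_ring V)"
      using *(1) set_take_subset[of k fs] by blast
    then have "gen (rev (take k fs)) = genideal (poly_ring V) (I \<union> set (take k fs))"
      using gen_eq_genideal[OF I, of "rev (take k fs)"] by simp
    then show ?case
      using Suc *(2)[of k] by (simp add: take_Suc_conv_app_nth)
  qed simp
  from this[of "length fs"] show ?thesis by simp
qed

text \<open>Bounds single exponents rather than the total degree, so that the admissible exponents
  supported in \<open>S\<close> form a box whose size is a power with exponent
  \<open>card S\<close>.\<close>

definition exponents_le :: "nat \<Rightarrow> ('v, 'k::field) mpoly \<Rightarrow> bool" where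
  "exponents_le W p \<longleftrightarrow> (\<forall>t\<in>Poly_Mapping.keys p. \<forall>x. Poly_Mapping.lookup t x \<le> W)"

lemma exponents_le_mult: "exponents_le a p \<Longrightarrow> exponents_le b q \<Longrightarrow> exponents_le (a + b) (p * q)"
  unfolding exponents_le_def
proof (intro ballI allI)
  fix t x assume *: "\<forall>t\<in>Poly_Mapping.keys p. \<forall>x. Poly_Mapping.lookup t x \<le> a"
    "\<forall>t\<in>Poly_Mapping.keys q. \<forall>x. Poly_Mapping.lookup t x \<le> b" "t \<in> Poly_Mapping.keys (p * q)"
  then obtain u v where "u \<in> Poly_Mapping.keys p" "v \<in> Poly_Mapping.keys q" "t = u + v"
    using keys_mult_subset by blast
  then show "Poly_Mapping.lookup t x \<le> a + b"
    using * by (simp add: lookup_add add_mono)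
qed

lemma exponents_le_power: "exponents_le a p \<Longrightarrow> exponents_le (n * a) (p ^ n)"
proof (induction n)
  case 0
  then show ?case by (simp add: exponents_le_def)
next
  case (Suc n)
  then show ?case
    using exponents_le_mult[of a p "n * a" "p ^ n"] by simp
qed

lemma exponents_le_mono: "exponents_le a p \<Longrightarrow> a \<le> b \<Longrightarrow> exponents_le b p"
  unfolding exponents_le_def using order_trans by blast

lemma exponents_le_mon:
  "\<forall>f\<in>set fs. exponents_le D f \<Longrightarrow> length \<alpha> = length fs \<Longrightarrow> exponents_le (sum_list \<alpha> * D) (mon fs \<alpha>)"
proof (induction fs arbitrary: \<alpha>)
  case Nil
  then show ?case by (simp add: exponents_le_def)
next
  case (Cons f fs)
  then obtain a \<beta> where \<alpha>: "\<alpha> = a # \<beta>" "length \<beta> = length fs"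
    by (auto simp: length_Suc_conv)
  have "exponents_le (a * D + sum_list \<beta> * D) (f ^ a * mon fs \<beta>)"
    using Cons \<alpha> by (intro exponents_le_mult exponents_le_power) auto
  then show ?case
    using \<alpha> by (simp add: add_mult_distrib)
qed

lemma ex_exponents_le: "\<exists>D. \<forall>f\<in>set fs. exponents_le D f"
proof (induction fs)
  case (Cons f fs)
  then obtain D where D: "\<forall>f\<in>set fs. exponents_le D f" by blast
  let ?S = "\<Union>t\<in>Poly_Mapping.keys f. Poly_Mapping.lookup t ` Poly_Mapping.keys t"
  have "Poly_Mapping.lookup t x \<le> Max (insert 0 ?S)" if "t \<in> Poly_Mapping.keys f" for t x
  proof (cases "x \<in> Poly_Mapping.keys t")
    case True
    then show ?thesis using that by (intro Max_ge) auto
  qed (simp add: in_keys_iff)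
  then obtain E where "exponents_le E f"
    unfolding exponents_le_def by blast
  then have "\<forall>g\<in>set (f # fs). exponents_le (max D E) g"
    using D exponents_le_mono[of D _ "max D E"] exponents_le_mono[of E f "max D E"] by auto
  then show ?case by blast
qed simp

lemma exponents_bounded:
  assumes "finite S"
  shows "finite {t :: 'v \<Rightarrow>\<^sub>0 nat. Poly_Mapping.keys t \<subseteq> S \<and> (\<forall>x. Poly_Mapping.lookup t x \<le> W)}"
    and "card {t :: 'v \<Rightarrow>\<^sub>0 nat. Poly_Mapping.keys t \<subseteq> S \<and> (\<forall>x. Poly_Mapping.lookup t x \<le> W)} \<le> (W + 1) ^ card S"
proof -
  let ?T = "{t :: 'v \<Rightarrow>\<^sub>0 nat. Poly_Mapping.keys t \<subseteq> S \<and> (\<forall>x. Poly_Mapping.lookup t x \<le> W)}"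
  let ?g = "\<lambda>t. restrict (Poly_Mapping.lookup t) S"
  have inj: "inj_on ?g ?T"
  proof (intro inj_onI poly_mapping_eqI)
    fix s t x assume *: "s \<in> ?T" "t \<in> ?T" "?g s = ?g t"
    show "Poly_Mapping.lookup s x = Poly_Mapping.lookup t x"
    proof (cases "x \<in> S")
      case True
      then show ?thesis using fun_cong[OF *(3), of x] by simp
    next
      case False
      then have "x \<notin> Poly_Mapping.keys s" "x \<notin> Poly_Mapping.keys t"
        using * by blast+
      then show ?thesis by (simp add: in_keys_iff)
    qed
  qed
  have img: "?g ` ?T \<subseteq> PiE S (\<lambda>_. {..W})"
    by auto
  have fin: "finite (PiE S (\<lambda>_. {..W}))"
    using assms by (simp add: finite_PiE)
  show "finite ?T"
    using inj finite_subset[OF img fin] by (rule finite_imageD[rotated])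
  have "card ?T \<le> card (PiE S (\<lambda>_. {..W}))"
    by (rule card_inj_on_le[OF inj img fin])
  then show "card ?T \<le> (W + 1) ^ card S"
    using assms by (simp add: card_PiE)
qed

section \<open>Degrees of products in the graded maximal ideal\<close>

lemma sum_lookup_keys_ge_1:
  "finite V \<Longrightarrow> Poly_Mapping.keys t \<subseteq> V \<Longrightarrow> t \<noteq> 0 \<Longrightarrow> 1 \<le> (\<Sum>x\<in>V. Poly_Mapping.lookup (t :: 'v \<Rightarrow>\<^sub>0 nat) x)"
proof -
  assume *: "finite V" "Poly_Mapping.keys t \<subseteq> V" "t \<noteq> 0"
  then obtain x where "x \<in> Poly_Mapping.keys t"
    by (metis keys_eq_empty all_not_in_conv)
  then have "x \<in> V" "Poly_Mapping.lookup t x \<ge> 1"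
    using * by (auto simp: in_keys_iff Suc_le_eq)
  then show ?thesis
    using member_le_sum[of x V "Poly_Mapping.lookup t"] *(1) by simp
qed

lemma graded_maximal_ideal_subset:
  "graded_maximal_ideal V \<subseteq> {p \<in> carrier (poly_ring V). Poly_Mapping.lookup p 0 = (0 :: 'k::field)}"
  unfolding graded_maximal_ideal_def
proof (rule genideal_poly_minimal[OF _ zero_constant_coeff_ideal])
  show "(indet ` V :: ('a, 'k) mpoly set) \<subseteq> carrier (poly_ring V)"
    by (auto intro: indet_poly_ring)
  have "Poly_Mapping.single x (1::nat) \<noteq> 0" for x :: 'a
    by (metis lookup_single_eq lookup_zero zero_neq_one)
  then show "(indet ` V :: ('a, 'k) mpoly set) \<subseteq> {p \<in> carrier (poly_ring V). Poly_Mapping.lookup p 0 = 0}"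
    by (auto simp: single_poly_ring indet_def monomial_def lookup_single when_def)
qed

lemma graded_maximal_ideal_closed:
  shows graded_maximal_ideal_ideal: "ideal (graded_maximal_ideal V) (poly_ring V)"
    and indet_graded_maximal: "x \<in> V \<Longrightarrow> indet x \<in> graded_maximal_ideal V"
proof -
  have "indet ` V \<subseteq> carrier (poly_ring V)"
    by (auto intro: indet_poly_ring)
  from genideal_poly_ideal[OF this] genideal_poly_self[OF this]
  show "ideal (graded_maximal_ideal V) (poly_ring V)" "x \<in> V \<Longrightarrow> indet x \<in> graded_maximal_ideal V"
    unfolding graded_maximal_ideal_def by auto
qed

lemma graded_maximal_carrier: "graded_maximal_ideal V \<subseteq> carrier (poly_ring V)"
  by (rule ideal_poly_ring[OF graded_maximal_ideal_ideal])

text \<open>Each entry lacks a constant term, so all its terms have degree at least one, and a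
  product of \<open>sum_list \<alpha>\<close> entries has only terms of at least that
  degree.\<close>

lemma mon_order:
  assumes V: "finite V" and fs: "set fs \<subseteq> graded_maximal_ideal V"
    and t: "t \<in> Poly_Mapping.keys (mon fs \<alpha> :: ('v, 'k::field) mpoly)" and len: "length \<alpha> = length fs"
  shows "sum_list \<alpha> \<le> (\<Sum>x\<in>V. Poly_Mapping.lookup t x)"
  using fs t len
proof (induction fs arbitrary: \<alpha> t)
  case (Cons f fs)
  obtain a \<beta> where \<alpha>: "\<alpha> = a # \<beta>" "length \<beta> = length fs"
    using Cons.prems by (auto simp: length_Suc_conv)
  have f: "f \<in> carrier (poly_ring V)" "Poly_Mapping.lookup f 0 = 0"
    using Cons.prems graded_maximal_ideal_subset[of V] by auto
  have pow: "b \<le> (\<Sum>x\<in>V. Poly_Mapping.lookup s x)" if "s \<in> Poly_Mapping.keys (f ^ b)" for s b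
    using that
  proof (induction b arbitrary: s)
    case (Suc b)
    obtain u v where uv: "u \<in> Poly_Mapping.keys f" "v \<in> Poly_Mapping.keys (f ^ b)" "s = u + v"
      using keys_mult_subset[of s f "f ^ b"] Suc.prems by auto
    have "1 \<le> (\<Sum>x\<in>V. Poly_Mapping.lookup u x)"
      using f uv(1) by (intro sum_lookup_keys_ge_1 V) (auto simp: mem_poly_ring in_keys_iff)
    then show ?case
      using Suc.IH[OF uv(2)] by (simp add: uv(3) lookup_add sum.distrib)
  qed simp
  obtain u v where uv: "u \<in> Poly_Mapping.keys (f ^ a)" "v \<in> Poly_Mapping.keys (mon fs \<beta>)" "t = u + v"
    using keys_mult_subset[of t "f ^ a" "mon fs \<beta>"] Cons.prems \<alpha> by auto
  then show ?case
    using pow[OF uv(1)] Cons.IH[OF _ uv(2)] Cons.prems \<alpha> by (simp add: lookup_add sum.distrib)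
qed simp

theorem regular_sequence_length_le_facet:
  fixes F :: "'v set set" and fs :: "('v, 'k::field) mpoly list"
  assumes V: "finite V" and S: "S \<subseteq> V" "\<And>A. A \<in> F \<Longrightarrow> \<not> A \<subseteq> S"
    "\<And>v. v \<in> V - S \<Longrightarrow> \<exists>A\<in>F. A \<subseteq> insert v S"
    and fs: "set fs \<subseteq> graded_maximal_ideal V"
    and reg: "regular_sequence (poly_ring V) (quotient_module (poly_ring V) (sqf_ideal V F)) fs"
  shows "length fs \<le> card S"
proof (rule ccontr)
  let ?C = "carrier (poly_ring V :: ('v, 'k) mpoly ring)" and ?I = "sqf_ideal V F :: ('v, 'k) mpoly set"
  assume "\<not> length fs \<le> card S"
  define gs where "gs = rev fs"
  define n where "n = length gs"
  have n: "card S < n"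
    using \<open>\<not> length fs \<le> card S\<close> by (simp add: n_def gs_def)
  have finS: "finite S"
    using S(1) V by (rule finite_subset)
  interpret subring_ideal ?C ?I
    by (rule subring_ideal_poly_ring[OF sqf_ideal_ideal])
  have gsm: "set gs \<subseteq> graded_maximal_ideal V"
    using fs by (simp add: gs_def)
  then have gs: "set gs \<subseteq> ?C"
    using graded_maximal_ideal_subset by blast
  obtain D where D: "\<forall>f\<in>set gs. exponents_le D f"
    using ex_exponents_le by blast
  \<comment> \<open>\<open>N\<close> exceeds \<open>(D * n + 1) ^ card S\<close> by one; with
    \<open>W + 1 \<le> (D * n + 1) * N\<close> and \<open>card S < n\<close> this makes
    \<open>T\<close> smaller than \<open>A\<close>. \<open>W\<close> bounds the exponents in every
    product \<open>mon gs \<alpha>\<close> with \<open>\<alpha>\<close> in \<open>A\<close>.\<close>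
  define N where "N = (D * n + 1) ^ card S + 1"
  define W where "W = n * N * D"
  define A where "A = {\<alpha>. set \<alpha> \<subseteq> {..<N} \<and> length \<alpha> = n}"
  define T where "T = {t. Poly_Mapping.keys t \<subseteq> S \<and> (\<forall>x. Poly_Mapping.lookup t x \<le> W)}"
  have finA: "finite A" and cardA: "card A = N ^ n"
    unfolding A_def by (simp_all add: finite_lists_length_eq card_lists_length_eq)
  have "W + 1 \<le> (D * n + 1) * N"
    by (simp add: W_def N_def algebra_simps)
  then have "(W + 1) ^ card S \<le> (D * n + 1) ^ card S * N ^ card S"
    by (metis power_mono power_mult_distrib zero_le)
  also have "\<dots> < N * N ^ card S"
    by (intro mult_strict_right_mono) (auto simp: N_def)
  also have "\<dots> \<le> N ^ n"
    using n power_increasing[of "Suc (card S)" n N] by (simp add: N_def)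
  finally have cardT: "card T < card A"
    unfolding T_def cardA using exponents_bounded(2)[OF finS, of W] by linarith
  \<comment> \<open>One unknown for each list in \<open>A\<close>, one equation for each exponent in
    \<open>T\<close>: the solution cancels all terms of the combination that are supported in
    \<open>S\<close>.\<close>
  obtain c where c: "\<exists>\<alpha>\<in>A. c \<alpha> \<noteq> 0"
    "\<forall>t\<in>T. (\<Sum>\<alpha>\<in>A. c \<alpha> * Poly_Mapping.lookup (mon gs \<alpha>) t) = 0"
    using linear_dependence[OF _ finA cardT, of "\<lambda>\<alpha>. Poly_Mapping.lookup (mon gs \<alpha>)"]
      exponents_bounded(1)[OF finS, of W] by (auto simp: T_def)
  \<comment> \<open>Field elements enter as constant polynomials, so the nonzero ones are units of
    \<open>?C\<close>.\<close>
  define c' where "c' \<alpha> = (Poly_Mapping.single 0 (c \<alpha>) :: ('v, 'k) mpoly)" for \<alpha>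
  define q where "q = (\<Sum>\<alpha>\<in>A. c' \<alpha> * mon gs \<alpha>)"
  define u where "u = (monomial (indicator_exponent S) :: ('v, 'k) mpoly)"
  have c'C: "c' \<alpha> \<in> ?C \<and> (c' \<alpha> = 0 \<or> (\<exists>d\<in>?C. d * c' \<alpha> = 1))" for \<alpha>
    by (cases "c \<alpha> = 0")
      (auto simp: c'_def single_poly_ring zero_poly_ring mult_single intro!: bexI[of _ "Poly_Mapping.single 0 (1 / c \<alpha>)"])
  have "Poly_Mapping.lookup (Poly_Mapping.single 0 a * p) t = a * Poly_Mapping.lookup p t"
    for a t and p :: "('v, 'k) mpoly"
    using lookup_single_mult[of 0 a p t] by simp
  then have lookq: "Poly_Mapping.lookup q t = (\<Sum>\<alpha>\<in>A. c \<alpha> * Poly_Mapping.lookup (mon gs \<alpha>) t)" for t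
    unfolding q_def lookup_sum c'_def by simp
  have qS: "\<not> Poly_Mapping.keys t \<subseteq> S" if t: "t \<in> Poly_Mapping.keys q" for t
  proof
    assume tS: "Poly_Mapping.keys t \<subseteq> S"
    obtain \<alpha> where \<alpha>: "\<alpha> \<in> A" "t \<in> Poly_Mapping.keys (mon gs \<alpha>)"
      using t unfolding in_keys_iff lookq by (metis (no_types, lifting) mult_zero_right sum.neutral)
    then have len: "length \<alpha> = length gs" and le: "set \<alpha> \<subseteq> {..<N}"
      by (auto simp: A_def n_def)
    have "sum_list \<alpha> \<le> n * N"
      using sum_list_mono[of \<alpha> "\<lambda>x. x" "\<lambda>_. N"] le len
      by (auto simp: sum_list_triv n_def subset_iff less_imp_le)
    then have "exponents_le W (mon gs \<alpha>)"
      using exponents_le_mono[OF exponents_le_mon[OF D len]] by (simp add: W_def)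
    then have "t \<in> T"
      using \<alpha>(2) tS by (auto simp: T_def exponents_le_def)
    then show False
      using c(2) t by (simp add: in_keys_iff lookq)
  qed
  have qC: "q \<in> ?C"
    unfolding q_def by (intro sum_C mult_C mon_C[OF gs]) (use c'C in auto)
  have uC: "u \<in> ?C"
    unfolding u_def monomial_def using S(1) finS by (intro single_poly_ring) (simp add: keys_indicator_exponent)
  \<comment> \<open>Every term of \<open>q\<close> contains a variable outside \<open>S\<close>; by
    maximality of the facet this variable and \<open>S\<close> together contain a member of
    \<open>F\<close>.\<close>
  have rel: "q * u \<in> ?I"
    unfolding sqf_ideal_def
  proof (intro CollectI conjI ballI)
    show "q * u \<in> ?C"
      by (rule mult_C[OF qC uC])
    fix t assume "t \<in> Poly_Mapping.keys (q * u)"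
    then obtain s where s: "s \<in> Poly_Mapping.keys q" "t = s + indicator_exponent S"
      using keys_mult_subset[of t q u] by (auto simp: u_def monomial_def)
    then obtain v where v: "v \<in> Poly_Mapping.keys s" "v \<notin> S"
      using qS by blast
    moreover have "v \<in> V"
      using qC s(1) v(1) by (auto simp: mem_poly_ring)
    ultimately obtain B where "B \<in> F" "B \<subseteq> insert v S"
      using S(3) by blast
    then show "\<exists>B\<in>F. B \<subseteq> Poly_Mapping.keys t"
      using v(1) finS unfolding s(2) keys_exponent_add by (auto simp: keys_indicator_exponent)
  qed
  \<comment> \<open>The terms of degree above \<open>card S\<close> and those supporting a member of
    \<open>F\<close> span an ideal that contains this power. The monomial \<open>u\<close> has
    degree \<open>card S\<close> and support \<open>S\<close>, so it is of neither kind.\<close>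
  have u_notin: "u \<notin> forms gs (Suc (card S)) ?C"
  proof
    define P where "P t \<longleftrightarrow> Suc (card S) \<le> (\<Sum>x\<in>V. Poly_Mapping.lookup t x) \<or> (\<exists>B\<in>F. B \<subseteq> Poly_Mapping.keys t)"
      for t :: "'v \<Rightarrow>\<^sub>0 nat"
    let ?P = "{p \<in> ?C. \<forall>t\<in>Poly_Mapping.keys p. P t}"
    have idP: "ideal ?P (poly_ring V)"
      by (rule monomial_ideal) (auto simp: P_def lookup_add keys_exponent_add sum.distrib)
    assume "u \<in> forms gs (Suc (card S)) ?C"
    also have "\<dots> \<subseteq> ?P"
    proof (rule forms_subset)
      show "?I \<subseteq> ?P"
        by (auto simp: sqf_ideal_def P_def)
    next
      fix \<alpha> x assume \<alpha>: "\<alpha> \<in> exps (length gs) (Suc (card S))" and x: "x \<in> ?C"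
      have "mon gs \<alpha> \<in> ?P"
        using mon_C[OF gs] mon_order[OF V gsm, of _ \<alpha>] \<alpha> by (auto simp: P_def exps_def)
      then show "mon gs \<alpha> * x \<in> ?P"
        by (subst mult.commute) (rule ideal_mult[OF idP x])
    qed (rule ideal_add[OF idP])
    finally have "P (indicator_exponent S)"
      by (simp add: u_def monomial_def)
    moreover have "(\<Sum>x\<in>V. Poly_Mapping.lookup (indicator_exponent S) x) = card S"
      using S(1) V finS by (simp add: lookup_indicator_exponent sum.If_cases Int_absorb1)
    ultimately show False
      using S(2) finS by (auto simp: P_def keys_indicator_exponent)
  qed
  have "reg gs"
    unfolding gs_def by (rule regular_sequence_reg[OF sqf_ideal_ideal reg])
  moreover have "length \<alpha> = length gs" if "\<alpha> \<in> A" for \<alpha>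
    using that by (simp add: A_def n_def)
  ultimately have "\<forall>\<alpha>\<in>A. c' \<alpha> = 0"
    using regular_polynomial_injective[where c = c', OF _ gs uC u_notin finA _ c'C rel[unfolded q_def]] by simp
  then show False
    using c(1) by (metis c'_def lookup_single_eq lookup_zero)
qed

section \<open>Depolarization of whiskers\<close>

text \<open>Substitution of monomials for indeterminates as a push-forward of exponents;
  coefficients of exponents with equal image are added. For additive \<open>f\<close> it is a ring
  endomorphism.\<close>

definition map_exponents ::
    "(('v \<Rightarrow>\<^sub>0 nat) \<Rightarrow> ('v \<Rightarrow>\<^sub>0 nat)) \<Rightarrow> ('v, 'k::field) mpoly \<Rightarrow> ('v, 'k) mpoly" where
  "map_exponents f p = (\<Sum>t\<in>Poly_Mapping.keys p. Poly_Mapping.single (f t) (Poly_Mapping.lookup p t))"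

lemma map_exponents_superset:
  "finite S \<Longrightarrow> Poly_Mapping.keys p \<subseteq> S \<Longrightarrow>
    map_exponents f p = (\<Sum>t\<in>S. Poly_Mapping.single (f t) (Poly_Mapping.lookup p t))"
  unfolding map_exponents_def by (rule sum.mono_neutral_left) (auto simp: in_keys_iff)

lemma map_exponents_single [simp]: "map_exponents f (Poly_Mapping.single t c) = Poly_Mapping.single (f t) c"
  by (simp add: map_exponents_superset[of "{t}"])

lemma map_exponents_add: "map_exponents f (p + q) = map_exponents f p + map_exponents f q"
proof -
  let ?S = "Poly_Mapping.keys p \<union> Poly_Mapping.keys q"
  have "Poly_Mapping.keys (p + q) \<subseteq> ?S"
    by (rule Poly_Mapping.keys_add)
  then show ?thesis
    using map_exponents_superset[of ?S p f] map_exponents_superset[of ?S q f]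
      map_exponents_superset[of ?S "p + q" f]
    by (simp add: lookup_add single_add sum.distrib)
qed

lemma map_exponents_zero [simp]: "map_exponents f 0 = 0"
  by (simp add: map_exponents_def)

lemma map_exponents_sum: "map_exponents f (sum g A) = (\<Sum>i\<in>A. map_exponents f (g i))"
  by (induction A rule: infinite_finite_induct) (auto simp: map_exponents_add)

lemma map_exponents_diff: "map_exponents f (p - q) = map_exponents f p - map_exponents f q"
  using map_exponents_add[of f "p - q" q] by simp

lemma map_exponents_mult:
  assumes "\<And>a b. f (a + b) = f a + f b"
  shows "map_exponents f (p * q) = map_exponents f p * map_exponents f q"
proof -
  let ?l = "Poly_Mapping.lookup"
  have "p * q = (\<Sum>s\<in>Poly_Mapping.keys p. \<Sum>t\<in>Poly_Mapping.keys q. Poly_Mapping.single (s + t) (?l p s * ?l q t))"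
    by (subst poly_mapping_sum_singles[of p], subst poly_mapping_sum_singles[of q])
      (simp add: sum_product mult_single)
  then show ?thesis
    by (simp add: map_exponents_sum assms) (simp add: map_exponents_def sum_product mult_single)
qed

lemma keys_map_exponents: "Poly_Mapping.keys (map_exponents f p) \<subseteq> f ` Poly_Mapping.keys p"
proof
  fix c assume "c \<in> Poly_Mapping.keys (map_exponents f p)"
  then have "(\<Sum>t\<in>Poly_Mapping.keys p. Poly_Mapping.lookup (Poly_Mapping.single (f t) (Poly_Mapping.lookup p t)) c) \<noteq> 0"
    by (simp add: in_keys_iff map_exponents_def lookup_sum)
  then obtain t where "t \<in> Poly_Mapping.keys p"
    "Poly_Mapping.lookup (Poly_Mapping.single (f t) (Poly_Mapping.lookup p t)) c \<noteq> 0"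
    by (meson sum.not_neutral_contains_not_neutral)
  then show "c \<in> f ` Poly_Mapping.keys p"
    by (auto simp: lookup_single when_def split: if_splits)
qed

lemma lookup_indet_mult:
  "Poly_Mapping.lookup (indet x * p) (Poly_Mapping.single x 1 + t) = Poly_Mapping.lookup p t"
  unfolding indet_def monomial_def by (simp add: lookup_single_mult)

lemma lookup_monomial_mult_zero:
  assumes "Poly_Mapping.lookup t x < Poly_Mapping.lookup e x"
  shows "Poly_Mapping.lookup (monomial e * p) t = 0"
proof (rule ccontr)
  assume "Poly_Mapping.lookup (monomial e * p) t \<noteq> 0"
  then have "t \<in> Poly_Mapping.keys (monomial e * p)"
    by (simp add: in_keys_iff)
  then show False
    using keys_mult_subset[of t "monomial e" p] assms by (auto simp: monomial_def lookup_add)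
qed

lemma lookup_indet_mult_zero:
  "Poly_Mapping.lookup t x = 0 \<Longrightarrow> Poly_Mapping.lookup (indet x * p) t = 0"
  unfolding indet_def by (rule lookup_monomial_mult_zero[of _ x]) simp

text \<open>The substitution \<open>Y j \<mapsto> X j\<close> for \<open>j \<le> i\<close>, on
  exponents. Subtraction of exponents truncates at zero, but only what \<open>t\<close> contains is
  removed, so it is exact here.\<close>

definition fold_whiskers :: "nat \<Rightarrow> (whisker_vertex \<Rightarrow>\<^sub>0 nat) \<Rightarrow> (whisker_vertex \<Rightarrow>\<^sub>0 nat)" where
  "fold_whiskers i t =
    (t + (\<Sum>j\<in>{1..i}. Poly_Mapping.single (X j) (Poly_Mapping.lookup t (Y j))))
     - (\<Sum>j\<in>{1..i}. Poly_Mapping.single (Y j) (Poly_Mapping.lookup t (Y j)))"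

lemma lookup_fold_whiskers [simp]:
  "Poly_Mapping.lookup (fold_whiskers i t) (X j) =
     Poly_Mapping.lookup t (X j) + (if j \<in> {1..i} then Poly_Mapping.lookup t (Y j) else 0)"
  "Poly_Mapping.lookup (fold_whiskers i t) (Y j) = (if j \<in> {1..i} then 0 else Poly_Mapping.lookup t (Y j))"
  by (simp_all add: fold_whiskers_def lookup_minus_nat lookup_add lookup_sum lookup_single when_def)

lemma whisker_exponent_eqI:
  assumes "\<And>j. Poly_Mapping.lookup s (X j) = Poly_Mapping.lookup t (X j)"
    "\<And>j. Poly_Mapping.lookup s (Y j) = Poly_Mapping.lookup t (Y j)"
  shows "s = t"
proof (rule poly_mapping_eqI)
  fix x show "Poly_Mapping.lookup s x = Poly_Mapping.lookup t x"
    using assms by (cases x) auto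
qed

lemma fold_whiskers_add: "fold_whiskers i (a + b) = fold_whiskers i a + fold_whiskers i b"
  by (rule whisker_exponent_eqI) (auto simp: lookup_add)

lemma fold_whiskers_idem [simp]: "fold_whiskers i (fold_whiskers i t) = fold_whiskers i t"
  by (rule whisker_exponent_eqI) auto

definition whisker_diff :: "nat \<Rightarrow> (whisker_vertex, 'k::field) mpoly" where
  "whisker_diff j = indet (X j) - indet (Y j)"

lemma fold_whiskers_single_X [simp]: "fold_whiskers i (Poly_Mapping.single (X j) n) = Poly_Mapping.single (X j) n"
  by (rule whisker_exponent_eqI) (auto simp: lookup_single when_def)

lemma fold_whiskers_single_Y:
  "fold_whiskers i (Poly_Mapping.single (Y j) n) =
    (if j \<in> {1..i} then Poly_Mapping.single (X j) n else Poly_Mapping.single (Y j) n)"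
  by (rule whisker_exponent_eqI) (auto simp: lookup_single when_def)

lemma map_fold_whisker_diff:
  "map_exponents (fold_whiskers i) (whisker_diff j) = (if j \<in> {1..i} then 0 else whisker_diff j)"
  by (simp add: whisker_diff_def map_exponents_diff indet_def monomial_def fold_whiskers_single_Y)

abbreviation whisker_vertices :: "nat \<Rightarrow> whisker_vertex set" where
  "whisker_vertices m \<equiv> X ` {1..m} \<union> Y ` {1..m}"

lemma keys_fold_whiskers:
  assumes "i \<le> m" "Poly_Mapping.keys t \<subseteq> whisker_vertices m"
  shows "Poly_Mapping.keys (fold_whiskers i t) \<subseteq> whisker_vertices m"
proof
  fix x assume x: "x \<in> Poly_Mapping.keys (fold_whiskers i t)"
  show "x \<in> whisker_vertices m"
  proof (cases x)
    case (X j)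
    show ?thesis
    proof (cases "j \<in> {1..i}")
      case True
      then show ?thesis using X assms(1) by auto
    next
      case False
      then have "whisker_vertex.X j \<in> Poly_Mapping.keys t"
        using x X by (auto simp: in_keys_iff)
      then show ?thesis using X assms(2) by auto
    qed
  next
    case (Y j)
    then have "whisker_vertex.Y j \<in> Poly_Mapping.keys t"
      using x by (auto simp: in_keys_iff split: if_splits)
    then show ?thesis using Y assms(2) by auto
  qed
qed

lemma whisker_diff_poly_ring: "j \<in> {1..m} \<Longrightarrow> whisker_diff j \<in> carrier (poly_ring (whisker_vertices m))"
  using add_poly_ring[of "indet (X j)" "whisker_vertices m" "- indet (Y j)"]
  by (simp add: whisker_diff_def indet_poly_ring uminus_poly_ring)

text \<open>Trading one \<open>Y k\<close> for \<open>X k\<close> changes a monomial by a multiple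
  of \<open>whisker_diff k\<close>. Repeated trades, measured by the number of \<open>Y\<close>
  factors still to be folded, reach the folded monomial.\<close>

lemma monomial_fold_whiskers_mem:
  fixes J :: "(whisker_vertex, 'k::field) mpoly set"
  assumes J: "ideal J (poly_ring (whisker_vertices m))" "whisker_diff ` {1..i} \<subseteq> J" and i: "i \<le> m"
    and t: "Poly_Mapping.keys t \<subseteq> whisker_vertices m"
  shows "monomial t - monomial (fold_whiskers i t) \<in> J"
  using t
proof (induction "\<Sum>j\<in>{1..i}. Poly_Mapping.lookup t (Y j)" arbitrary: t)
  case 0
  then have "\<forall>j\<in>{1..i}. Poly_Mapping.lookup t (Y j) = 0"
    by simp
  then have "fold_whiskers i t = t"
    by (intro whisker_exponent_eqI) auto
  then show ?case
    using ideal_zero[OF J(1)] by simp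
next
  case (Suc n)
  then obtain k where k: "k \<in> {1..i}" "Poly_Mapping.lookup t (Y k) \<noteq> 0"
    by (metis (mono_tags, lifting) Suc_neq_Zero sum.neutral)
  define s where "s = t - Poly_Mapping.single (Y k) 1"
  define t' where "t' = Poly_Mapping.single (X k) 1 + s"
  have t_eq: "t = Poly_Mapping.single (Y k) 1 + s"
    unfolding s_def using k by (intro exponent_add_diff[symmetric]) (auto simp: lookup_single when_def Suc_le_eq)
  have sV: "Poly_Mapping.keys s \<subseteq> whisker_vertices m"
    using Suc.prems by (simp add: t_eq keys_exponent_add)
  have t'V: "Poly_Mapping.keys t' \<subseteq> whisker_vertices m"
    using sV k i by (auto simp: t'_def keys_exponent_add)
  have "(\<Sum>j\<in>{1..i}. Poly_Mapping.lookup t (Y j)) = Suc (\<Sum>j\<in>{1..i}. Poly_Mapping.lookup t' (Y j))"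
    using k by (simp add: t_eq t'_def lookup_add sum.distrib lookup_single when_def)
  then have "n = (\<Sum>j\<in>{1..i}. Poly_Mapping.lookup t' (Y j))"
    using Suc.hyps(2) by simp
  from Suc.hyps(1)[OF this t'V] have 1: "monomial t' - monomial (fold_whiskers i t') \<in> J" .
  have "monomial s * whisker_diff k \<in> J"
    unfolding monomial_def using J(2) k by (intro ideal_mult[OF J(1)] single_poly_ring[OF sV]) blast
  then have 2: "monomial t' - monomial t \<in> J"
    by (simp add: t_eq t'_def whisker_diff_def indet_def monomial_mult algebra_simps)
  have "fold_whiskers i t' = fold_whiskers i t"
    using k by (simp add: t_eq t'_def fold_whiskers_add fold_whiskers_single_Y)
  then show ?case
    using ideal_diff[OF J(1) 1 2] by simp
qed

text \<open>The pattern left by polarizing exponents up to two: a square of \<open>X j\<close>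
  becomes \<open>X j\<close> times \<open>Y j\<close>, so \<open>Y j\<close> never occurs without
  \<open>X j\<close>. Absence of the empty set makes the ideal proper.\<close>

locale polarized =
  fixes m :: nat and F :: "whisker_vertex set set"
  assumes F_vertices: "A \<in> F \<Longrightarrow> A \<subseteq> whisker_vertices m"
    and F_polarized: "A \<in> F \<Longrightarrow> Y j \<in> A \<Longrightarrow> X j \<in> A"
    and F_nonempty: "{} \<notin> F"
begin

text \<open>The monomials of the image of the ideal under \<open>Y j \<mapsto> X j\<close> for \<open>j \<le> i\<close>.\<close>

definition nonface :: "nat \<Rightarrow> (whisker_vertex \<Rightarrow>\<^sub>0 nat) \<Rightarrow> bool" where
  "nonface i c \<longleftrightarrow> (\<exists>A\<in>F. \<forall>x. Poly_Mapping.lookup (fold_whiskers i (indicator_exponent A)) x \<le> Poly_Mapping.lookup c x)"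

lemma F_finite: "A \<in> F \<Longrightarrow> finite A"
  using F_vertices by (rule finite_subset) auto

lemma nonface_add: "nonface i c \<Longrightarrow> nonface i (s + c)"
  unfolding nonface_def by (auto simp: lookup_add intro: trans_le_add2)

lemma nonface_fold: "A \<in> F \<Longrightarrow> A \<subseteq> Poly_Mapping.keys t \<Longrightarrow> nonface i (fold_whiskers i t)"
proof -
  assume A: "A \<in> F" "A \<subseteq> Poly_Mapping.keys t"
  have le: "Poly_Mapping.lookup (indicator_exponent A) x \<le> Poly_Mapping.lookup t x" for x
    by (rule indicator_exponent_le[OF F_finite[OF A(1)] A(2)])
  have "fold_whiskers i t = fold_whiskers i (indicator_exponent A) + fold_whiskers i (t - indicator_exponent A)"
    using exponent_add_diff[OF le] fold_whiskers_add by metis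
  then show ?thesis
    unfolding nonface_def using A(1) by (intro bexI[of _ A]) (simp_all add: lookup_add)
qed

text \<open>The kernel of the folding is generated by the differences, and the image of the ideal
  consists of the terms described by \<open>nonface i\<close>. Passing to the quotient by the
  differences thus becomes a condition on the terms of the folded polynomial.\<close>

lemma mem_whisker_ideal_iff:
  fixes p :: "(whisker_vertex, 'k::field) mpoly"
  assumes i: "i \<le> m" and p: "p \<in> carrier (poly_ring (whisker_vertices m))"
  shows "p \<in> genideal (poly_ring (whisker_vertices m)) (sqf_ideal (whisker_vertices m) F \<union> whisker_diff ` {1..i})
    \<longleftrightarrow> (\<forall>c\<in>Poly_Mapping.keys (map_exponents (fold_whiskers i) p). nonface i c)"
proof -
  let ?R = "poly_ring (whisker_vertices m) :: (whisker_vertex, 'k) mpoly ring"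
  let ?I = "sqf_ideal (whisker_vertices m) F :: (whisker_vertex, 'k) mpoly set"
  let ?S = "?I \<union> whisker_diff ` {1..i}" and ?f = "map_exponents (fold_whiskers i)"
  let ?K = "{p \<in> carrier ?R. \<forall>c\<in>Poly_Mapping.keys (?f p). nonface i c}"
  note f_mult = map_exponents_mult[OF fold_whiskers_add]
  have S: "?S \<subseteq> carrier ?R"
  proof (intro Un_least image_subsetI)
    show "?I \<subseteq> carrier ?R"
      by (rule ideal_poly_ring[OF sqf_ideal_ideal])
    fix j assume "j \<in> {1..i}"
    then have "j \<in> {1..m}"
      using i by simp
    then show "whisker_diff j \<in> carrier ?R"
      by (rule whisker_diff_poly_ring)
  qed
  define J where "J = genideal ?R ?S"
  have J: "ideal J ?R" "?I \<subseteq> J" "whisker_diff ` {1..i} \<subseteq> J"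
    unfolding J_def using genideal_poly_ideal[OF S] genideal_poly_self[OF S] by auto
  \<comment> \<open>\<open>?K\<close> is the preimage of a monomial ideal under a ring homomorphism,
    so only the generators need inspection.\<close>
  have "J \<subseteq> ?K"
    unfolding J_def
  proof (rule genideal_poly_minimal[OF S])
    show "ideal ?K ?R"
    proof (rule poly_idealI)
      fix p q assume "p \<in> ?K" "q \<in> ?K"
      then show "p + q \<in> ?K"
        using Poly_Mapping.keys_add[of "?f p" "?f q"] by (auto simp: map_exponents_add add_poly_ring)
    next
      fix r p assume *: "r \<in> carrier ?R" "p \<in> ?K"
      have "nonface i c" if "c \<in> Poly_Mapping.keys (?f r * ?f p)" for c
        using keys_mult_subset[OF that] * nonface_add by auto
      then show "r * p \<in> ?K"
        using * by (simp add: f_mult mult_poly_ring)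
    qed (auto simp: zero_poly_ring)
    have "nonface i c" if pI: "p \<in> ?I" and c: "c \<in> Poly_Mapping.keys (?f p)" for p c
    proof -
      obtain t where t: "t \<in> Poly_Mapping.keys p" "c = fold_whiskers i t"
        using c keys_map_exponents[of "fold_whiskers i" p] by auto
      then show ?thesis
        using sqf_idealD(2)[OF pI t(1)] nonface_fold by blast
    qed
    moreover have "?f (whisker_diff j) = (0 :: (whisker_vertex, 'k) mpoly)" if "j \<in> {1..i}" for j
      using that by (simp add: map_fold_whisker_diff)
    ultimately show "?S \<subseteq> ?K"
      using S by auto
  qed
  moreover have "p \<in> J" if nf: "\<forall>c\<in>Poly_Mapping.keys (?f p). nonface i c"
  proof -
    have tV: "Poly_Mapping.keys t \<subseteq> whisker_vertices m" if "t \<in> Poly_Mapping.keys p" for t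
      using p that by (simp add: mem_poly_ring)
    have "Poly_Mapping.single t a - Poly_Mapping.single (fold_whiskers i t) a \<in> J"
      if "t \<in> Poly_Mapping.keys p" for t and a :: 'k
    proof -
      have "Poly_Mapping.single 0 a * (monomial t - monomial (fold_whiskers i t)) \<in> J"
        by (intro ideal_mult[OF J(1)] single_poly_ring monomial_fold_whiskers_mem[OF J(1,3) i tV[OF that]]) simp
      then show ?thesis
        by (simp add: right_diff_distrib monomial_def mult_single)
    qed
    then have "(\<Sum>t\<in>Poly_Mapping.keys p. Poly_Mapping.single t (Poly_Mapping.lookup p t)
        - Poly_Mapping.single (fold_whiskers i t) (Poly_Mapping.lookup p t)) \<in> J"
      by (intro ideal_sum[OF J(1)])
    \<comment> \<open>Modulo the differences \<open>p\<close> may be replaced by its folding; it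
      remains to treat the single terms of \<open>?f p\<close>.\<close>
    then have 1: "p - ?f p \<in> J"
      using poly_mapping_sum_singles[of p] by (simp add: sum_subtractf map_exponents_def)
    have "Poly_Mapping.single c a \<in> J" if c: "c \<in> Poly_Mapping.keys (?f p)" for c and a :: 'k
    proof -
      obtain t where t: "t \<in> Poly_Mapping.keys p" "c = fold_whiskers i t"
        using c keys_map_exponents[of "fold_whiskers i" p] by auto
      have cV: "Poly_Mapping.keys c \<subseteq> whisker_vertices m"
        unfolding t(2) by (rule keys_fold_whiskers[OF i tV[OF t(1)]])
      obtain A where A: "A \<in> F"
        "\<And>x. Poly_Mapping.lookup (fold_whiskers i (indicator_exponent A)) x \<le> Poly_Mapping.lookup c x"
        using nf c unfolding nonface_def by blast
      define r where "r = c - fold_whiskers i (indicator_exponent A)"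
      have c_eq: "fold_whiskers i (indicator_exponent A) + r = c"
        unfolding r_def using A(2) by (rule exponent_add_diff)
      \<comment> \<open>An unfolded multiple of the generator \<open>A\<close> that folds onto
        \<open>c\<close>: its monomial lies in \<open>?I\<close> and agrees with that of
        \<open>c\<close> modulo the differences.\<close>
      define s where "s = indicator_exponent A + r"
      have "c = fold_whiskers i c"
        by (simp add: t(2))
      also have "\<dots> = fold_whiskers i s"
        unfolding s_def by (subst c_eq[symmetric]) (simp add: fold_whiskers_add)
      finally have cs: "c = fold_whiskers i s" .
      have keys_s: "Poly_Mapping.keys s = A \<union> Poly_Mapping.keys r"
        by (simp add: s_def keys_exponent_add keys_indicator_exponent F_finite[OF A(1)])
      have "Poly_Mapping.keys r \<subseteq> Poly_Mapping.keys c"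
        by (subst c_eq[symmetric]) (simp add: keys_exponent_add)
      then have sV: "Poly_Mapping.keys s \<subseteq> whisker_vertices m"
        using keys_s cV F_vertices[OF A(1)] by blast
      have "monomial s \<in> ?I"
        unfolding monomial_def using A(1) keys_s by (intro sqf_idealI single_poly_ring[OF sV]) auto
      then have "monomial s - (monomial s - monomial (fold_whiskers i s)) \<in> J"
        using J(2) by (intro ideal_diff[OF J(1)] monomial_fold_whiskers_mem[OF J(1,3) i sV]) auto
      then have "Poly_Mapping.single 0 a * monomial c \<in> J"
        by (intro ideal_mult[OF J(1)] single_poly_ring) (simp_all add: cs)
      then show ?thesis
        by (simp add: monomial_def mult_single)
    qed
    then have "?f p \<in> J"
      by (subst poly_mapping_sum_singles) (rule ideal_sum[OF J(1)])
    then show ?thesis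
      using ideal_add[OF J(1) 1, of "?f p"] by simp
  qed
  ultimately show ?thesis
    using p unfolding J_def by blast
qed

text \<open>Each generator involves \<open>X k\<close> and \<open>Y k\<close> at most once, and \<open>Y k\<close> only together with \<open>X k\<close>.\<close>

lemma nonface_Y:
  assumes k: "i < k" and t: "Poly_Mapping.lookup t (X k) = 0" and nf: "nonface i (Poly_Mapping.single (Y k) 1 + t)"
  shows "nonface i t"
proof -
  obtain A where A: "A \<in> F"
    "\<And>x. Poly_Mapping.lookup (fold_whiskers i (indicator_exponent A)) x
      \<le> Poly_Mapping.lookup (Poly_Mapping.single (Y k) 1 + t) x"
    using nf unfolding nonface_def by blast
  have "X k \<notin> A"
    using A(2)[of "X k"] k t F_finite[OF A(1)] by (auto simp: lookup_add lookup_single lookup_indicator_exponent)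
  then have Y: "Y k \<notin> A"
    using F_polarized A(1) by blast
  have "Poly_Mapping.lookup (fold_whiskers i (indicator_exponent A)) x \<le> Poly_Mapping.lookup t x" for x
  proof (cases "x = Y k")
    case True
    then show ?thesis
      using k Y F_finite[OF A(1)] by (simp add: lookup_indicator_exponent)
  next
    case False
    then show ?thesis
      using A(2)[of x] by (simp add: lookup_add lookup_single)
  qed
  then show ?thesis
    using A(1) unfolding nonface_def by blast
qed

lemma nonface_X:
  assumes k: "i < k" and t: "Poly_Mapping.lookup t (X k) \<noteq> 0" and nf: "nonface i (Poly_Mapping.single (X k) 1 + t)"
  shows "nonface i t"
proof -
  obtain A where A: "A \<in> F"
    "\<And>x. Poly_Mapping.lookup (fold_whiskers i (indicator_exponent A)) x
      \<le> Poly_Mapping.lookup (Poly_Mapping.single (X k) 1 + t) x"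
    using nf unfolding nonface_def by blast
  have "Poly_Mapping.lookup (fold_whiskers i (indicator_exponent A)) x \<le> Poly_Mapping.lookup t x" for x
  proof (cases "x = X k")
    case True
    then show ?thesis
      using k t F_finite[OF A(1)] by (simp add: lookup_indicator_exponent)
  next
    case False
    then show ?thesis
      using A(2)[of x] by (simp add: lookup_add lookup_single)
  qed
  then show ?thesis
    using A(1) unfolding nonface_def by blast
qed

text \<open>Comparison of coefficients outside the monomial ideal. If \<open>X k\<close> is absent
  from \<open>t\<close>, multiplication by \<open>Y k\<close> stays outside, and the
  \<open>X k\<close> part of the product cannot reach that exponent. Otherwise multiplication by
  \<open>X k\<close> stays outside; the coefficient of \<open>v\<close> at \<open>t\<close> then
  equals the one where a \<open>Y k\<close> is traded for \<open>X k\<close>, and the exponent of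
  \<open>Y k\<close> descends to zero.\<close>

lemma whisker_diff_regular:
  fixes v :: "(whisker_vertex, 'k::field) mpoly"
  assumes k: "i < k" and v: "\<forall>c\<in>Poly_Mapping.keys (whisker_diff k * v). nonface i c"
    and t: "\<not> nonface i t"
  shows "Poly_Mapping.lookup v t = 0"
proof (cases "Poly_Mapping.lookup t (X k) = 0")
  case True
  let ?s = "Poly_Mapping.single (Y k) 1 + t"
  have "\<not> nonface i ?s"
    using nonface_Y[OF k True] t by blast
  then have "Poly_Mapping.lookup (whisker_diff k * v) ?s = 0"
    using v by (auto simp: in_keys_iff)
  moreover have "Poly_Mapping.lookup ?s (X k) = 0"
    using True by (simp add: lookup_add lookup_single)
  ultimately show ?thesis
    by (simp add: whisker_diff_def left_diff_distrib lookup_minus lookup_indet_mult lookup_indet_mult_zero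
      del: One_nat_def)
next
  case False
  then show ?thesis
    using t
  proof (induction "Poly_Mapping.lookup t (Y k)" arbitrary: t)
    case 0
    let ?s = "Poly_Mapping.single (X k) 1 + t"
    have "\<not> nonface i ?s"
      using nonface_X[OF k 0(2)] 0(3) by blast
    then have "Poly_Mapping.lookup (whisker_diff k * v) ?s = 0"
      using v by (auto simp: in_keys_iff)
    moreover have "Poly_Mapping.lookup ?s (Y k) = 0"
      using 0(1) by (simp add: lookup_add lookup_single)
    ultimately show ?case
      by (simp add: whisker_diff_def left_diff_distrib lookup_minus lookup_indet_mult lookup_indet_mult_zero
        del: One_nat_def)
  next
    case (Suc n)
    let ?s = "Poly_Mapping.single (X k) 1 + t"
    define u where "u = t - Poly_Mapping.single (Y k) 1"
    have t_eq: "Poly_Mapping.single (Y k) 1 + u = t"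
      unfolding u_def using Suc.hyps(2) by (intro exponent_add_diff) (auto simp: lookup_single when_def)
    let ?t' = "Poly_Mapping.single (X k) 1 + u"
    have s_eq: "?s = Poly_Mapping.single (Y k) 1 + ?t'"
      by (subst t_eq[symmetric]) (simp add: add_ac)
    have nf: "\<not> nonface i ?s"
      using nonface_X[OF k Suc.prems(1)] Suc.prems(2) by blast
    then have "Poly_Mapping.lookup (whisker_diff k * v) ?s = 0"
      using v by (auto simp: in_keys_iff)
    then have "Poly_Mapping.lookup (indet (X k) * v) ?s = Poly_Mapping.lookup (indet (Y k) * v) ?s"
      by (simp add: whisker_diff_def left_diff_distrib lookup_minus)
    then have "Poly_Mapping.lookup v t = Poly_Mapping.lookup v ?t'"
      using lookup_indet_mult[of "X k" v t] lookup_indet_mult[of "Y k" v ?t'] s_eq by metis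
    also have "\<dots> = 0"
    proof (rule Suc.hyps(1))
      have "Suc n = Suc (Poly_Mapping.lookup u (Y k))"
        unfolding Suc.hyps(2) by (subst t_eq[symmetric]) (simp add: lookup_add)
      then show "n = Poly_Mapping.lookup ?t' (Y k)"
        by (simp add: lookup_add lookup_single)
      show "Poly_Mapping.lookup ?t' (X k) \<noteq> 0"
        by (simp add: lookup_add)
      show "\<not> nonface i ?t'"
        using nonface_add[of i ?t'] nf s_eq by metis
    qed
    finally show ?case .
  qed
qed

text \<open>Folding up to \<open>i\<close> fixes the next difference, so the claim becomes the
  coefficient statement for the folded polynomial.\<close>

lemma whisker_ideal_step:
  fixes p :: "(whisker_vertex, 'k::field) mpoly"
  assumes i: "i < m" and p: "p \<in> carrier (poly_ring (whisker_vertices m))"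
    and mem: "whisker_diff (Suc i) * p \<in>
      genideal (poly_ring (whisker_vertices m)) (sqf_ideal (whisker_vertices m) F \<union> whisker_diff ` {1..i})"
  shows "p \<in> genideal (poly_ring (whisker_vertices m)) (sqf_ideal (whisker_vertices m) F \<union> whisker_diff ` {1..i})"
proof -
  let ?v = "map_exponents (fold_whiskers i) p"
  have "Suc i \<in> {1..m}"
    using i by simp
  then have "whisker_diff (Suc i) * p \<in> carrier (poly_ring (whisker_vertices m))"
    by (intro mult_poly_ring p whisker_diff_poly_ring)
  moreover have "map_exponents (fold_whiskers i) (whisker_diff (Suc i) * p) = whisker_diff (Suc i) * ?v"
    by (simp add: map_exponents_mult[OF fold_whiskers_add] map_fold_whisker_diff)
  ultimately have "\<forall>c\<in>Poly_Mapping.keys (whisker_diff (Suc i) * ?v). nonface i c"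
    using mem mem_whisker_ideal_iff[of i "whisker_diff (Suc i) * p"] i by simp
  then have "\<forall>t\<in>Poly_Mapping.keys ?v. nonface i t"
    using whisker_diff_regular[of i "Suc i" ?v] by (auto simp: in_keys_iff)
  then show ?thesis
    using mem_whisker_ideal_iff[of i p] i p by simp
qed

section \<open>The sum of squares as an additional regular element\<close>

definition square_sum :: "(whisker_vertex, 'k::field) mpoly" where
  "square_sum = (\<Sum>j\<in>{1..m}. monomial (Poly_Mapping.single (X j) 2))"

text \<open>The hypothesis \<open>socle\<close> provides an \<open>i\<close> whose square keeps
  \<open>t\<close> outside the ideal while all other \<open>X\<close> exponents of \<open>t\<close>
  are at most one. So for \<open>j \<noteq> i\<close> the square of \<open>X j\<close> does not
  divide \<open>t\<close> times the square of \<open>X i\<close>, and the product has there exactly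
  the coefficient of \<open>t\<close>. With first powers instead of squares other summands could
  reach the same exponent.\<close>

lemma square_sum_step:
  fixes p :: "(whisker_vertex, 'k::field) mpoly"
  assumes socle: "\<And>t. \<not> nonface m t \<Longrightarrow> \<exists>i\<in>{1..m}. \<not> nonface m (Poly_Mapping.single (X i) 2 + t) \<and>
      (\<forall>j\<in>{1..m}. j \<noteq> i \<longrightarrow> Poly_Mapping.lookup t (X j) \<le> 1)"
    and p: "p \<in> carrier (poly_ring (whisker_vertices m))"
    and s: "(square_sum :: (whisker_vertex, 'k) mpoly) \<in> carrier (poly_ring (whisker_vertices m))"
    and mem: "square_sum * p \<in>
      genideal (poly_ring (whisker_vertices m)) (sqf_ideal (whisker_vertices m) F \<union> whisker_diff ` {1..m})"
  shows "p \<in> genideal (poly_ring (whisker_vertices m)) (sqf_ideal (whisker_vertices m) F \<union> whisker_diff ` {1..m})"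
proof -
  let ?v = "map_exponents (fold_whiskers m) p"
  have "map_exponents (fold_whiskers m) square_sum = (square_sum :: (whisker_vertex, 'k) mpoly)"
    by (simp add: square_sum_def map_exponents_sum monomial_def)
  then have nf: "\<forall>c\<in>Poly_Mapping.keys (square_sum * ?v). nonface m c"
    using mem mem_whisker_ideal_iff[of m "square_sum * p"] mult_poly_ring[OF s p]
    by (simp add: map_exponents_mult[OF fold_whiskers_add])
  have "nonface m t" if t: "t \<in> Poly_Mapping.keys ?v" for t
  proof (rule ccontr)
    assume "\<not> nonface m t"
    then obtain i where i: "i \<in> {1..m}" "\<not> nonface m (Poly_Mapping.single (X i) 2 + t)"
      "\<And>j. j \<in> {1..m} \<Longrightarrow> j \<noteq> i \<Longrightarrow> Poly_Mapping.lookup t (X j) \<le> 1"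
      using socle by blast
    let ?s = "Poly_Mapping.single (X i) 2 + t"
    have "Poly_Mapping.lookup (square_sum * ?v) ?s
        = (\<Sum>j\<in>{1..m}. Poly_Mapping.lookup (monomial (Poly_Mapping.single (X j) 2) * ?v) ?s)"
      by (simp add: square_sum_def sum_distrib_right lookup_sum)
    also have "\<dots> = (\<Sum>j\<in>{1..m}. if j = i then Poly_Mapping.lookup ?v t else 0)"
    proof (rule sum.cong[OF refl])
      fix j assume j: "j \<in> {1..m}"
      show "Poly_Mapping.lookup (monomial (Poly_Mapping.single (X j) 2) * ?v) ?s
          = (if j = i then Poly_Mapping.lookup ?v t else 0)"
      proof (cases "j = i")
        case True
        then show ?thesis
          by (simp add: monomial_def lookup_single_mult)
      next
        case False
        then show ?thesis
          using i(3)[OF j] lookup_monomial_mult_zero[of ?s "X j" "Poly_Mapping.single (X j) 2" ?v]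
          by (simp add: lookup_add lookup_single when_def)
      qed
    qed
    also have "\<dots> = Poly_Mapping.lookup ?v t"
      using i(1) by simp
    finally have "?s \<in> Poly_Mapping.keys (square_sum * ?v)"
      using t by (simp add: in_keys_iff)
    then show False
      using nf i(2) by blast
  qed
  then show ?thesis
    using mem_whisker_ideal_iff[of m p] p by simp
qed

text \<open>All generators have constant coefficient zero, the monomial ones because no member of
  \<open>F\<close> is empty.\<close>

lemma one_notin_whisker_ideal:
  fixes gs :: "(whisker_vertex, 'k::field) mpoly list"
  assumes "set gs \<subseteq> graded_maximal_ideal (whisker_vertices m)"
  shows "1 \<notin> genideal (poly_ring (whisker_vertices m)) (sqf_ideal (whisker_vertices m) F \<union> set gs)"
proof
  let ?V = "whisker_vertices m"
  let ?K = "{p \<in> carrier (poly_ring ?V). Poly_Mapping.lookup p 0 = (0::'k)}"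
  have "sqf_ideal ?V F \<subseteq> ?K"
  proof
    fix p :: "(whisker_vertex, 'k) mpoly"
    assume p: "p \<in> sqf_ideal ?V F"
    have "0 \<notin> Poly_Mapping.keys p"
      using sqf_idealD(2)[OF p, of 0] F_nonempty by auto
    then show "p \<in> ?K"
      using sqf_idealD(1)[OF p] by (simp add: in_keys_iff)
  qed
  moreover have "set gs \<subseteq> ?K"
    using assms graded_maximal_ideal_subset by blast
  ultimately have "genideal (poly_ring ?V) (sqf_ideal ?V F \<union> set gs) \<subseteq> ?K"
    by (intro genideal_poly_minimal zero_constant_coeff_ideal) auto
  moreover assume "1 \<in> genideal (poly_ring ?V) (sqf_ideal ?V F \<union> set gs)"
  ultimately show False
    by auto
qed

section \<open>The regular sequences for the lower bound\<close>

definition whisker_sequence :: "(whisker_vertex, 'k::field) mpoly list" where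
  "whisker_sequence = map whisker_diff [1..<Suc m]"

lemma whisker_sequence_simps:
  "length whisker_sequence = m"
  "i < m \<Longrightarrow> whisker_sequence ! i = whisker_diff (Suc i)"
  "i \<le> m \<Longrightarrow> set (take i whisker_sequence) = whisker_diff ` {1..i}"
  by (auto simp: whisker_sequence_def take_map simp del: upt_Suc)

lemma whisker_diff_graded_maximal: "j \<in> {1..m} \<Longrightarrow> whisker_diff j \<in> graded_maximal_ideal (whisker_vertices m)"
  unfolding whisker_diff_def
  by (intro ideal_diff[OF graded_maximal_ideal_ideal] indet_graded_maximal) auto

lemma square_sum_graded_maximal: "square_sum \<in> graded_maximal_ideal (whisker_vertices m)"
  unfolding square_sum_def
proof (rule ideal_sum[OF graded_maximal_ideal_ideal])
  fix j assume j: "j \<in> {1..m}"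
  have "monomial (Poly_Mapping.single (X j) 2) = indet (X j) * indet (X j)"
    by (simp add: indet_def monomial_def mult_single numeral_2_eq_2 flip: single_add)
  moreover have "indet (X j) * indet (X j) \<in> graded_maximal_ideal (whisker_vertices m)"
    using j by (intro ideal_mult[OF graded_maximal_ideal_ideal] indet_poly_ring indet_graded_maximal) auto
  ultimately show "monomial (Poly_Mapping.single (X j) 2) \<in> graded_maximal_ideal (whisker_vertices m)"
    by metis
qed

lemma whisker_sequence_graded_maximal: "set whisker_sequence \<subseteq> graded_maximal_ideal (whisker_vertices m)"
proof -
  have "whisker_diff j \<in> graded_maximal_ideal (whisker_vertices m)" if "j \<in> set [1..<Suc m]" for j
    by (rule whisker_diff_graded_maximal) (use that in auto)
  then show ?thesis
    unfolding whisker_sequence_def set_map by (rule image_subsetI)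
qed

theorem whisker_sequence_regular:
  "regular_sequence (poly_ring (whisker_vertices m))
     (quotient_module (poly_ring (whisker_vertices m)) (sqf_ideal (whisker_vertices m) F))
     (whisker_sequence :: (whisker_vertex, 'k::field) mpoly list)"
  unfolding regular_sequence_quotient_iff[OF poly_ring_cring sqf_ideal_ideal] poly_ring_simps
proof (intro conjI allI impI ballI)
  show "set whisker_sequence \<subseteq> carrier (poly_ring (whisker_vertices m))"
    using whisker_sequence_graded_maximal graded_maximal_carrier by blast
  show "1 \<notin> genideal (poly_ring (whisker_vertices m)) (sqf_ideal (whisker_vertices m) F \<union> set whisker_sequence)"
    by (rule one_notin_whisker_ideal[OF whisker_sequence_graded_maximal])
  fix i and p :: "(whisker_vertex, 'k) mpoly"
  assume "i < length (whisker_sequence :: (whisker_vertex, 'k) mpoly list)"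
    and p: "p \<in> carrier (poly_ring (whisker_vertices m))"
      "whisker_sequence ! i * p \<in>
       genideal (poly_ring (whisker_vertices m)) (sqf_ideal (whisker_vertices m) F \<union> set (take i whisker_sequence))"
  then have i: "i < m"
    by (simp add: whisker_sequence_simps)
  then show "p \<in> genideal (poly_ring (whisker_vertices m)) (sqf_ideal (whisker_vertices m) F \<union> set (take i whisker_sequence))"
    using whisker_ideal_step[OF i p(1)] p(2) by (simp add: whisker_sequence_simps)
qed

theorem whisker_sequence_square_sum_regular:
  assumes socle: "\<And>t. \<not> nonface m t \<Longrightarrow> \<exists>i\<in>{1..m}. \<not> nonface m (Poly_Mapping.single (X i) 2 + t) \<and>
      (\<forall>j\<in>{1..m}. j \<noteq> i \<longrightarrow> Poly_Mapping.lookup t (X j) \<le> 1)"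
  shows "regular_sequence (poly_ring (whisker_vertices m))
     (quotient_module (poly_ring (whisker_vertices m)) (sqf_ideal (whisker_vertices m) F))
     (whisker_sequence @ [square_sum :: (whisker_vertex, 'k::field) mpoly])"
  unfolding regular_sequence_quotient_iff[OF poly_ring_cring sqf_ideal_ideal] poly_ring_simps
proof (intro conjI allI impI ballI)
  let ?fs = "whisker_sequence @ [square_sum :: (whisker_vertex, 'k::field) mpoly]"
  have max: "set ?fs \<subseteq> graded_maximal_ideal (whisker_vertices m)"
    using whisker_sequence_graded_maximal square_sum_graded_maximal by simp
  then show "set ?fs \<subseteq> carrier (poly_ring (whisker_vertices m))"
    using graded_maximal_carrier by blast
  show "1 \<notin> genideal (poly_ring (whisker_vertices m)) (sqf_ideal (whisker_vertices m) F \<union> set ?fs)"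
    by (rule one_notin_whisker_ideal[OF max])
  fix i and p :: "(whisker_vertex, 'k) mpoly"
  assume i: "i < length ?fs"
    and p: "p \<in> carrier (poly_ring (whisker_vertices m))"
      "?fs ! i * p \<in>
       genideal (poly_ring (whisker_vertices m)) (sqf_ideal (whisker_vertices m) F \<union> set (take i ?fs))"
  show "p \<in> genideal (poly_ring (whisker_vertices m)) (sqf_ideal (whisker_vertices m) F \<union> set (take i ?fs))"
  proof (cases "i < m")
    case True
    then show ?thesis
      using whisker_ideal_step[OF True p(1)] p(2) by (simp add: whisker_sequence_simps nth_append)
  next
    case False
    then have im: "i = m"
      using i by (simp add: whisker_sequence_simps)
    have "set (take i ?fs) = whisker_diff ` {1..m}" "?fs ! i = square_sum"
      using whisker_sequence_simps(3)[of m] by (simp_all add: im whisker_sequence_simps(1) nth_append)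
    then show ?thesis
      using square_sum_step[OF socle p(1)] p(2) square_sum_graded_maximal graded_maximal_carrier by auto
  qed
qed

end

section \<open>Whiskered cycles\<close>

definition cycle_adj :: "nat \<Rightarrow> nat \<Rightarrow> nat \<Rightarrow> bool" where
  "cycle_adj m i j \<longleftrightarrow> i \<in> {1..m} \<and> j \<in> {1..m} \<and>
     (j = Suc i \<or> i = Suc j \<or> i = 1 \<and> j = m \<or> i = m \<and> j = 1)"

lemma cycle_adj_irrefl: "m \<ge> 3 \<Longrightarrow> \<not> cycle_adj m i i"
  by (auto simp: cycle_adj_def)

lemma cycle_adj_sym: "cycle_adj m i j \<longleftrightarrow> cycle_adj m j i"
  by (auto simp: cycle_adj_def)

text \<open>Neighbours differ by one step modulo \<open>m\<close>, and three steps of plus or minus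
  one close up only if \<open>m\<close> divides 1 or 3.\<close>

lemma cycle_triangle_free:
  "m > 3 \<Longrightarrow> cycle_adj m i j \<Longrightarrow> cycle_adj m j k \<Longrightarrow> cycle_adj m i k \<Longrightarrow> False"
  unfolding cycle_adj_def by auto

lemma vertices_whiskered_cycle: "vertices (whiskered_cycle m) = whisker_vertices m"
  by (simp add: whiskered_cycle_def)

lemma edges_whiskered_cycle:
  assumes "m \<ge> 3"
  shows "edges (whiskered_cycle m) = {{X i, X j} |i j. cycle_adj m i j} \<union> {{X i, Y i} |i. i \<in> {1..m}}"
    (is "?L = ?A \<union> ?B")
proof
  show "?L \<subseteq> ?A \<union> ?B"
  proof
    fix e assume "e \<in> ?L"
    then consider i where "e = {X i, X (i + 1)}" "1 \<le> i" "i \<le> m - 1" | "e = {X 1, X m}"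
      | i where "e = {X i, Y i}" "1 \<le> i" "i \<le> m"
      unfolding whiskered_cycle_def by auto
    then show "e \<in> ?A \<union> ?B"
    proof cases
      case 1
      then have "cycle_adj m i (i + 1)"
        using assms by (auto simp: cycle_adj_def)
      then show ?thesis using 1 by blast
    next
      case 2
      have "cycle_adj m 1 m"
        using assms by (auto simp: cycle_adj_def)
      then show ?thesis using 2 by blast
    next
      case 3
      then show ?thesis by auto
    qed
  qed
  show "?A \<union> ?B \<subseteq> ?L"
  proof
    fix e assume "e \<in> ?A \<union> ?B"
    then consider i j where "e = {X i, X j}" "cycle_adj m i j" | i where "e = {X i, Y i}" "i \<in> {1..m}"
      by blast
    then show "e \<in> ?L"
    proof cases
      case 1
      then consider "j = i + 1" "1 \<le> i" "i \<le> m - 1" | "i = j + 1" "1 \<le> j" "j \<le> m - 1"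
        | "i = 1" "j = m" | "i = m" "j = 1"
        unfolding cycle_adj_def by fastforce
      then show ?thesis
        unfolding whiskered_cycle_def using 1(1) by cases (auto simp: insert_commute)
    next
      case 2
      then show ?thesis
        unfolding whiskered_cycle_def by auto
    qed
  qed
qed

section \<open>Pairs of disjoint edges and their folded generators\<close>

definition edge_pairs :: "nat \<Rightarrow> whisker_vertex set set" where
  "edge_pairs m = {e \<union> e' |e e'. e \<in> edges (whiskered_cycle m) \<and> e' \<in> edges (whiskered_cycle m) \<and> e \<inter> e' = {}}"

lemma edge_pairs_cases:
  assumes m: "m \<ge> 3" and A: "A \<in> edge_pairs m"
  obtains (whiskers) i j where "i \<in> {1..m}" "j \<in> {1..m}" "i \<noteq> j" "A = {X i, Y i, X j, Y j}"
  | (mixed) i j k where "cycle_adj m i j" "k \<in> {1..m}" "k \<noteq> i" "k \<noteq> j" "A = {X i, X j, X k, Y k}"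
  | (cycle) i j k l where "cycle_adj m i j" "cycle_adj m k l" "k \<noteq> i" "k \<noteq> j" "l \<noteq> i" "l \<noteq> j"
      "A = {X i, X j, X k, X l}"
proof -
  obtain e e' where A': "A = e \<union> e'" "e \<in> edges (whiskered_cycle m)" "e' \<in> edges (whiskered_cycle m)" "e \<inter> e' = {}"
    using A unfolding edge_pairs_def by blast
  have edge: "(\<exists>i j. e = {X i, X j} \<and> cycle_adj m i j) \<or> (\<exists>i. e = {X i, Y i} \<and> i \<in> {1..m})"
    if "e \<in> edges (whiskered_cycle m)" for e
    using that unfolding edges_whiskered_cycle[OF m] by blast
  from edge[OF A'(2)] show thesis
  proof (elim disjE exE conjE)
    fix i j assume e: "e = {X i, X j}" "cycle_adj m i j"
    from edge[OF A'(3)] show thesis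
    proof (elim disjE exE conjE)
      fix k l assume e': "e' = {X k, X l}" "cycle_adj m k l"
      then show thesis
        using cycle[of i j k l] e A' by auto
    next
      fix k assume e': "e' = {X k, Y k}" "k \<in> {1..m}"
      then show thesis
        using mixed[of i j k] e A' by auto
    qed
  next
    fix k assume e: "e = {X k, Y k}" "k \<in> {1..m}"
    from edge[OF A'(3)] show thesis
    proof (elim disjE exE conjE)
      fix i j assume e': "e' = {X i, X j}" "cycle_adj m i j"
      moreover have "A = {X i, X j, X k, Y k}"
        using A'(1) e e' by auto
      ultimately show thesis
        using mixed[of i j k] e A'(4) by auto
    next
      fix l assume e': "e' = {X l, Y l}" "l \<in> {1..m}"
      then show thesis
        using whiskers[of k l] e A' by auto
    qed
  qed
qed

lemma edge_pairsI:
  assumes m: "m \<ge> 3"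
  shows edge_pairs_whiskers: "i \<in> {1..m} \<Longrightarrow> j \<in> {1..m} \<Longrightarrow> i \<noteq> j \<Longrightarrow> {X i, Y i} \<union> {X j, Y j} \<in> edge_pairs m"
    and edge_pairs_mixed: "cycle_adj m i j \<Longrightarrow> k \<in> {1..m} \<Longrightarrow> k \<noteq> i \<Longrightarrow> k \<noteq> j \<Longrightarrow>
      {X i, X j} \<union> {X k, Y k} \<in> edge_pairs m"
    and edge_pairs_cycle: "cycle_adj m i j \<Longrightarrow> cycle_adj m k l \<Longrightarrow> k \<noteq> i \<Longrightarrow> k \<noteq> j \<Longrightarrow> l \<noteq> i \<Longrightarrow> l \<noteq> j \<Longrightarrow>
      {X i, X j} \<union> {X k, X l} \<in> edge_pairs m"
proof -
  have *: "e \<union> e' \<in> edge_pairs m"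
    if "e \<in> edges (whiskered_cycle m)" "e' \<in> edges (whiskered_cycle m)" "e \<inter> e' = {}" for e e'
    using that unfolding edge_pairs_def by blast
  have W: "{X i, Y i} \<in> edges (whiskered_cycle m)" if "i \<in> {1..m}" for i
    using that unfolding edges_whiskered_cycle[OF m] by blast
  have C: "{X i, X j} \<in> edges (whiskered_cycle m)" if "cycle_adj m i j" for i j
    using that unfolding edges_whiskered_cycle[OF m] by blast
  show "i \<in> {1..m} \<Longrightarrow> j \<in> {1..m} \<Longrightarrow> i \<noteq> j \<Longrightarrow> {X i, Y i} \<union> {X j, Y j} \<in> edge_pairs m"
    by (rule *) (auto intro: W)
  show "cycle_adj m i j \<Longrightarrow> k \<in> {1..m} \<Longrightarrow> k \<noteq> i \<Longrightarrow> k \<noteq> j \<Longrightarrow>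
      {X i, X j} \<union> {X k, Y k} \<in> edge_pairs m"
    by (rule *) (auto intro: W C)
  show "cycle_adj m i j \<Longrightarrow> cycle_adj m k l \<Longrightarrow> k \<noteq> i \<Longrightarrow> k \<noteq> j \<Longrightarrow> l \<noteq> i \<Longrightarrow> l \<noteq> j \<Longrightarrow>
      {X i, X j} \<union> {X k, X l} \<in> edge_pairs m"
    by (rule *) (auto intro: C)
qed

lemma cycle_adj_range: "cycle_adj m i j \<Longrightarrow> i \<in> {1..m} \<and> j \<in> {1..m}"
  by (simp add: cycle_adj_def)

text \<open>Only a whisker contains \<open>Y j\<close>, and it contains \<open>X j\<close> as
  well.\<close>

lemma polarized_edge_pairs:
  assumes m: "m \<ge> 3"
  shows "polarized m (edge_pairs m)"
proof
  show "A \<subseteq> whisker_vertices m" if "A \<in> edge_pairs m" for A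
    using m that by (cases rule: edge_pairs_cases) (use cycle_adj_range in blast)+
  show "X j \<in> A" if "A \<in> edge_pairs m" "Y j \<in> A" for A j
    using m that(1) by (cases rule: edge_pairs_cases) (use that(2) in auto)
  show "{} \<notin> edge_pairs m"
  proof
    assume "{} \<in> edge_pairs m"
    with m show False
      by (cases rule: edge_pairs_cases) auto
  qed
qed

text \<open>Folding turns the whisker at i into the square of \<open>X i\<close>. The alternatives
  are divisibility by the folded generators: two squares, a cycle edge with a square off it, and two
  disjoint cycle edges.\<close>

lemma nonface_edge_pairs_iff:
  fixes t :: "whisker_vertex \<Rightarrow>\<^sub>0 nat"
  assumes m: "m \<ge> 3"
  defines "a \<equiv> \<lambda>i. Poly_Mapping.lookup t (X i)"
  shows "polarized.nonface (edge_pairs m) m t \<longleftrightarrow>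
    (\<exists>i\<in>{1..m}. \<exists>j\<in>{1..m}. i \<noteq> j \<and> a i \<ge> 2 \<and> a j \<ge> 2) \<or>
    (\<exists>i j k. cycle_adj m i j \<and> k \<in> {1..m} \<and> k \<noteq> i \<and> k \<noteq> j \<and> a i \<ge> 1 \<and> a j \<ge> 1 \<and> a k \<ge> 2) \<or>
    (\<exists>i j k l. cycle_adj m i j \<and> cycle_adj m k l \<and> k \<noteq> i \<and> k \<noteq> j \<and> l \<noteq> i \<and> l \<noteq> j \<and>
       a i \<ge> 1 \<and> a j \<ge> 1 \<and> a k \<ge> 1 \<and> a l \<ge> 1)"
    (is "_ \<longleftrightarrow> ?W \<or> ?M \<or> ?C")
proof -
  interpret polarized m "edge_pairs m"
    by (rule polarized_edge_pairs[OF m])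
  have cnt: "Poly_Mapping.lookup (fold_whiskers m (indicator_exponent A)) (X i)
      = (if X i \<in> A then 1 else 0) + (if i \<in> {1..m} \<and> Y i \<in> A then 1 else 0)"
    if "A \<in> edge_pairs m" for A i
    using F_finite[OF that] by (simp add: lookup_indicator_exponent)
  \<comment> \<open>No \<open>Y\<close> of a generator survives the folding, so divisibility
    concerns the \<open>X\<close> exponents only; a \<open>Y i\<close> in \<open>A\<close> comes
    with \<open>X i\<close> and raises the required exponent to two.\<close>
  have nonfaceI: "nonface m t"
    if A: "A \<in> edge_pairs m"
      and le: "\<And>i. X i \<in> A \<Longrightarrow> (if Y i \<in> A then 2 else 1) \<le> a i" for A
    unfolding nonface_def
  proof (intro bexI[OF _ A] allI)
    fix x
    show "Poly_Mapping.lookup (fold_whiskers m (indicator_exponent A)) x \<le> Poly_Mapping.lookup t x"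
    proof (cases x)
      case (X i)
      then show ?thesis
        using le[of i] cnt[OF A, of i] F_polarized[OF A, of i] by (auto simp: a_def split: if_splits)
    next
      case (Y i)
      have "whisker_vertex.Y i \<notin> A \<or> i \<in> {1..m}"
        using F_vertices[OF A] by auto
      then show ?thesis
        using F_finite[OF A] Y by (auto simp: lookup_indicator_exponent)
    qed
  qed
  show ?thesis
  proof
    assume "nonface m t"
    then obtain A where A: "A \<in> edge_pairs m"
      "\<And>x. Poly_Mapping.lookup (fold_whiskers m (indicator_exponent A)) x \<le> Poly_Mapping.lookup t x"
      unfolding nonface_def by blast
    have le: "(if X i \<in> A then 1 else 0) + (if i \<in> {1..m} \<and> Y i \<in> A then 1 else 0) \<le> a i" for i
      using A(2)[of "X i"] unfolding cnt[OF A(1)] a_def .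
    show "?W \<or> ?M \<or> ?C"
      using m A(1)
    proof (cases rule: edge_pairs_cases)
      case (whiskers i j)
      then have "a i \<ge> 2" "a j \<ge> 2"
        using le[of i] le[of j] by auto
      then show ?thesis using whiskers by blast
    next
      case (mixed i j k)
      then have "a i \<ge> 1" "a j \<ge> 1" "a k \<ge> 2"
        using le[of i] le[of j] le[of k] by auto
      then show ?thesis using mixed by blast
    next
      case (cycle i j k l)
      then have "a i \<ge> 1" "a j \<ge> 1" "a k \<ge> 1" "a l \<ge> 1"
        using le[of i] le[of j] le[of k] le[of l] by auto
      then show ?thesis using cycle by blast
    qed
  next
    assume "?W \<or> ?M \<or> ?C"
    then show "nonface m t"
    proof (elim disjE exE bexE conjE)
      fix i j assume *: "i \<in> {1..m}" "j \<in> {1..m}" "i \<noteq> j" "2 \<le> a i" "2 \<le> a j"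
      show "nonface m t"
        by (rule nonfaceI[OF edge_pairs_whiskers[OF m *(1-3)]]) (use * in auto)
    next
      fix i j k assume *: "cycle_adj m i j" "k \<in> {1..m}" "k \<noteq> i" "k \<noteq> j" "1 \<le> a i" "1 \<le> a j" "2 \<le> a k"
      show "nonface m t"
        by (rule nonfaceI[OF edge_pairs_mixed[OF m *(1-4)]]) (use * in auto)
    next
      fix i j k l assume *: "cycle_adj m i j" "cycle_adj m k l" "k \<noteq> i" "k \<noteq> j" "l \<noteq> i" "l \<noteq> j"
        "1 \<le> a i" "1 \<le> a j" "1 \<le> a k" "1 \<le> a l"
      show "nonface m t"
        by (rule nonfaceI[OF edge_pairs_cycle[OF m *(1-6)]]) (use * in auto)
    qed
  qed
qed

text \<open>Pairwise intersecting edges form a star or a triangle, and triangles are excluded.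
  \<open>P\<close> selects the vertices whose induced edges are considered.\<close>

lemma intersecting_edges_common_vertex:
  assumes m: "m > 3"
    and inter: "\<And>i j k l. cycle_adj m i j \<Longrightarrow> P i \<Longrightarrow> P j \<Longrightarrow> cycle_adj m k l \<Longrightarrow> P k \<Longrightarrow> P l \<Longrightarrow>
      k = i \<or> k = j \<or> l = i \<or> l = j"
  shows "\<exists>c\<in>{1..m}. \<forall>i j. cycle_adj m i j \<longrightarrow> P i \<longrightarrow> P j \<longrightarrow> c = i \<or> c = j"
proof (cases "\<exists>k l. cycle_adj m k l \<and> P k \<and> P l")
  case False
  then show ?thesis
    using m by (intro bexI[of _ 1]) auto
next
  case True
  then obtain k l where kl: "cycle_adj m k l" "P k" "P l"
    by blast
  show ?thesis
  proof (rule ccontr)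
    assume no: "\<not> ?thesis"
    have range: "k \<in> {1..m}" "l \<in> {1..m}"
      using cycle_adj_range[OF kl(1)] by auto
    \<comment> \<open>Since \<open>k\<close> is not common to all edges, some edge avoids
      \<open>k\<close>; it meets the edge of \<open>k\<close> and \<open>l\<close>, hence at
      \<open>l\<close>. The same holds with the roles exchanged.\<close>
    have "\<exists>p. cycle_adj m l p \<and> P p \<and> p \<noteq> k"
    proof -
      obtain i j where "cycle_adj m i j" "P i" "P j" "k \<noteq> i" "k \<noteq> j"
        using no range(1) by blast
      then show ?thesis
        using inter[OF kl, of i j] cycle_adj_sym[of m i j] by blast
    qed
    moreover have "\<exists>q. cycle_adj m k q \<and> P q \<and> q \<noteq> l"
    proof -
      obtain i j where "cycle_adj m i j" "P i" "P j" "l \<noteq> i" "l \<noteq> j"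
        using no range(2) by blast
      then show ?thesis
        using inter[OF kl, of i j] cycle_adj_sym[of m i j] by blast
    qed
    ultimately obtain p q where pq: "cycle_adj m l p" "P p" "p \<noteq> k" "cycle_adj m k q" "P q" "q \<noteq> l"
      by blast
    have "k \<noteq> l"
      using kl cycle_adj_irrefl[of m k] m by auto
    \<comment> \<open>The edges from \<open>l\<close> to \<open>p\<close> and from \<open>k\<close>
      to \<open>q\<close> intersect, which leaves only this equality and closes a triangle.\<close>
    then have "p = q"
      using inter[OF pq(1) kl(3) pq(2) pq(4) kl(2) pq(5)] pq by auto
    then show False
      using cycle_triangle_free[OF m kl(1) pq(1)] pq by simp
  qed
qed

text \<open>If an exponent is at least two, it is the only one, and raising it passes no new
  threshold. If all are at most one, the edges in the support pairwise intersect; the vertex common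
  to them is raised, and a new generator would need a second square or an edge in the support
  avoiding that vertex.\<close>

lemma edge_pairs_socle:
  fixes t :: "whisker_vertex \<Rightarrow>\<^sub>0 nat"
  assumes m: "m > 3" and t: "\<not> polarized.nonface (edge_pairs m) m t"
  shows "\<exists>i\<in>{1..m}. \<not> polarized.nonface (edge_pairs m) m (Poly_Mapping.single (X i) 2 + t) \<and>
      (\<forall>j\<in>{1..m}. j \<noteq> i \<longrightarrow> Poly_Mapping.lookup t (X j) \<le> 1)"
proof -
  have m3: "m \<ge> 3"
    using m by simp
  define a where "a i = Poly_Mapping.lookup t (X i)" for i
  note t' = t[unfolded nonface_edge_pairs_iff[OF m3], folded a_def]
  have b: "Poly_Mapping.lookup (Poly_Mapping.single (X i) 2 + t) (X j) = (if j = i then a j + 2 else a j)" for i j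
    by (simp add: lookup_add lookup_single a_def)
  note iff = nonface_edge_pairs_iff[OF m3, of "Poly_Mapping.single (X i) 2 + t" for i, unfolded b]
  show ?thesis
  proof (cases "\<exists>i\<in>{1..m}. a i \<ge> 2")
    case True
    then obtain i where i: "i \<in> {1..m}" "a i \<ge> 2"
      by blast
    have "\<forall>j\<in>{1..m}. j \<noteq> i \<longrightarrow> \<not> 2 \<le> a j"
      using t' i by blast
    then have small: "\<forall>j\<in>{1..m}. j \<noteq> i \<longrightarrow> a j \<le> 1"
      by (auto simp: not_le)
    \<comment> \<open>Only the thresholds 1 and 2 occur in the description of nonfaces, and
      \<open>a i\<close> already reaches both.\<close>
    have ge: "n \<le> (if j = i then a j + 2 else a j) \<longleftrightarrow> n \<le> a j" if "n \<le> 2" for n j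
      using i that by auto
    have "\<not> polarized.nonface (edge_pairs m) m (Poly_Mapping.single (X i) 2 + t)"
      unfolding iff using t' by (simp add: ge)
    then show ?thesis
      using i(1) small by (auto simp: a_def)
  next
    case False
    then have small: "\<forall>j\<in>{1..m}. a j \<le> 1"
      by auto
    obtain c where c: "c \<in> {1..m}"
      "\<And>i j. cycle_adj m i j \<Longrightarrow> a i \<ge> 1 \<Longrightarrow> a j \<ge> 1 \<Longrightarrow> c = i \<or> c = j"
      using intersecting_edges_common_vertex[OF m, of "\<lambda>i. a i \<ge> 1"] t' by blast
    have "\<not> polarized.nonface (edge_pairs m) m (Poly_Mapping.single (X c) 2 + t)"
      unfolding iff
    proof (intro notI, elim disjE exE bexE conjE)
      fix i j assume *: "i \<in> {1..m}" "j \<in> {1..m}" "i \<noteq> j" "2 \<le> (if i = c then a i + 2 else a i)"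
        "2 \<le> (if j = c then a j + 2 else a j)"
      have "a i \<le> 1" "a j \<le> 1"
        using small *(1,2) by blast+
      then show False
        using * by (auto split: if_splits)
    next
      fix i j k assume *: "cycle_adj m i j" "k \<in> {1..m}" "k \<noteq> i" "k \<noteq> j"
        "1 \<le> (if i = c then a i + 2 else a i)" "1 \<le> (if j = c then a j + 2 else a j)"
        "2 \<le> (if k = c then a k + 2 else a k)"
      have "a k \<le> 1"
        using small *(2) by blast
      then have "k = c"
        using *(7) by (auto split: if_splits)
      then show False
        using c(2)[OF *(1)] * by auto
    next
      fix i j k l assume *: "cycle_adj m i j" "cycle_adj m k l" "k \<noteq> i" "k \<noteq> j" "l \<noteq> i" "l \<noteq> j"
        "1 \<le> (if i = c then a i + 2 else a i)" "1 \<le> (if j = c then a j + 2 else a j)"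
        "1 \<le> (if k = c then a k + 2 else a k)" "1 \<le> (if l = c then a l + 2 else a l)"
      \<comment> \<open>Of two disjoint edges at least one avoids \<open>c\<close>; its exponents
        are those of \<open>t\<close>, against the choice of \<open>c\<close>.\<close>
      show False
        using c(2)[OF *(1)] c(2)[OF *(2)] * by (cases "c = i \<or> c = j") auto
    qed
    then show ?thesis
      using c(1) small by (auto simp: a_def)
  qed
qed

text \<open>Every edge contains an \<open>X\<close>, so with \<open>X 1\<close> alone no two edges
  are disjoint. A further \<open>X k\<close> brings the whisker at \<open>k\<close>, disjoint from
  the one at 1.\<close>

lemma whiskered_cycle_facet:
  assumes m: "m \<ge> 3"
  shows "A \<in> edge_pairs m \<Longrightarrow> \<not> A \<subseteq> insert (X 1) (Y ` {1..m})"
    and "v \<in> whisker_vertices m - insert (X 1) (Y ` {1..m}) \<Longrightarrow>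
      \<exists>A\<in>edge_pairs m. A \<subseteq> insert v (insert (X 1) (Y ` {1..m}))"
proof -
  assume "A \<in> edge_pairs m"
  with m show "\<not> A \<subseteq> insert (X 1) (Y ` {1..m})"
    by (cases rule: edge_pairs_cases) (use cycle_adj_irrefl[OF m] in auto)
next
  assume "v \<in> whisker_vertices m - insert (X 1) (Y ` {1..m})"
  then obtain k where k: "v = X k" "k \<in> {1..m}" "1 \<noteq> k"
    by auto
  then show "\<exists>A\<in>edge_pairs m. A \<subseteq> insert v (insert (X 1) (Y ` {1..m}))"
    using m by (intro bexI[OF _ edge_pairs_whiskers[OF m, of 1 k]]) auto
qed

text \<open>Three vertices leave no room for two disjoint edges, whereas \<open>Y k\<close>
  completes the whisker at \<open>k\<close>, disjoint from the opposite edge. This facet has one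
  element fewer than the general one of size \<open>m + 1\<close>.\<close>

lemma whiskered_triangle_facet:
  shows "A \<in> edge_pairs 3 \<Longrightarrow> \<not> A \<subseteq> X ` {1..3}"
    and "v \<in> whisker_vertices 3 - X ` {1..3} \<Longrightarrow> \<exists>A\<in>edge_pairs 3. A \<subseteq> insert v (X ` {1..3})"
proof -
  have m: "(3::nat) \<le> 3" by simp
  assume A: "A \<in> edge_pairs 3"
  show "\<not> A \<subseteq> X ` {1..3}"
    using m A
  proof (cases rule: edge_pairs_cases)
    case (cycle i j k l)
    then have "card {i, j, k, l} = 4"
      using cycle_adj_irrefl[OF m] by (auto simp: card_insert_if)
    moreover have "card {i, j, k, l} \<le> card {1..3::nat}"
      using cycle cycle_adj_range by (intro card_mono) auto
    ultimately show ?thesis by simp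
  qed auto
next
  assume "v \<in> whisker_vertices 3 - X ` {1..3}"
  then obtain k where k: "v = Y k" "k \<in> {1..3}"
    by auto
  then have "k = 1 \<or> k = 2 \<or> k = 3"
    by auto
  then obtain i j where ij: "cycle_adj 3 i j" "k \<noteq> i" "k \<noteq> j"
  proof (elim disjE)
    assume "k = 1"
    then show ?thesis by (intro that[of 2 3]) (auto simp: cycle_adj_def)
  next
    assume "k = 2"
    then show ?thesis by (intro that[of 1 3]) (auto simp: cycle_adj_def)
  next
    assume "k = 3"
    then show ?thesis by (intro that[of 1 2]) (auto simp: cycle_adj_def)
  qed
  have "{X i, X j} \<union> {X k, Y k} \<in> edge_pairs 3"
    using edge_pairs_mixed[of 3] ij k by simp
  then show "\<exists>A\<in>edge_pairs 3. A \<subseteq> insert v (X ` {1..3})"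
    by (rule bexI[rotated]) (use cycle_adj_range[OF ij(1)] k in auto)
qed

theorem theorem5p8:
  fixes m :: nat
    and R :: "(whisker_vertex, 'k::field) mpoly ring"
  assumes "m \<ge> 3"
    and "R = poly_ring (vertices (whiskered_cycle m))"
  shows "depth R (graded_maximal_ideal (vertices (whiskered_cycle m)))
           (quotient_module R (squarefree_square (whiskered_cycle m)))
         = (if m = 3 then 3 else enat (m + 1))"
proof -
  let ?V = "whisker_vertices m"
  interpret polarized m "edge_pairs m"
    by (rule polarized_edge_pairs[OF assms(1)])
  have I: "(squarefree_square (whiskered_cycle m) :: (whisker_vertex, 'k) mpoly set) = sqf_ideal ?V (edge_pairs m)"
    using squarefree_square_eq[OF whiskered_cycle_finite_simple[OF assms(1)]]
    by (simp add: edge_pairs_def vertices_whiskered_cycle)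
  have R: "R = poly_ring ?V"
    using assms(2) by (simp add: vertices_whiskered_cycle)
  let ?M = "quotient_module R (sqf_ideal ?V (edge_pairs m))"
  let ?reg = "\<lambda>fs. set fs \<subseteq> graded_maximal_ideal ?V \<and> regular_sequence R ?M fs"
  have upper: "depth R (graded_maximal_ideal ?V) ?M \<le> enat d" if "\<And>fs. ?reg fs \<Longrightarrow> length fs \<le> d" for d
    unfolding depth_def using that by (intro Sup_least) auto
  have lower: "enat (length fs) \<le> depth R (graded_maximal_ideal ?V) ?M" if "?reg fs" for fs
    unfolding depth_def using that by (intro Sup_upper) auto
  have finV: "finite ?V"
    by simp
  show ?thesis
  proof (cases "m = 3")
    case True
    have "length fs \<le> 3" if "?reg fs" for fs
    proof -
      have "length fs \<le> card (X ` {1..m})"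
        by (rule regular_sequence_length_le_facet[of ?V _ "edge_pairs m"])
          (use that R True whiskered_triangle_facet in auto)
      then show ?thesis
        using True by (simp add: card_image inj_on_def)
    qed
    then have "depth R (graded_maximal_ideal ?V) ?M \<le> enat 3"
      by (rule upper)
    \<comment> \<open>The differences alone have length three and meet the bound.\<close>
    moreover have "?reg whisker_sequence"
      unfolding R by (intro conjI whisker_sequence_graded_maximal whisker_sequence_regular)
    then have "enat m \<le> depth R (graded_maximal_ideal ?V) ?M"
      using lower[of whisker_sequence] by (simp only: whisker_sequence_simps(1))
    ultimately have "depth R (graded_maximal_ideal ?V) ?M = enat 3"
      using True by (intro antisym) simp_all
    then show ?thesis
      using True unfolding I vertices_whiskered_cycle by (simp add: numeral_eq_enat)
  next
    case False
    then have m: "m > 3"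
      using assms(1) by simp
    have "length fs \<le> m + 1" if "?reg fs" for fs
    proof -
      have "length fs \<le> card (insert (X 1) (Y ` {1..m}))"
        by (rule regular_sequence_length_le_facet[of ?V _ "edge_pairs m"])
          (use that R assms(1) whiskered_cycle_facet[OF assms(1)] in auto)
      also have "\<dots> = m + 1"
        by (subst card_insert_disjoint) (auto simp: card_image inj_on_def)
      finally show ?thesis .
    qed
    then have "depth R (graded_maximal_ideal ?V) ?M \<le> enat (m + 1)"
      by (rule upper)
    \<comment> \<open>The sum of squares supplies the one element beyond the \<open>m\<close>
      differences, so the length equals the size of the facet.\<close>
    moreover have "?reg (whisker_sequence @ [square_sum])"
      unfolding R using whisker_sequence_graded_maximal square_sum_graded_maximal
      by (intro conjI whisker_sequence_square_sum_regular edge_pairs_socle[OF m]) auto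
    from lower[OF this] have "enat (m + 1) \<le> depth R (graded_maximal_ideal ?V) ?M"
      by (simp only: length_append whisker_sequence_simps(1) list.size) simp
    ultimately have "depth R (graded_maximal_ideal ?V) ?M = enat (m + 1)"
      by (rule antisym)
    then show ?thesis
      using False unfolding I vertices_whiskered_cycle by simp
  qed
qed

end
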